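(* Let $V^{(m^1)^\infty},\dots,V^{(m^r)^\infty}$ and $V^{(m)^\infty}$ be irreducible tame representations of $G_\infty$ with signatures $(m^i_1,\dots,m^i_{p_i},0,0,\dots)$, $1\le i\le r$, and $(m_1,\dots,m_q,0,0,\dots)$ respectively, and let $V^{(m^\vee)^\infty}$ be the representation contragredient to $V^{(m)^\infty}$, i.e. the inductive limit of the contragredient representations $V^{(m^\vee)^k}$ of $G_k$. Let $I^\infty$ denote the identity representation of $G_\infty$, realized on inverse limits of invariants. Then the multiplicity of $V^{(m)^\infty}$ in the tensor product $$V^{(m^1)^\infty}\otimes\cdots\otimes V^{(m^r)^\infty}$$ is equal to the multiplicity of $I^\infty$ in the tensor product $$V^{(m^1)^\infty}\otimes\cdots\otimes V^{(m^r)^\infty}\otimes V^{(m^\vee)^\infty}.$$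
   Context: $G_k$ denotes $U(k)$ (or $GL(k,\mathbb C)$), embedded in $G_{k+1}$ by $g\mapsto\begin{pmatrix}g&0\\0&1\end{pmatrix}$; $G_\infty=\bigcup_kG_k$; $g^\vee=(g^{-1})^T$. All signatures have entries that are nonincreasing nonnegative integers. Put $p=p_1+\dots+p_r$, $n=p+q$. Realization. Polynomial functions carry the inner product $\langle f_1,f_2\rangle=f_1(D)\overline{f_2(\bar Z)}|_{Z=0}$, where $f_1(D)$ is obtained by replacing each variable by the corresponding partial derivative. For $k\ge n$ the irreducible $G_k$-module $V^{(m^i)^k}$ of highest weight $(m^i_1,\dots,m^i_{p_i},0,\dots,0)$ is the space of polynomials $f$ on $\mathbb C^{p_i\times k}$ with $f(bZ)=b_{11}^{m^i_1}\cdots b_{p_ip_i}^{m^i_{p_i}}f(Z)$ for all invertible lower triangular $b$, with action $f(Z)\mapsto f(Zg)$; similarly for $V^{(m)^k}$ on $\mathbb C^{q\times k}$. The contragredient (dual) module $V^{(m^\vee)^k}$ is the space of polynomials $f$ on $\mathbb C^{q\times k}\ni w$ with $f(bw)=b_{11}^{m_1}\cdots b_{qq}^{m_q}f(w)$ for all invertible lower triangular $b$, with action $f(w)\mapsto f(wg^\vee)$. Functions of $k$ columns are regarded as functions of $k+1$ columns not depending on the last column; this gives isometric $G_k$-equivariant embeddings of the $k$-th modules into the $(k+1)$-st. $V^{(m^i)^\infty}$, $V^{(m)^\infty}$, $V^{(m^\vee)^\infty}$ are the corresponding inductive limits (Hilbert space completions of the unions), and the tensor products for $G_\infty$ are likewise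 the inductive limits of the tensor products for $G_k$, with the diagonal action. Multiplicity of $V^{(m)^\infty}$: the dimension of the space $\mathrm{Hom}_{G_\infty}\bigl(V^{(m)^\infty},V^{(m^1)^\infty}\otimes\cdots\otimes V^{(m^r)^\infty}\bigr)$ of continuous intertwining maps. Multiplicity of $I^\infty$: let $T_k=V^{(m^1)^k}\otimes\cdots\otimes V^{(m^r)^k}\otimes V^{(m^\vee)^k}$, realized as a space of polynomials in $(Z,w)\in\mathbb C^{p\times k}\oplus\mathbb C^{q\times k}$, where $Z$ is the matrix with row blocks $Z^1,\dots,Z^r$, $Z^i\in\mathbb C^{p_i\times k}$. For $n\le j\le k$ the truncation map $\phi^k_j:T_k\to T_j$ sets all variables in columns $j+1,\dots,k$ equal to $0$; it is $G_j$-equivariant, so $G_\infty$ acts on $\varprojlim_kT_k$. The $G_k$-invariant polynomials are generated by $P^k_{\alpha\beta}=\sum_{t=1}^kZ_{\alpha t}w_{\beta t}$ ($1\le\alpha\le p$, $1\le\beta\le q$), and $\phi^k_j(P^k_{\alpha\beta})=P^j_{\alpha\beta}$. Invariants for $G_\infty$ in the augmented tensor product are understood as elements of the inverse limit (formal infinite series, polynomial in $P_{\alpha\beta}=\sum_{t=1}^\infty Z_{\alpha t}w_{\beta t}$), not as elements of the Hilbert space. The multiplicity of $I^\infty$ is $\dim\mathrm{Hom}_{G_\infty}(\mathbb C,\varprojlim_kT_k)=\dim\varprojlim_kT_k^{G_k}$, where $\mathbb C$ is the trivial module and $T_k^{G_k}$ is the space of $G_k$-invariants. *)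

theory Defs
  imports
    "HOL-Analysis.Analysis"
    "HOL-Library.Poly_Mapping"
    "HOL-Library.Function_Algebras"
    "HOL-Library.Extended_Nat"
begin

section \<open>Complex polynomials in blocks of matrix variables\<close>

text \<open>
  The variable \<open>(b, a, t)\<close> is the entry in row \<open>a\<close> and column \<open>t\<close> of the matrix with block
  number \<open>b\<close>; rows, columns and blocks are counted from 0. Blocks \<open>0, \<dots>, r - 1\<close> are the row blocks
  \<open>Z\<^sup>1, \<dots>, Z\<^sup>r\<close> of \<open>Z\<close>, and block \<open>r\<close> is the matrix \<open>w\<close>. All numbers \<open>k\<close> of columns
  share one polynomial ring, so that regarding a function of \<open>k\<close> columns as a function of \<open>k + 1\<close>
  columns is literally an inclusion.
\<close>

type_synonym var = "nat \<times> nat \<times> nat"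
type_synonym mono = "var \<Rightarrow>\<^sub>0 nat"
type_synonym cpoly = "mono \<Rightarrow>\<^sub>0 complex"

definition Const :: "complex \<Rightarrow> cpoly" where
  "Const c = Poly_Mapping.single 0 c"

definition Monom :: "mono \<Rightarrow> cpoly" where
  "Monom \<alpha> = Poly_Mapping.single \<alpha> 1"

definition Var :: "var \<Rightarrow> cpoly" where
  "Var v = Monom (Poly_Mapping.single v 1)"

definition psubst :: "(var \<Rightarrow> cpoly) \<Rightarrow> cpoly \<Rightarrow> cpoly" where
  "psubst \<sigma> f =
    (\<Sum>\<alpha>\<in>Poly_Mapping.keys f. Const (Poly_Mapping.lookup f \<alpha>) *
      (\<Prod>v\<in>Poly_Mapping.keys \<alpha>. \<sigma> v ^ Poly_Mapping.lookup \<alpha> v))"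

definition polys :: "nat \<Rightarrow> nat \<Rightarrow> nat \<Rightarrow> cpoly set" where
  "polys b p k = {f. \<forall>\<alpha>\<in>Poly_Mapping.keys f. \<forall>(b', a, t)\<in>Poly_Mapping.keys \<alpha>.
    b' = b \<and> a < p \<and> t < k}"


section \<open>The groups\<close>

text \<open>
  A \<open>k\<close> by \<open>k\<close> matrix is represented by the infinite matrix extending it by the identity, so
  the embeddings of \<open>G\<^sub>k\<close> into \<open>G\<^sub>k\<^sub>+\<^sub>1\<close> are inclusions. The rows and columns of such a
  matrix have finite support, whence the sums below over supports.
\<close>

type_synonym cmat = "nat \<Rightarrow> nat \<Rightarrow> complex"

definition cmat_carrier :: "nat \<Rightarrow> cmat set" where
  "cmat_carrier k = {g. \<forall>i j. k \<le> i \<or> k \<le> j \<longrightarrow> g i j = (if i = j then 1 else 0)}"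

definition cmat_one :: cmat where
  "cmat_one = (\<lambda>i j. if i = j then 1 else 0)"

definition cmat_mult :: "cmat \<Rightarrow> cmat \<Rightarrow> cmat" where
  "cmat_mult g h = (\<lambda>i j. \<Sum>l\<in>{l. g i l \<noteq> 0}. g i l * h l j)"

definition cmat_transpose :: "cmat \<Rightarrow> cmat" where
  "cmat_transpose g = (\<lambda>i j. g j i)"

definition cmat_adjoint :: "cmat \<Rightarrow> cmat" where
  "cmat_adjoint g = (\<lambda>i j. cnj (g j i))"

definition GL_group :: "nat \<Rightarrow> cmat set" where
  "GL_group k = {g \<in> cmat_carrier k. \<exists>h\<in>cmat_carrier k.
    cmat_mult g h = cmat_one \<and> cmat_mult h g = cmat_one}"

definition U_group :: "nat \<Rightarrow> cmat set" where
  "U_group k = {g \<in> cmat_carrier k.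
    cmat_mult g (cmat_adjoint g) = cmat_one \<and> cmat_mult (cmat_adjoint g) g = cmat_one}"

definition group_limit :: "(nat \<Rightarrow> cmat set) \<Rightarrow> cmat set" where
  "group_limit G = (\<Union>k. G k)"

definition cmat_inverse :: "cmat \<Rightarrow> cmat" where
  "cmat_inverse g = (THE h. h \<in> (\<Union>k. cmat_carrier k) \<and>
    cmat_mult g h = cmat_one \<and> cmat_mult h g = cmat_one)"

definition cmat_dual :: "cmat \<Rightarrow> cmat" where
  "cmat_dual g = cmat_transpose (cmat_inverse g)"


section \<open>Modules for the groups \<open>G\<^sub>k\<close>\<close>

text \<open>\<open>row_subst b f\<close> is \<open>f(bZ)\<close>, with \<open>b\<close> multiplied to every block.\<close>

definition row_subst :: "cmat \<Rightarrow> cpoly \<Rightarrow> cpoly" where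
  "row_subst b = psubst (\<lambda>(i, a, t). \<Sum>c\<in>{c. b a c \<noteq> 0}. Const (b a c) * Var (i, c, t))"

text \<open>\<open>col_subst \<gamma> f\<close> replaces each block \<open>Z\<^sup>i\<close> of variables by \<open>Z\<^sup>i (\<gamma> i)\<close>.\<close>

definition col_subst :: "(nat \<Rightarrow> cmat) \<Rightarrow> cpoly \<Rightarrow> cpoly" where
  "col_subst \<gamma> = psubst (\<lambda>(i, a, t). \<Sum>s\<in>{s. \<gamma> i s t \<noteq> 0}. Var (i, a, s) * Const (\<gamma> i s t))"

definition signature :: "nat list \<Rightarrow> bool" where
  "signature m \<longleftrightarrow> sorted_wrt (\<ge>) m"

text \<open>
  The polynomials in block \<open>b\<close> underlying the module of highest weight \<open>m\<close>, and also its
  contragredient: these two modules have the same space and differ in the action.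
\<close>

definition hw_space :: "nat \<Rightarrow> nat list \<Rightarrow> nat \<Rightarrow> cpoly set" where
  "hw_space b m k = {f \<in> polys b (length m) k.
    \<forall>g\<in>GL_group (length m). (\<forall>i j. i < j \<longrightarrow> g i j = 0) \<longrightarrow>
      row_subst g f = Const (\<Prod>i<length m. g i i ^ (m ! i)) * f}"

definition act :: "cmat \<Rightarrow> cpoly \<Rightarrow> cpoly" where
  "act g = col_subst (\<lambda>_. g)"

text \<open>The diagonal action when block \<open>r\<close> carries a contragredient module.\<close>

definition act_aug :: "nat \<Rightarrow> cmat \<Rightarrow> cpoly \<Rightarrow> cpoly" where
  "act_aug r g = col_subst (\<lambda>i. if i = r then cmat_dual g else g)"

definition pscale :: "complex \<Rightarrow> cpoly \<Rightarrow> cpoly" where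
  "pscale c f = Const c * f"

lemma Const_simps:
  "Const (a + b) = Const a + Const b"
  "Const (a * b) = Const a * Const b"
  "Const 1 = 1"
  by (simp_all add: Const_def single_add mult_single flip: single_one)

interpretation pscale: vector_space pscale
  by unfold_locales (simp_all add: pscale_def Const_simps algebra_simps)

text \<open>
  Tensor products of modules on disjoint sets of variables are spanned by the products of
  polynomials.
\<close>

definition tensor_space :: "nat list list \<Rightarrow> nat \<Rightarrow> cpoly set" where
  "tensor_space ms k = pscale.span
    {(\<Prod>i<length ms. f i) | f. \<forall>i<length ms. f i \<in> hw_space i (ms ! i) k}"

definition aug_tensor_space :: "nat list list \<Rightarrow> nat list \<Rightarrow> nat \<Rightarrow> cpoly set" where
  "aug_tensor_space ms m k = pscale.span
    {(\<Prod>i<length ms. f i) * h | f h.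
      (\<forall>i<length ms. f i \<in> hw_space i (ms ! i) k) \<and> h \<in> hw_space (length ms) m k}"

text \<open>The number \<open>n = p + q\<close>.\<close>

definition stable_rank :: "nat list list \<Rightarrow> nat list \<Rightarrow> nat" where
  "stable_rank ms m = (\<Sum>\<mu>\<leftarrow>ms. length \<mu>) + length m"


section \<open>The inner product and Hilbert space completions\<close>

definition pdv :: "var \<Rightarrow> cpoly \<Rightarrow> cpoly" where
  "pdv v f = (\<Sum>\<alpha>\<in>Poly_Mapping.keys f. Poly_Mapping.single (\<alpha> - Poly_Mapping.single v 1)
    (of_nat (Poly_Mapping.lookup \<alpha> v) * Poly_Mapping.lookup f \<alpha>))"

definition pdvs :: "mono \<Rightarrow> cpoly \<Rightarrow> cpoly" where
  "pdvs \<alpha> f = Finite_Set.fold (\<lambda>v. pdv v ^^ Poly_Mapping.lookup \<alpha> v) f (Poly_Mapping.keys \<alpha>)"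

text \<open>\<open>diff_op f\<close> is the operator \<open>f(D)\<close>.\<close>

definition diff_op :: "cpoly \<Rightarrow> cpoly \<Rightarrow> cpoly" where
  "diff_op f h = (\<Sum>\<alpha>\<in>Poly_Mapping.keys f. Const (Poly_Mapping.lookup f \<alpha>) * pdvs \<alpha> h)"

text \<open>The constant coefficient is the value at \<open>Z = 0\<close>.\<close>

definition pinner :: "cpoly \<Rightarrow> cpoly \<Rightarrow> complex" where
  "pinner f1 f2 = Poly_Mapping.lookup (diff_op f1 (Poly_Mapping.map cnj f2)) 0"

text \<open>
  Completions are formed inside the Hilbert space of all formal power series
  \<open>\<Sum>\<alpha>. c\<^sub>\<alpha> Z\<^sup>\<alpha>\<close> with finite norm for which the monomials are orthogonal and have the norms
  given by \<^const>\<open>pinner\<close>. The lemmas \<open>pinner_Monom\<close>, \<open>fnorm_lookup\<close> and \<open>fock_complete\<close>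
  below show that this norm extends the one of polynomials and that the space is complete. The
  closure of a space of polynomials in it is therefore its completion.
\<close>

definition fterm :: "(mono \<Rightarrow> complex) \<Rightarrow> mono \<Rightarrow> real" where
  "fterm c \<alpha> = (cmod (c \<alpha>))\<^sup>2 * Re (pinner (Monom \<alpha>) (Monom \<alpha>))"

definition fock :: "(mono \<Rightarrow> complex) set" where
  "fock = {c. fterm c summable_on UNIV}"

definition fnorm :: "(mono \<Rightarrow> complex) \<Rightarrow> real" where
  "fnorm c = sqrt (\<Sum>\<^sub>\<infinity>\<alpha>. fterm c \<alpha>)"

definition fock_lim :: "(nat \<Rightarrow> mono \<Rightarrow> complex) \<Rightarrow> (mono \<Rightarrow> complex) \<Rightarrow> bool" where
  "fock_lim F c \<longleftrightarrow> (\<forall>j. F j \<in> fock) \<and> c \<in> fock \<and> (\<lambda>j. fnorm (F j - c)) \<longlonglongrightarrow> 0"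

definition completion :: "cpoly set \<Rightarrow> (mono \<Rightarrow> complex) set" where
  "completion W = {c. \<exists>F. (\<forall>j. F j \<in> W) \<and> fock_lim (\<lambda>j. Poly_Mapping.lookup (F j)) c}"

text \<open>The extension by continuity of an operator on \<open>W\<close> to the completion of \<open>W\<close>.\<close>

definition extend :: "cpoly set \<Rightarrow> (cpoly \<Rightarrow> cpoly) \<Rightarrow> (mono \<Rightarrow> complex) \<Rightarrow> (mono \<Rightarrow> complex)" where
  "extend W T c = (THE d. \<forall>F. (\<forall>j. F j \<in> W) \<and> fock_lim (\<lambda>j. Poly_Mapping.lookup (F j)) c
    \<longrightarrow> fock_lim (\<lambda>j. Poly_Mapping.lookup (T (F j))) d)"

definition fock_continuous_on ::
    "(mono \<Rightarrow> complex) set \<Rightarrow> ((mono \<Rightarrow> complex) \<Rightarrow> (mono \<Rightarrow> complex)) \<Rightarrow> bool" where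
  "fock_continuous_on V A \<longleftrightarrow> (\<forall>x\<in>V. \<forall>\<epsilon>>0. \<exists>\<delta>>0. \<forall>y\<in>V.
    fnorm (y - x) < \<delta> \<longrightarrow> fnorm (A y - A x) < \<epsilon>)"

subsection \<open>Relation to the inner product on polynomials\<close>

lemma lookup_pdv:
  "Poly_Mapping.lookup (pdv v f) \<beta> =
    of_nat (Suc (Poly_Mapping.lookup \<beta> v)) * Poly_Mapping.lookup f (\<beta> + Poly_Mapping.single v 1)"
proof -
  let ?e = "Poly_Mapping.single v (1::nat)"
  let ?t = "\<lambda>\<alpha>. Poly_Mapping.lookup (Poly_Mapping.single (\<alpha> - ?e)
    (of_nat (Poly_Mapping.lookup \<alpha> v) * Poly_Mapping.lookup f \<alpha>)) \<beta>"
  have nz: "\<alpha> = \<beta> + ?e" if "?t \<alpha> \<noteq> 0" for \<alpha>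
  proof -
    have b: "\<alpha> - ?e = \<beta>" and p: "Poly_Mapping.lookup \<alpha> v \<noteq> 0"
      using that by (auto simp: lookup_single when_def split: if_splits)
    show ?thesis
    proof (rule poly_mapping_eqI)
      fix u
      show "Poly_Mapping.lookup \<alpha> u = Poly_Mapping.lookup (\<beta> + ?e) u"
        using p unfolding b[symmetric]
        by (cases "u = v") (auto simp: lookup_add lookup_minus lookup_single when_def)
    qed
  qed
  have "Poly_Mapping.lookup (pdv v f) \<beta> = (\<Sum>\<alpha>\<in>Poly_Mapping.keys f. ?t \<alpha>)"
    by (simp add: pdv_def lookup_sum)
  also have "\<dots> = (\<Sum>\<alpha>\<in>{\<beta> + ?e}. ?t \<alpha>)"
    by (rule sum.mono_neutral_cong) (use nz in \<open>auto simp: in_keys_iff\<close>)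
  also have "\<dots> = of_nat (Suc (Poly_Mapping.lookup \<beta> v)) * Poly_Mapping.lookup f (\<beta> + ?e)"
    by (simp add: lookup_add lookup_single algebra_simps)
  finally show ?thesis .
qed

lemma pdv_commute: "pdv u (pdv v f) = pdv v (pdv u f)"
  by (rule poly_mapping_eqI)
    (auto simp: lookup_pdv lookup_add lookup_single when_def algebra_simps)

lemma pdv_funpow_commute1: "pdv u ((pdv v ^^ j) f) = (pdv v ^^ j) (pdv u f)"
  by (induction j) (simp_all add: pdv_commute[of u v])

lemma pdv_funpow_commute: "(pdv u ^^ i) ((pdv v ^^ j) f) = (pdv v ^^ j) ((pdv u ^^ i) f)"
  by (induction i arbitrary: f) (simp_all add: pdv_funpow_commute1)

lemma lookup_pdv_funpow:
  "fact (Poly_Mapping.lookup \<beta> v) * Poly_Mapping.lookup ((pdv v ^^ j) f) \<beta> =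
    fact (Poly_Mapping.lookup \<beta> v + j) * Poly_Mapping.lookup f (\<beta> + Poly_Mapping.single v j)"
proof (induction j arbitrary: \<beta>)
  case 0
  show ?case by simp
next
  case (Suc j)
  let ?b = "\<beta> + Poly_Mapping.single v (1::nat)"
  have s: "?b + Poly_Mapping.single v j = \<beta> + Poly_Mapping.single v (Suc j)"
    by (simp add: add.assoc single_add[symmetric])
  have l: "Poly_Mapping.lookup ?b v = Suc (Poly_Mapping.lookup \<beta> v)"
    by (simp add: lookup_add)
  show ?case
    using Suc.IH[of ?b] unfolding s l by (simp add: lookup_pdv algebra_simps)
qed

lemma lookup_pdvs_0:
  "Poly_Mapping.lookup (pdvs \<alpha> f) 0 =
    (\<Prod>v\<in>Poly_Mapping.keys \<alpha>. fact (Poly_Mapping.lookup \<alpha> v)) * Poly_Mapping.lookup f \<alpha>"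
proof -
  let ?D = "\<lambda>v. pdv v ^^ Poly_Mapping.lookup \<alpha> v"
  interpret comp_fun_commute_on UNIV ?D
    by unfold_locales (auto simp: pdv_funpow_commute)
  have gen: "Poly_Mapping.lookup (Finite_Set.fold ?D f S) \<beta> =
      (\<Prod>v\<in>S. fact (Poly_Mapping.lookup \<alpha> v)) *
        Poly_Mapping.lookup f (\<beta> + (\<Sum>v\<in>S. Poly_Mapping.single v (Poly_Mapping.lookup \<alpha> v)))"
    if "finite S" "\<forall>v\<in>S. Poly_Mapping.lookup \<beta> v = 0" for S \<beta>
    using that
  proof (induction S arbitrary: \<beta> rule: finite_induct)
    case empty
    then show ?case by simp
  next
    case (insert v S)
    let ?b = "\<beta> + Poly_Mapping.single v (Poly_Mapping.lookup \<alpha> v)"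
    have z: "\<forall>u\<in>S. Poly_Mapping.lookup ?b u = 0"
      using insert by (auto simp: lookup_add lookup_single when_def)
    have "Poly_Mapping.lookup (Finite_Set.fold ?D f (insert v S)) \<beta> =
        Poly_Mapping.lookup (?D v (Finite_Set.fold ?D f S)) \<beta>"
      using insert by simp
    also have "\<dots> = fact (Poly_Mapping.lookup \<alpha> v) * Poly_Mapping.lookup (Finite_Set.fold ?D f S) ?b"
      using lookup_pdv_funpow[of \<beta> v "Poly_Mapping.lookup \<alpha> v" "Finite_Set.fold ?D f S"] insert
      by simp
    finally show ?case
      using insert insert.IH[OF z] by (simp add: algebra_simps)
  qed
  have "(\<Sum>v\<in>Poly_Mapping.keys \<alpha>. Poly_Mapping.single v (Poly_Mapping.lookup \<alpha> v)) = \<alpha>"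
    by (rule poly_mapping_eqI)
      (auto simp: lookup_sum lookup_single when_def in_keys_iff sum.delta)
  then show ?thesis
    using gen[of "Poly_Mapping.keys \<alpha>" 0] by (simp add: pdvs_def)
qed

lemma lookup_Const_mult: "Poly_Mapping.lookup (Const c * f) \<beta> = c * Poly_Mapping.lookup f \<beta>"
  by (simp add: Const_def mult_map_scale_conv_mult[symmetric] Poly_Mapping.map.rep_eq when_def)

lemma pinner_eq:
  "pinner f1 f2 = (\<Sum>\<alpha>\<in>Poly_Mapping.keys f1.
    (\<Prod>v\<in>Poly_Mapping.keys \<alpha>. fact (Poly_Mapping.lookup \<alpha> v)) *
      (Poly_Mapping.lookup f1 \<alpha> * cnj (Poly_Mapping.lookup f2 \<alpha>)))"
  by (simp add: pinner_def diff_op_def lookup_sum lookup_Const_mult lookup_pdvs_0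
      Poly_Mapping.map.rep_eq when_def mult_ac) (intro sum.cong; simp)

lemma pinner_Monom:
  "pinner (Monom \<alpha>) (Monom \<beta>) =
    (if \<alpha> = \<beta> then \<Prod>v\<in>Poly_Mapping.keys \<alpha>. fact (Poly_Mapping.lookup \<alpha> v) else 0)"
  by (simp add: pinner_eq Monom_def lookup_single when_def)

lemma fterm_eq:
  "fterm c \<alpha> = (cmod (c \<alpha>))\<^sup>2 * (\<Prod>v\<in>Poly_Mapping.keys \<alpha>. fact (Poly_Mapping.lookup \<alpha> v))"
proof -
  have "pinner (Monom \<alpha>) (Monom \<alpha>) =
      of_real (\<Prod>v\<in>Poly_Mapping.keys \<alpha>. fact (Poly_Mapping.lookup \<alpha> v))"
    by (simp add: pinner_Monom)
  then show ?thesis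
    unfolding fterm_def by (simp only: Re_complex_of_real)
qed

lemma lookup_in_fock: "Poly_Mapping.lookup f \<in> fock"
  and fnorm_lookup: "fnorm (Poly_Mapping.lookup f) = sqrt (Re (pinner f f))"
proof -
  have z: "fterm (Poly_Mapping.lookup f) \<alpha> = 0" if "\<alpha> \<notin> Poly_Mapping.keys f" for \<alpha>
    using that by (simp add: fterm_def in_keys_iff)
  have "fterm (Poly_Mapping.lookup f) summable_on Poly_Mapping.keys f"
    by simp
  then show "Poly_Mapping.lookup f \<in> fock"
    unfolding fock_def mem_Collect_eq
    by (rule summable_on_cong_neutral[THEN iffD1, rotated -1]) (auto simp: z)
  have "(\<Sum>\<^sub>\<infinity>\<alpha>. fterm (Poly_Mapping.lookup f) \<alpha>) =
      (\<Sum>\<^sub>\<infinity>\<alpha>\<in>Poly_Mapping.keys f. fterm (Poly_Mapping.lookup f) \<alpha>)"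
    by (rule infsum_cong_neutral) (auto simp: z)
  also have "\<dots> = (\<Sum>\<alpha>\<in>Poly_Mapping.keys f. fterm (Poly_Mapping.lookup f) \<alpha>)"
    by simp
  also have "\<dots> = Re (pinner f f)"
  proof -
    have "complex_of_real (fterm (Poly_Mapping.lookup f) \<alpha>) =
        (\<Prod>v\<in>Poly_Mapping.keys \<alpha>. fact (Poly_Mapping.lookup \<alpha> v)) *
          (Poly_Mapping.lookup f \<alpha> * cnj (Poly_Mapping.lookup f \<alpha>))" for \<alpha>
      by (simp add: fterm_eq complex_norm_square[symmetric])
    then have "pinner f f =
        of_real (\<Sum>\<alpha>\<in>Poly_Mapping.keys f. fterm (Poly_Mapping.lookup f) \<alpha>)"
      by (simp add: pinner_eq)
    then show ?thesis by simp
  qed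
  finally show "fnorm (Poly_Mapping.lookup f) = sqrt (Re (pinner f f))"
    by (simp add: fnorm_def)
qed

lemma fterm_nonneg: "0 \<le> fterm c \<alpha>"
  by (simp add: fterm_eq prod_nonneg)

lemma fterm_add_le: "fterm (c + d) \<alpha> \<le> 2 * fterm c \<alpha> + 2 * fterm d \<alpha>"
proof -
  let ?w = "\<Prod>v\<in>Poly_Mapping.keys \<alpha>. fact (Poly_Mapping.lookup \<alpha> v) :: real"
  have "(cmod (c \<alpha> + d \<alpha>))\<^sup>2 \<le> (cmod (c \<alpha>) + cmod (d \<alpha>))\<^sup>2"
    by (intro power_mono norm_triangle_ineq) simp
  also have "\<dots> \<le> 2 * (cmod (c \<alpha>))\<^sup>2 + 2 * (cmod (d \<alpha>))\<^sup>2"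
    using zero_le_power2[of "cmod (c \<alpha>) - cmod (d \<alpha>)"]
    by (simp add: power2_eq_square algebra_simps)
  finally have "(cmod (c \<alpha> + d \<alpha>))\<^sup>2 * ?w \<le> (2 * (cmod (c \<alpha>))\<^sup>2 + 2 * (cmod (d \<alpha>))\<^sup>2) * ?w"
    by (rule mult_right_mono) (simp add: prod_nonneg)
  then show ?thesis
    by (simp add: fterm_eq algebra_simps)
qed

lemma fock_add:
  assumes "c \<in> fock" "d \<in> fock"
  shows "c + d \<in> fock"
proof -
  have "(\<lambda>\<alpha>. 2 * fterm c \<alpha> + 2 * fterm d \<alpha>) summable_on UNIV"
    using assms unfolding fock_def by (intro summable_on_add summable_on_cmult_right) auto
  then show ?thesis
    unfolding fock_def mem_Collect_eq
    by (rule summable_on_comparison_test) (simp_all add: fterm_add_le fterm_nonneg)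
qed

lemma fterm_uminus: "fterm (- c) = fterm c"
  by (simp add: fterm_def fun_eq_iff)

lemma fock_minus: "c \<in> fock \<Longrightarrow> d \<in> fock \<Longrightarrow> c - d \<in> fock"
  using fock_add[of c "- d"] by (simp add: fock_def fterm_uminus)

theorem fock_complete:
  assumes mem: "\<And>j. F j \<in> fock"
    and cauchy: "\<And>\<epsilon>. \<epsilon> > 0 \<Longrightarrow> \<exists>N. \<forall>i\<ge>N. \<forall>j\<ge>N. fnorm (F i - F j) < \<epsilon>"
  shows "\<exists>c. fock_lim F c"
proof -
  have part: "sum (fterm (F i - F j)) S \<le> (fnorm (F i - F j))\<^sup>2" if "finite S" for i j S
  proof -
    have "fterm (F i - F j) summable_on UNIV"
      using fock_minus[OF mem mem] by (simp add: fock_def)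
    then have "sum (fterm (F i - F j)) S \<le> (\<Sum>\<^sub>\<infinity>\<alpha>. fterm (F i - F j) \<alpha>)"
      by (rule finite_sum_le_infsum) (use that in \<open>auto simp: fterm_nonneg\<close>)
    then show ?thesis
      by (simp add: fnorm_def infsum_nonneg fterm_nonneg)
  qed
  have "Cauchy (\<lambda>j. F j \<alpha>)" for \<alpha>
  proof (rule CauchyI)
    fix \<epsilon> :: real assume "\<epsilon> > 0"
    then obtain N where N: "\<forall>i\<ge>N. \<forall>j\<ge>N. fnorm (F i - F j) < \<epsilon>"
      using cauchy by blast
    have "cmod (F i \<alpha> - F j \<alpha>) < \<epsilon>" if "i \<ge> N" "j \<ge> N" for i j
    proof -
      have one: "(1::real) \<le> (\<Prod>v\<in>Poly_Mapping.keys \<alpha>. fact (Poly_Mapping.lookup \<alpha> v))"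
        by (rule prod_ge_1) (simp add: fact_ge_1)
      have "(cmod (F i \<alpha> - F j \<alpha>))\<^sup>2 \<le> fterm (F i - F j) \<alpha>"
        using mult_left_mono[OF one, of "(cmod (F i \<alpha> - F j \<alpha>))\<^sup>2"] by (simp add: fterm_eq)
      also have "\<dots> \<le> (fnorm (F i - F j))\<^sup>2"
        using part[of "{\<alpha>}" i j] by simp
      finally have "cmod (F i \<alpha> - F j \<alpha>) \<le> fnorm (F i - F j)"
        by (rule power2_le_imp_le) (simp add: fnorm_def infsum_nonneg fterm_nonneg)
      then show ?thesis
        using N that by (meson le_less_trans)
    qed
    then show "\<exists>M. \<forall>m\<ge>M. \<forall>n\<ge>M. norm (F m \<alpha> - F n \<alpha>) < \<epsilon>"
      by blast
  qed
  then have "\<forall>\<alpha>. \<exists>x. (\<lambda>j. F j \<alpha>) \<longlonglongrightarrow> x"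
    by (simp add: Cauchy_convergent_iff convergent_def)
  then obtain c where c: "\<And>\<alpha>. (\<lambda>j. F j \<alpha>) \<longlonglongrightarrow> c \<alpha>"
    by metis
  have key: "\<exists>N. \<forall>i\<ge>N. F i - c \<in> fock \<and> fnorm (F i - c) \<le> \<epsilon>" if \<epsilon>: "\<epsilon> > 0" for \<epsilon>
  proof -
    obtain N where N: "\<forall>i\<ge>N. \<forall>j\<ge>N. fnorm (F i - F j) < \<epsilon>"
      using cauchy \<epsilon> by blast
    have "F i - c \<in> fock \<and> fnorm (F i - c) \<le> \<epsilon>" if i: "i \<ge> N" for i
    proof -
      have bd: "sum (fterm (F i - c)) S \<le> \<epsilon>\<^sup>2" if S: "finite S" for S
      proof (rule LIMSEQ_le_const2)
        show "(\<lambda>j. sum (fterm (F i - F j)) S) \<longlonglongrightarrow> sum (fterm (F i - c)) S"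
          unfolding fterm_def fun_diff_def by (intro tendsto_intros c)
        have "sum (fterm (F i - F j)) S \<le> \<epsilon>\<^sup>2" if "j \<ge> N" for j
        proof -
          have "fnorm (F i - F j) \<le> \<epsilon>" "0 \<le> fnorm (F i - F j)"
            using N i that by (auto intro: less_imp_le simp: fnorm_def infsum_nonneg fterm_nonneg)
          then show ?thesis
            using part[OF S, of i j] power_mono[of "fnorm (F i - F j)" \<epsilon> 2] by linarith
        qed
        then show "\<exists>N. \<forall>j\<ge>N. sum (fterm (F i - F j)) S \<le> \<epsilon>\<^sup>2"
          by blast
      qed
      then have s: "fterm (F i - c) summable_on UNIV"
        by (intro nonneg_bdd_above_summable_on) (auto simp: fterm_nonneg intro!: bdd_aboveI2)
      then have "(\<Sum>\<^sub>\<infinity>\<alpha>. fterm (F i - c) \<alpha>) \<le> \<epsilon>\<^sup>2"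
        by (rule infsum_le_finite_sums) (use bd in auto)
      then have "fnorm (F i - c) \<le> \<epsilon>"
        unfolding fnorm_def using \<epsilon> by (simp add: real_le_lsqrt infsum_nonneg fterm_nonneg)
      then show ?thesis
        using s by (simp add: fock_def)
    qed
    then show ?thesis by blast
  qed
  have "c \<in> fock"
  proof -
    obtain i where "F i - c \<in> fock"
      using key[of 1] by auto
    then show ?thesis
      using fock_minus[OF mem[of i], of "F i - c"] by simp
  qed
  moreover have "(\<lambda>j. fnorm (F j - c)) \<longlonglongrightarrow> 0"
  proof (rule LIMSEQ_I)
    fix \<epsilon> :: real assume "\<epsilon> > 0"
    then obtain N where "\<forall>i\<ge>N. fnorm (F i - c) \<le> \<epsilon> / 2"
      using key[of "\<epsilon> / 2"] by auto
    then show "\<exists>N. \<forall>j\<ge>N. norm (fnorm (F j - c) - 0) < \<epsilon>"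
      using \<open>\<epsilon> > 0\<close>
      by (intro exI[of _ N]) (force simp: fnorm_def infsum_nonneg fterm_nonneg)
  qed
  ultimately show ?thesis
    using mem by (auto simp: fock_lim_def)
qed


section \<open>Modules for \<open>G\<^sub>\<infinity>\<close> and multiplicities\<close>

definition hw_union :: "nat list list \<Rightarrow> nat list \<Rightarrow> cpoly set" where
  "hw_union ms m = (\<Union>k\<in>{stable_rank ms m..}. hw_space 0 m k)"

definition tensor_union :: "nat list list \<Rightarrow> nat list \<Rightarrow> cpoly set" where
  "tensor_union ms m = (\<Union>k\<in>{stable_rank ms m..}. tensor_space ms k)"

text \<open>
  The linear maps from \<open>V\<close> to \<open>W\<close> that intertwine the actions \<open>\<rho>\<close> and \<open>\<sigma>\<close> of \<open>G\<close>. They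
  are normalized to vanish outside of \<open>V\<close>, so that each map is counted once.
\<close>

definition intertwiners ::
    "cmat set \<Rightarrow> (complex \<Rightarrow> 'v \<Rightarrow> 'v::ab_group_add) \<Rightarrow> 'v set \<Rightarrow> (cmat \<Rightarrow> 'v \<Rightarrow> 'v) \<Rightarrow>
      (complex \<Rightarrow> 'w \<Rightarrow> 'w::ab_group_add) \<Rightarrow> 'w set \<Rightarrow> (cmat \<Rightarrow> 'w \<Rightarrow> 'w) \<Rightarrow> ('v \<Rightarrow> 'w) set" where
  "intertwiners G sV V \<rho> sW W \<sigma> = {A.
    (\<forall>x\<in>V. A x \<in> W) \<and> (\<forall>x. x \<notin> V \<longrightarrow> A x = 0) \<and>
    (\<forall>x\<in>V. \<forall>y\<in>V. A (x + y) = A x + A y) \<and>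
    (\<forall>c. \<forall>x\<in>V. A (sV c x) = sW c (A x)) \<and>
    (\<forall>g\<in>G. \<forall>x\<in>V. A (\<rho> g x) = \<sigma> g (A x))}"

text \<open>
  The dimension of a subspace, \<open>\<infinity>\<close> if it is not finitely generated;
  \<^const>\<open>vector_space.dim\<close> would be 0 in that case.
\<close>

definition edim :: "(complex \<Rightarrow> 'v \<Rightarrow> 'v::ab_group_add) \<Rightarrow> 'v set \<Rightarrow> enat" where
  "edim s S = (if \<exists>B. finite B \<and> S \<subseteq> module.span s B then enat (vector_space.dim s S) else \<infinity>)"

definition fscale :: "complex \<Rightarrow> (mono \<Rightarrow> complex) \<Rightarrow> (mono \<Rightarrow> complex)" where
  "fscale c x = (\<lambda>\<alpha>. c * x \<alpha>)"

definition seq_scale :: "complex \<Rightarrow> (nat \<Rightarrow> cpoly) \<Rightarrow> (nat \<Rightarrow> cpoly)" where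
  "seq_scale c s = (\<lambda>k. pscale c (s k))"

definition map_scale :: "(complex \<Rightarrow> 'w \<Rightarrow> 'w) \<Rightarrow> complex \<Rightarrow> ('v \<Rightarrow> 'w) \<Rightarrow> ('v \<Rightarrow> 'w)" where
  "map_scale sW c A = (\<lambda>x. sW c (A x))"

lemma vector_space_fun:
  assumes "vector_space sW"
  shows "vector_space (\<lambda>c A x. sW c (A x))"
proof -
  interpret vector_space sW by fact
  show ?thesis
    by unfold_locales (simp_all add: fun_eq_iff algebra_simps)
qed

text \<open>The scalings whose dimensions are taken below satisfy the vector space axioms.\<close>

lemma vector_space_map_fscale: "vector_space (map_scale fscale)"
  and vector_space_map_seq_scale: "vector_space (map_scale seq_scale)"
proof -
  have "vector_space ((*) :: complex \<Rightarrow> complex \<Rightarrow> complex)"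
    by unfold_locales (simp_all add: algebra_simps)
  then have "vector_space fscale"
    unfolding fscale_def by (rule vector_space_fun)
  then show "vector_space (map_scale fscale)"
    unfolding map_scale_def by (rule vector_space_fun)
  have "vector_space seq_scale"
    unfolding seq_scale_def by (rule vector_space_fun) (rule pscale.vector_space_axioms)
  then show "vector_space (map_scale seq_scale)"
    unfolding map_scale_def by (rule vector_space_fun)
qed

definition hom_tensor ::
    "(nat \<Rightarrow> cmat set) \<Rightarrow> nat list list \<Rightarrow> nat list \<Rightarrow> ((mono \<Rightarrow> complex) \<Rightarrow> (mono \<Rightarrow> complex)) set" where
  "hom_tensor G ms m =
    {A \<in> intertwiners (group_limit G)
        fscale (completion (hw_union ms m)) (\<lambda>g. extend (hw_union ms m) (act g))
        fscale (completion (tensor_union ms m)) (\<lambda>g. extend (tensor_union ms m) (act g)).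
      fock_continuous_on (completion (hw_union ms m)) A}"

definition multiplicity_tensor :: "(nat \<Rightarrow> cmat set) \<Rightarrow> nat list list \<Rightarrow> nat list \<Rightarrow> enat" where
  "multiplicity_tensor G ms m = edim (map_scale fscale) (hom_tensor G ms m)"

text \<open>\<open>trunc j\<close> sets the variables outside of the first \<open>j\<close> columns equal to 0.\<close>

definition trunc :: "nat \<Rightarrow> cpoly \<Rightarrow> cpoly" where
  "trunc j = psubst (\<lambda>(i, a, t). if t < j then Var (i, a, t) else 0)"

text \<open>
  The inverse limit over \<open>k \<ge> n\<close>; the irrelevant components with \<open>k < n\<close> are normalized to 0.
\<close>

definition inverse_limit :: "nat list list \<Rightarrow> nat list \<Rightarrow> (nat \<Rightarrow> cpoly) set" where
  "inverse_limit ms m = {s.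
    (\<forall>k\<ge>stable_rank ms m. s k \<in> aug_tensor_space ms m k) \<and>
    (\<forall>j k. stable_rank ms m \<le> j \<and> j \<le> k \<longrightarrow> trunc j (s k) = s j) \<and>
    (\<forall>k<stable_rank ms m. s k = 0)}"

text \<open>
  An element \<open>g\<close> of \<open>G\<^sub>l\<close> acts on all components with \<open>k \<ge> l\<close>. The other components of
  the result are truncations of these.
\<close>

definition act_limit ::
    "(nat \<Rightarrow> cmat set) \<Rightarrow> nat list list \<Rightarrow> nat list \<Rightarrow> cmat \<Rightarrow> (nat \<Rightarrow> cpoly) \<Rightarrow> (nat \<Rightarrow> cpoly)" where
  "act_limit G ms m g s = (\<lambda>j. if j < stable_rank ms m then 0
    else trunc j (act_aug (length ms) g (s (LEAST k. j \<le> k \<and> g \<in> G k))))"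

definition hom_identity ::
    "(nat \<Rightarrow> cmat set) \<Rightarrow> nat list list \<Rightarrow> nat list \<Rightarrow> (complex \<Rightarrow> (nat \<Rightarrow> cpoly)) set" where
  "hom_identity G ms m =
    intertwiners (group_limit G) (*) UNIV (\<lambda>g z. z) seq_scale (inverse_limit ms m) (act_limit G ms m)"

definition multiplicity_identity :: "(nat \<Rightarrow> cmat set) \<Rightarrow> nat list list \<Rightarrow> nat list \<Rightarrow> enat" where
  "multiplicity_identity G ms m = edim (map_scale seq_scale) (hom_identity G ms m)"

end

theory Submission
  imports Defs
begin

text \<open>
  For the pairing \<open>(f, h) = \<Sum>\<alpha>. \<alpha>! f\<^sub>\<alpha> h\<^sub>\<alpha>\<close> the action by \<open>g\<close> is dual to the one by \<open>g\<^sup>\<or>\<close>.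
  Contraction of the last tensor factor therefore turns an invariant of \<open>T\<^sub>k\<close> into an intertwining map
  \<open>V\<^sub>k \<rightarrow> W\<^sub>k\<close>, where \<open>V\<^sub>k\<close> has signature \<open>m\<close> and \<open>W\<^sub>k\<close> is the tensor product of the modules of
  signatures \<open>m\<^sup>i\<close>, and an orthonormal basis of \<open>V\<^sub>k\<close> provides the inverse. Vectors that depend only on
  the first \<open>k\<close> columns are characterized by being fixed by the diagonal matrices that act on the other
  columns. Hence intertwining maps respect the filtrations by \<open>k\<close>, and the sequences of invariants that
  are compatible with truncation correspond to the intertwining maps \<open>T\<close> from \<open>\<Union>V\<^sub>k\<close> to \<open>\<Union>W\<^sub>k\<close>.
  Every such \<open>T\<close> is bounded, so that it extends to the completions: the form \<open>\<langle>T f, T h\<rangle>\<close> on \<open>V\<^sub>k\<close> is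
  invariant under \<open>U(k)\<close> and thus a multiple of the inner product, by uniqueness and cyclicity of the
  highest weight vector, and the factor does not depend on \<open>k\<close> because the \<open>V\<^sub>k\<close> are nested.
\<close>

text \<open>Two obstacles shape the argument. Invariants are formal series outside the Hilbert
  space, whereas the intertwining maps to be counted act between completions. The maps between the
  unions of polynomial spaces mediate, since they involve neither limit. That a continuous
  intertwining map sends polynomials to polynomials comes from the torus argument applied to the
  coefficients of a power series. The other obstacle is that GL does not act by isometries, so that
  even its action on the completions has to be shown bounded. All vectors of a module have one
  common degree, and a bound in each degree suffices.

  Truncation of invariants matches restriction of maps because truncation is self-adjoint for the
  pairing and fixes the polynomials in the first j columns. Uniqueness and cyclicity of the highest
  weight vector are statements about values of polynomials: up to limits, row operations and torus
  or unitary column operations carry any matrix to the first rows of the identity. Dimensions are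
  compared by bijections that are linear, so that finite and infinite multiplicities are treated
  alike.\<close>

abbreviation coef :: "('a \<Rightarrow>\<^sub>0 'b::zero) \<Rightarrow> 'a \<Rightarrow> 'b" where
  "coef \<equiv> Poly_Mapping.lookup"

abbreviation keys :: "('a \<Rightarrow>\<^sub>0 'b::zero) \<Rightarrow> 'a set" where
  "keys \<equiv> Poly_Mapping.keys"

abbreviation single :: "'a \<Rightarrow> 'b \<Rightarrow> 'a \<Rightarrow>\<^sub>0 'b::zero" where
  "single \<equiv> Poly_Mapping.single"

subsection \<open>Evaluation\<close>

definition mev :: "(var \<Rightarrow> complex) \<Rightarrow> mono \<Rightarrow> complex" where
  "mev x \<alpha> = (\<Prod>v\<in>keys \<alpha>. x v ^ coef \<alpha> v)"

definition pev :: "(var \<Rightarrow> complex) \<Rightarrow> cpoly \<Rightarrow> complex" where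
  "pev x f = (\<Sum>\<alpha>\<in>keys f. coef f \<alpha> * mev x \<alpha>)"

text \<open>Products and sums over the supports of different arguments are compared over a common
  finite superset; the later \<open>superset\<close> lemmas serve the same end.\<close>

lemma mev_superset:
  assumes "finite S" "keys \<alpha> \<subseteq> S"
  shows "mev x \<alpha> = (\<Prod>v\<in>S. x v ^ coef \<alpha> v)"
  unfolding mev_def using assms
  by (intro prod.mono_neutral_left) (auto simp: in_keys_iff)

lemma mev_add: "mev x (\<alpha> + \<beta>) = mev x \<alpha> * mev x \<beta>"
proof -
  let ?S = "keys \<alpha> \<union> keys \<beta>"
  have "mev x (\<alpha> + \<beta>) = (\<Prod>v\<in>?S. x v ^ coef (\<alpha> + \<beta>) v)"
    by (rule mev_superset) (use Poly_Mapping.keys_add[of \<alpha> \<beta>] in auto)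
  also have "\<dots> = (\<Prod>v\<in>?S. x v ^ coef \<alpha> v) * (\<Prod>v\<in>?S. x v ^ coef \<beta> v)"
    by (simp add: lookup_add power_add prod.distrib)
  also have "\<dots> = mev x \<alpha> * mev x \<beta>"
    by (simp add: mev_superset[of ?S])
  finally show ?thesis .
qed

lemma mev_0 [simp]: "mev x 0 = 1"
  by (simp add: mev_def)

lemma mev_single [simp]: "mev x (single v n) = x v ^ n"
  by (cases "n = 0") (simp_all add: mev_def)

lemma mev_cong: "(\<And>v. v \<in> keys \<alpha> \<Longrightarrow> x v = y v) \<Longrightarrow> mev x \<alpha> = mev y \<alpha>"
  by (simp add: mev_def)

lemma pev_superset:
  assumes "finite S" "keys f \<subseteq> S"
  shows "pev x f = (\<Sum>\<alpha>\<in>S. coef f \<alpha> * mev x \<alpha>)"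
  unfolding pev_def using assms
  by (intro sum.mono_neutral_left) (auto simp: in_keys_iff)

lemma pev_add: "pev x (f + g) = pev x f + pev x g"
proof -
  let ?S = "keys f \<union> keys g"
  have "pev x (f + g) = (\<Sum>\<alpha>\<in>?S. coef (f + g) \<alpha> * mev x \<alpha>)"
    by (rule pev_superset) (use Poly_Mapping.keys_add[of f g] in auto)
  then show ?thesis
    by (simp add: pev_superset[of ?S] lookup_add distrib_right sum.distrib)
qed

lemma pev_0 [simp]: "pev x 0 = 0"
  by (simp add: pev_def)

lemma pev_single: "pev x (single \<alpha> c) = c * mev x \<alpha>"
  by (cases "c = 0") (simp_all add: pev_def)

lemma pev_sum: "pev x (\<Sum>i\<in>I. f i) = (\<Sum>i\<in>I. pev x (f i))"
  by (induction I rule: infinite_finite_induct) (simp_all add: pev_add)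

lemma pev_uminus: "pev x (- f) = - pev x f"
  using pev_add[of x f "- f"] by (simp add: add_eq_0_iff)

lemma pev_diff: "pev x (f - g) = pev x f - pev x g"
  using pev_add[of x f "- g"] by (simp add: pev_uminus)

lemma poly_mapping_eq_sum: "(f :: 'a \<Rightarrow>\<^sub>0 'b::comm_monoid_add) = (\<Sum>\<alpha>\<in>keys f. single \<alpha> (coef f \<alpha>))"
  by (rule poly_mapping_eqI)
    (auto simp: lookup_sum lookup_single when_def in_keys_iff sum.delta)

lemma pev_mult: "pev x (f * g) = pev x f * pev x g"
proof -
  have "f * g = (\<Sum>\<alpha>\<in>keys f. single \<alpha> (coef f \<alpha>)) * (\<Sum>\<beta>\<in>keys g. single \<beta> (coef g \<beta>))"
    by (simp flip: poly_mapping_eq_sum)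
  also have "pev x \<dots> = pev x f * pev x g"
    by (simp add: sum_product pev_sum mult_single pev_single mev_add)
      (simp add: pev_def sum_product mult_ac)
  finally show ?thesis .
qed

lemma pev_Const [simp]: "pev x (Const c) = c"
  by (simp add: Const_def pev_single)

lemma pev_1 [simp]: "pev x 1 = 1"
  by (simp flip: Const_simps(3))

lemma pev_Monom: "pev x (Monom \<alpha>) = mev x \<alpha>"
  by (simp add: Monom_def pev_single)

lemma pev_Var [simp]: "pev x (Var v) = x v"
  by (simp add: Var_def pev_Monom)

lemma pev_prod: "pev x (\<Prod>i\<in>I. f i) = (\<Prod>i\<in>I. pev x (f i))"
  by (induction I rule: infinite_finite_induct) (simp_all add: pev_mult)

lemma pev_power: "pev x (f ^ n) = pev x f ^ n"
  by (induction n) (simp_all add: pev_mult)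

lemma pev_pscale: "pev x (pscale c f) = c * pev x f"
  by (simp add: pscale_def pev_mult)

lemma pev_cong:
  assumes "\<And>\<alpha> v. \<alpha> \<in> keys f \<Longrightarrow> v \<in> keys \<alpha> \<Longrightarrow> x v = y v"
  shows "pev x f = pev y f"
  unfolding pev_def by (intro sum.cong refl arg_cong2[where f = "(*)"] mev_cong assms)

lemma coef_0_eq_pev: "coef f 0 = pev (\<lambda>_. 0) f"
proof -
  have "mev (\<lambda>_. 0) \<alpha> = (if \<alpha> = 0 then 1 else 0)" for \<alpha>
    using keys_eq_empty[of \<alpha>] by (auto simp: mev_def in_keys_iff simp del: keys_eq_empty)
  then have "pev (\<lambda>_. 0) f = (\<Sum>\<alpha>\<in>keys f. if \<alpha> = 0 then coef f \<alpha> else 0)"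
    unfolding pev_def by (intro sum.cong) auto
  then show ?thesis
    by (simp add: sum.delta in_keys_iff)
qed

lemma pev_psubst: "pev x (psubst \<sigma> f) = pev (\<lambda>v. pev x (\<sigma> v)) f"
  by (simp add: psubst_def pev_sum pev_mult pev_prod pev_power)
    (simp add: pev_def[of "\<lambda>v. pev x (\<sigma> v)"] mev_def)

lemma coef_pscale [simp]: "coef (pscale c f) \<alpha> = c * coef f \<alpha>"
  by (simp add: pscale_def lookup_Const_mult)

lemma uni_poly_coeffs_0:
  fixes c :: "nat \<Rightarrow> complex"
  assumes "finite N" "\<And>z. (\<Sum>n\<in>N. c n * z ^ n) = 0" "n \<in> N"
  shows "c n = 0"
proof -
  define p where "p = (\<Sum>n\<in>N. Polynomial.monom (c n) n)"
  have "poly p z = 0" for z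
    using assms(2)[of z] by (simp add: p_def poly_sum poly_monom)
  then have "p = 0"
    using poly_all_0_iff_0 by blast
  moreover have "poly.coeff p n = c n"
    using assms(1,3) by (simp add: p_def coeff_sum)
  ultimately show ?thesis by simp
qed

text \<open>Induction on the set of variables: the coefficients of the powers of one variable are
  polynomials in the others, and each of them vanishes identically.\<close>

lemma poly_eq_0I:
  assumes "\<And>x. pev x f = 0"
  shows "f = 0"
proof -
  have "f = 0" if "finite X" "\<forall>\<alpha>\<in>keys f. keys \<alpha> \<subseteq> X" "\<And>x. pev x f = 0" for X f
    using that
  proof (induction X arbitrary: f rule: finite_induct)
    case empty
    then have k: "keys f \<subseteq> {0}" by auto
    have "coef f 0 = 0"
      using empty by (simp add: coef_0_eq_pev)
    with k show ?case
      by (metis in_keys_iff keys_eq_empty subset_singletonD singletonI)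
  next
    case (insert v X)
    define N where "N = (\<lambda>\<alpha>. coef \<alpha> v) ` keys f"
    define g where "g n = (\<Sum>\<alpha>\<in>{\<alpha>\<in>keys f. coef \<alpha> v = n}. single (\<alpha> - single v n) (coef f \<alpha>))" for n
    have split: "\<alpha> = (\<alpha> - single v n) + single v n" if "coef \<alpha> v = n" for \<alpha> :: mono and n
      by (rule poly_mapping_eqI) (use that in \<open>auto simp: lookup_add lookup_minus lookup_single when_def\<close>)
    have gk: "\<exists>\<alpha>\<in>keys f. coef \<alpha> v = n \<and> \<beta> = \<alpha> - single v n" if "\<beta> \<in> keys (g n)" for \<beta> n
      using that keys_sum[of "\<lambda>\<alpha>. single (\<alpha> - single v n) (coef f \<alpha>)" "{\<alpha>\<in>keys f. coef \<alpha> v = n}"]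
      by (fastforce simp: g_def split: if_splits)
    have kX: "keys \<beta> \<subseteq> X" if \<beta>: "\<beta> \<in> keys (g n)" for \<beta> n
    proof
      fix u assume u: "u \<in> keys \<beta>"
      obtain \<alpha> where a: "\<alpha> \<in> keys f" "coef \<alpha> v = n" "\<beta> = \<alpha> - single v n"
        using gk[OF \<beta>] by blast
      have "u \<noteq> v" "u \<in> keys \<alpha>"
        using u a by (auto simp: in_keys_iff lookup_minus lookup_single when_def split: if_splits)
      then show "u \<in> X" using insert.prems(1) a by auto
    qed
    have pe: "pev x f = (\<Sum>n\<in>N. pev x (g n) * x v ^ n)" for x
    proof -
      have "(\<Sum>n\<in>N. pev x (g n) * x v ^ n) =
          (\<Sum>n\<in>N. \<Sum>\<alpha>\<in>{\<alpha>\<in>keys f. coef \<alpha> v = n}. coef f \<alpha> * mev x \<alpha>)"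
      proof (intro sum.cong refl)
        fix n
        have "pev x (single (\<alpha> - single v n) (coef f \<alpha>)) * x v ^ n = coef f \<alpha> * mev x \<alpha>"
          if "coef \<alpha> v = n" for \<alpha>
          using arg_cong[OF split[OF that], of "mev x"] by (simp add: pev_single mev_add)
        then show "pev x (g n) * x v ^ n = (\<Sum>\<alpha>\<in>{\<alpha>\<in>keys f. coef \<alpha> v = n}. coef f \<alpha> * mev x \<alpha>)"
          by (simp add: g_def pev_sum sum_distrib_right)
      qed
      also have "\<dots> = pev x f"
        unfolding N_def pev_def by (rule sum.image_gen[symmetric]) simp
      finally show ?thesis by simp
    qed
    have fin: "finite N" by (simp add: N_def)
    have g0: "g n = 0" if n: "n \<in> N" for n
    proof (rule insert.IH)
      show "\<forall>\<alpha>\<in>keys (g n). keys \<alpha> \<subseteq> X" using kX by blast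
      fix x
      have "pev (x(v := z)) (g n) = pev x (g n)" for z n
        by (rule pev_cong) (use kX \<open>v \<notin> X\<close> in auto)
      then have "(\<Sum>n\<in>N. pev x (g n) * z ^ n) = 0" for z
        using pe[of "x(v := z)"] insert.prems(2) by simp
      then show "pev x (g n) = 0"
        using uni_poly_coeffs_0[OF fin _ n, of "\<lambda>n. pev x (g n)"] by blast
    qed
    show ?case
    proof (rule poly_mapping_eqI)
      fix \<alpha>
      show "coef f \<alpha> = coef 0 \<alpha>"
      proof (cases "\<alpha> \<in> keys f")
        case True
        let ?n = "coef \<alpha> v"
        have "coef (g ?n) (\<alpha> - single v ?n) =
            (\<Sum>\<beta>\<in>{\<beta>\<in>keys f. coef \<beta> v = ?n}. if \<beta> = \<alpha> then coef f \<beta> else 0)"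
        proof -
          have "\<beta> = \<alpha>" if "\<beta> - single v ?n = \<alpha> - single v ?n" "coef \<beta> v = ?n" for \<beta>
            using split[OF that(2)] split[of \<alpha> ?n] that(1) by simp
          then show ?thesis
            unfolding g_def lookup_sum lookup_single when_def by (intro sum.cong refl if_cong) auto
        qed
        also have "\<dots> = coef f \<alpha>"
          using True by (simp add: sum.delta)
        finally show ?thesis
          using g0[of ?n] True by (simp add: N_def)
      qed (simp add: in_keys_iff)
    qed
  qed
  from this[of "\<Union>\<alpha>\<in>keys f. keys \<alpha>" f] assms show ?thesis by auto
qed

text \<open>Together with \<open>pev_psubst\<close> this reduces every identity between
  substitutions to one between the points at which a polynomial is evaluated.\<close>

lemma poly_ext: "(\<And>x. pev x f = pev x g) \<Longrightarrow> f = g"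
  using poly_eq_0I[of "f - g"] by (simp add: pev_diff)

subsection \<open>Linear substitutions\<close>

type_synonym vmat = "var \<Rightarrow> var \<Rightarrow> complex"

text \<open>Row and column operations, truncation, scaling of variables and the exchange of blocks
  are all of this form, so that the chain rule and the adjoint need to be established only
  once.\<close>

definition lsubst :: "vmat \<Rightarrow> cpoly \<Rightarrow> cpoly" where
  "lsubst M = psubst (\<lambda>v. \<Sum>u\<in>{u. M v u \<noteq> 0}. Const (M v u) * Var u)"

definition vapply :: "vmat \<Rightarrow> (var \<Rightarrow> complex) \<Rightarrow> var \<Rightarrow> complex" where
  "vapply M x v = (\<Sum>u\<in>{u. M v u \<noteq> 0}. M v u * x u)"

lemma pev_lsubst: "pev x (lsubst M f) = pev (vapply M x) f"
  by (simp add: lsubst_def pev_psubst pev_sum pev_mult vapply_def[abs_def])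

lemma vapply_superset:
  "finite S \<Longrightarrow> {u. M v u \<noteq> 0} \<subseteq> S \<Longrightarrow> vapply M x v = (\<Sum>u\<in>S. M v u * x u)"
  unfolding vapply_def by (intro sum.mono_neutral_left) auto

lemma lsubst_add: "lsubst M (f + g) = lsubst M f + lsubst M g"
  by (rule poly_ext) (simp add: pev_lsubst pev_add)

lemma lsubst_mult: "lsubst M (f * g) = lsubst M f * lsubst M g"
  by (rule poly_ext) (simp add: pev_lsubst pev_mult)

lemma lsubst_Const [simp]: "lsubst M (Const c) = Const c"
  by (rule poly_ext) (simp add: pev_lsubst)

lemma lsubst_1 [simp]: "lsubst M 1 = 1"
  by (rule poly_ext) (simp add: pev_lsubst)

lemma lsubst_0 [simp]: "lsubst M 0 = 0"
  by (rule poly_ext) (simp add: pev_lsubst)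

lemma lsubst_pscale: "lsubst M (pscale c f) = pscale c (lsubst M f)"
  by (simp add: pscale_def lsubst_mult)

lemma lsubst_diff: "lsubst M (f - g) = lsubst M f - lsubst M g"
  by (rule poly_ext) (simp add: pev_lsubst pev_diff)

lemma lsubst_sum: "lsubst M (\<Sum>i\<in>I. f i) = (\<Sum>i\<in>I. lsubst M (f i))"
  by (rule poly_ext) (simp add: pev_lsubst pev_sum)

lemma lsubst_prod: "lsubst M (\<Prod>i\<in>I. f i) = (\<Prod>i\<in>I. lsubst M (f i))"
  by (rule poly_ext) (simp add: pev_lsubst pev_prod)

lemma lsubst_Var: "lsubst M (Var v) = (\<Sum>u\<in>{u. M v u \<noteq> 0}. Const (M v u) * Var u)"
  by (rule poly_ext) (simp add: pev_lsubst pev_sum pev_mult vapply_def)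

section \<open>Row and column operations as linear substitutions\<close>

definition row_mat :: "cmat \<Rightarrow> vmat" where
  "row_mat b = (\<lambda>(i, a, t) (j, c, s). if i = j \<and> t = s then b a c else 0)"

definition col_mat :: "(nat \<Rightarrow> cmat) \<Rightarrow> vmat" where
  "col_mat \<gamma> = (\<lambda>(i, a, t) (j, c, s). if i = j \<and> a = c then \<gamma> i s t else 0)"

lemma row_subst_eq: "row_subst b = lsubst (row_mat b)"
  unfolding row_subst_def lsubst_def
proof (rule arg_cong[where f = psubst], rule ext, clarsimp)
  fix i a t
  have "{u. row_mat b (i, a, t) u \<noteq> 0} = (\<lambda>c. (i, c, t)) ` {c. b a c \<noteq> 0}"
    by (auto simp: row_mat_def split: if_splits)
  then show "(\<Sum>c | b a c \<noteq> 0. Const (b a c) * Var (i, c, t)) =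
      (\<Sum>u | row_mat b (i, a, t) u \<noteq> 0. Const (row_mat b (i, a, t) u) * Var u)"
    by (simp add: sum.reindex inj_on_def) (simp add: row_mat_def)
qed

lemma col_subst_eq: "col_subst \<gamma> = lsubst (col_mat \<gamma>)"
  unfolding col_subst_def lsubst_def
proof (rule arg_cong[where f = psubst], rule ext, clarsimp)
  fix i a t
  have "{u. col_mat \<gamma> (i, a, t) u \<noteq> 0} = (\<lambda>s. (i, a, s)) ` {s. \<gamma> i s t \<noteq> 0}"
    by (auto simp: col_mat_def split: if_splits)
  then show "(\<Sum>s | \<gamma> i s t \<noteq> 0. Var (i, a, s) * Const (\<gamma> i s t)) =
      (\<Sum>u | col_mat \<gamma> (i, a, t) u \<noteq> 0. Const (col_mat \<gamma> (i, a, t) u) * Var u)"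
    by (simp add: sum.reindex inj_on_def) (simp add: col_mat_def mult.commute)
qed

definition proj :: "nat \<Rightarrow> cmat" where
  "proj k = (\<lambda>s t. if s = t \<and> t < k then 1 else 0)"

text \<open>Truncation is multiplication of the columns by a singular matrix. It therefore inherits
  what is proved below for column substitutions by arbitrary matrices.\<close>

lemma trunc_eq: "trunc k = col_subst (\<lambda>_. proj k)"
  unfolding trunc_def col_subst_def
proof (rule arg_cong[where f = psubst], rule ext)
  fix v :: var
  obtain i a t where v: "v = (i, a, t)" by (cases v)
  have "{s. proj k s t \<noteq> 0} = (if t < k then {t} else {})"
    by (auto simp: proj_def)
  then show "(case v of (i, a, t) \<Rightarrow> if t < k then Var (i, a, t) else 0) =
      (case v of (i, a, t) \<Rightarrow> \<Sum>s | proj k s t \<noteq> 0. Var (i, a, s) * Const (proj k s t))"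
    by (simp add: v) (simp add: proj_def Const_simps)
qed

lemma vapply_col: "vapply (col_mat \<gamma>) x (i, a, t) = (\<Sum>s\<in>{s. \<gamma> i s t \<noteq> 0}. \<gamma> i s t * x (i, a, s))"
proof -
  have "{u. col_mat \<gamma> (i, a, t) u \<noteq> 0} = (\<lambda>s. (i, a, s)) ` {s. \<gamma> i s t \<noteq> 0}"
    by (auto simp: col_mat_def split: if_splits)
  then show ?thesis
    unfolding vapply_def by (simp add: sum.reindex inj_on_def) (simp add: col_mat_def)
qed

lemma vapply_row: "vapply (row_mat b) x (i, a, t) = (\<Sum>c\<in>{c. b a c \<noteq> 0}. b a c * x (i, c, t))"
proof -
  have "{u. row_mat b (i, a, t) u \<noteq> 0} = (\<lambda>c. (i, c, t)) ` {c. b a c \<noteq> 0}"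
    by (auto simp: row_mat_def split: if_splits)
  then show ?thesis
    unfolding vapply_def by (simp add: sum.reindex inj_on_def) (simp add: row_mat_def)
qed

text \<open>Products occur only with a single variable because the adjoint of such a multiplication
  is known: it is the partial derivative.\<close>

lemma cpoly_induct [case_names Const Var_mult add]:
  assumes C: "\<And>c. P (Const c)" and V: "\<And>v f. P f \<Longrightarrow> P (Var v * f)"
    and A: "\<And>f g. P f \<Longrightarrow> P g \<Longrightarrow> P (f + g)"
  shows "P f"
proof -
  have m: "P (single \<alpha> c)" for \<alpha> c
  proof (induction \<alpha> rule: Poly_Mapping.update_induct)
    case const
    then show ?case using C by (simp add: Const_def)
  next
    case (update \<alpha> v n)
    have "Poly_Mapping.update v n \<alpha> = single v n + \<alpha>"
      by (rule poly_mapping_eqI)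
        (use update in \<open>auto simp: lookup_update lookup_add lookup_single when_def in_keys_iff\<close>)
    moreover have "P (single (single v n + \<alpha>) c)" for n
    proof (induction n)
      case (Suc n)
      have "single (single v (Suc n) + \<alpha>) c = Var v * single (single v n + \<alpha>) c"
        by (simp add: Var_def Monom_def mult_single add.assoc[symmetric] single_add[symmetric])
      then show ?case using V[OF Suc] by simp
    qed (use update in simp)
    ultimately show ?case by simp
  qed
  have "P (\<Sum>\<alpha>\<in>A. single \<alpha> (coef f \<alpha>))" for A
    by (induction A rule: infinite_finite_induct) (use m A C[of 0] in \<open>auto simp: Const_def\<close>)
  then show ?thesis
    using poly_mapping_eq_sum[of f] by metis
qed

subsection \<open>The pairing and the inner product\<close>

text \<open>The factorial of a multi-index, which is the squared norm of the monomial
  \<open>Monom \<alpha>\<close>.\<close>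

definition mfact :: "mono \<Rightarrow> real" where
  "mfact \<alpha> = (\<Prod>v\<in>keys \<alpha>. fact (coef \<alpha> v))"

lemma mfact_pos: "0 < mfact \<alpha>"
  by (simp add: mfact_def prod_pos)

lemma fterm_mfact: "fterm c \<alpha> = mfact \<alpha> * (cmod (c \<alpha>))\<^sup>2"
  by (simp add: fterm_eq mfact_def)

lemma mfact_superset: "finite S \<Longrightarrow> keys \<alpha> \<subseteq> S \<Longrightarrow> mfact \<alpha> = (\<Prod>v\<in>S. fact (coef \<alpha> v))"
  unfolding mfact_def by (intro prod.mono_neutral_left) (auto simp: in_keys_iff)

lemma mfact_add_single: "mfact (\<alpha> + single v 1) = real (Suc (coef \<alpha> v)) * mfact \<alpha>"
proof -
  let ?S = "insert v (keys \<alpha>)"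
  have "mfact (\<alpha> + single v 1) = (\<Prod>u\<in>?S. fact (coef (\<alpha> + single v 1) u))"
    by (rule mfact_superset) (use Poly_Mapping.keys_add[of \<alpha> "single v 1"] in auto)
  also have "\<dots> = fact (Suc (coef \<alpha> v)) * (\<Prod>u\<in>?S - {v}. fact (coef \<alpha> u))"
    by (subst prod.remove[of _ v])
      (auto simp: lookup_add lookup_single when_def simp del: fact_Suc intro!: prod.cong split: if_splits)
  also have "\<dots> = real (Suc (coef \<alpha> v)) * (fact (coef \<alpha> v) * (\<Prod>u\<in>?S - {v}. fact (coef \<alpha> u)))"
    by simp
  also have "fact (coef \<alpha> v) * (\<Prod>u\<in>?S - {v}. fact (coef \<alpha> u)) = (\<Prod>u\<in>?S. fact (coef \<alpha> u))"
    by (subst (2) prod.remove[of _ v]) auto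
  also have "\<dots> = mfact \<alpha>"
    by (rule mfact_superset[symmetric]) auto
  finally show ?thesis .
qed

definition pcnj :: "cpoly \<Rightarrow> cpoly" where
  "pcnj = Poly_Mapping.map cnj"

lemma coef_pcnj [simp]: "coef (pcnj f) \<alpha> = cnj (coef f \<alpha>)"
  by (simp add: pcnj_def Poly_Mapping.map.rep_eq when_def)

lemma keys_pcnj [simp]: "keys (pcnj f) = keys f"
  by (auto simp: in_keys_iff)

lemma pcnj_pcnj [simp]: "pcnj (pcnj f) = f"
  by (rule poly_mapping_eqI) simp

lemma pcnj_add: "pcnj (f + g) = pcnj f + pcnj g"
  by (rule poly_mapping_eqI) (simp add: lookup_add)

lemma pcnj_0 [simp]: "pcnj 0 = 0"
  by (rule poly_mapping_eqI) simp

lemma pcnj_pscale: "pcnj (pscale c f) = pscale (cnj c) (pcnj f)"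
  by (rule poly_mapping_eqI) simp

lemma pcnj_sum: "pcnj (\<Sum>i\<in>I. f i) = (\<Sum>i\<in>I. pcnj (f i))"
  by (induction I rule: infinite_finite_induct) (simp_all add: pcnj_add)

lemma pev_pcnj: "pev x (pcnj f) = cnj (pev (\<lambda>v. cnj (x v)) f)"
  by (simp add: pev_def mev_def)

lemma pinner_superset:
  assumes "finite S" "keys f \<subseteq> S"
  shows "pinner f h = (\<Sum>\<alpha>\<in>S. of_real (mfact \<alpha>) * (coef f \<alpha> * cnj (coef h \<alpha>)))"
  unfolding pinner_eq mfact_def using assms
  by (auto intro!: sum.mono_neutral_left simp: in_keys_iff)

lemma pinner_add_left: "pinner (f + g) h = pinner f h + pinner g h"
proof -
  let ?S = "keys f \<union> keys g"
  have "pinner (f + g) h = (\<Sum>\<alpha>\<in>?S. of_real (mfact \<alpha>) * (coef (f + g) \<alpha> * cnj (coef h \<alpha>)))"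
    by (rule pinner_superset) (use Poly_Mapping.keys_add[of f g] in auto)
  then show ?thesis
    by (simp add: pinner_superset[of ?S] lookup_add algebra_simps sum.distrib)
qed

lemma pinner_commute: "pinner f h = cnj (pinner h f)"
  by (simp add: pinner_superset[of "keys f \<union> keys h"] mult_ac)

lemma pinner_add_right: "pinner h (f + g) = pinner h f + pinner h g"
  by (subst (1 2 3) pinner_commute) (simp add: pinner_add_left)

lemma pinner_scale_left: "pinner (pscale c f) h = c * pinner f h"
proof -
  have "pinner (pscale c f) h = (\<Sum>\<alpha>\<in>keys f. of_real (mfact \<alpha>) * (coef (pscale c f) \<alpha> * cnj (coef h \<alpha>)))"
    by (rule pinner_superset) (auto simp: in_keys_iff)
  then show ?thesis
    by (simp add: pinner_superset[of "keys f"] sum_distrib_left mult_ac)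
qed

lemma pinner_scale_right: "pinner h (pscale c f) = cnj c * pinner h f"
  by (subst (1 2) pinner_commute) (simp add: pinner_scale_left)

lemma pinner_0 [simp]: "pinner 0 h = 0" "pinner h 0 = 0"
  using pinner_scale_left[of 0 h h] pinner_scale_right[of h 0 h] by simp_all

lemma pinner_sum_left: "pinner (\<Sum>i\<in>I. f i) h = (\<Sum>i\<in>I. pinner (f i) h)"
  by (induction I rule: infinite_finite_induct) (simp_all add: pinner_add_left)

lemma pinner_sum_right: "pinner h (\<Sum>i\<in>I. f i) = (\<Sum>i\<in>I. pinner h (f i))"
  by (induction I rule: infinite_finite_induct) (simp_all add: pinner_add_right)

lemma pinner_diff_left: "pinner (f - g) h = pinner f h - pinner g h"
  using pinner_add_left[of "f - g" g h] by simp

lemma pinner_diff_right: "pinner h (f - g) = pinner h f - pinner h g"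
  using pinner_add_right[of h "f - g" g] by simp

text \<open>The bilinear companion of the inner product. Its adjoints are plain transposes without
  conjugation, as needed for the contragredient action of GL.\<close>

definition bil :: "cpoly \<Rightarrow> cpoly \<Rightarrow> complex" where
  "bil f h = pinner f (pcnj h)"

lemma pinner_bil: "pinner f h = bil f (pcnj h)"
  by (simp add: bil_def)

lemma bil_superset:
  assumes "finite S" "keys f \<subseteq> S"
  shows "bil f h = (\<Sum>\<alpha>\<in>S. of_real (mfact \<alpha>) * (coef f \<alpha> * coef h \<alpha>))"
  by (simp add: bil_def pinner_superset[OF assms])

lemma bil_commute: "bil f h = bil h f"
  by (simp add: bil_superset[of "keys f \<union> keys h"] mult_ac)

lemma bil_add_left: "bil (f + g) h = bil f h + bil g h"
  by (simp add: bil_def pinner_add_left)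

lemma bil_add_right: "bil h (f + g) = bil h f + bil h g"
  by (simp add: bil_commute[of h] bil_add_left)

lemma bil_scale_left: "bil (pscale c f) h = c * bil f h"
  by (simp add: bil_def pinner_scale_left)

lemma bil_scale_right: "bil h (pscale c f) = c * bil h f"
  by (simp add: bil_commute[of h] bil_scale_left)

lemma bil_0 [simp]: "bil 0 h = 0" "bil h 0 = 0"
  by (simp_all add: bil_def)

lemma bil_sum_left: "bil (\<Sum>i\<in>I. f i) h = (\<Sum>i\<in>I. bil (f i) h)"
  by (simp add: bil_def pinner_sum_left)

lemma bil_sum_right: "bil h (\<Sum>i\<in>I. f i) = (\<Sum>i\<in>I. bil h (f i))"
  by (simp add: bil_commute[of h] bil_sum_left)

lemma bil_Const: "bil (Const c) h = c * coef h 0"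
  by (cases "c = 0") (simp_all add: bil_superset[of "{0}"] Const_def mfact_def)

section \<open>Multiplication by a variable and differentiation\<close>

lemma coef_Var_mult:
  "coef (Var v * f) \<beta> = (if coef \<beta> v = 0 then 0 else coef f (\<beta> - single v 1))"
proof -
  have eq: "single v 1 + \<alpha> = \<beta> \<longleftrightarrow> coef \<beta> v \<noteq> 0 \<and> \<alpha> = \<beta> - single v 1" for \<alpha> :: mono
  proof
    assume h: "coef \<beta> v \<noteq> 0 \<and> \<alpha> = \<beta> - single v 1"
    show "single v 1 + \<alpha> = \<beta>"
      by (rule poly_mapping_eqI) (use h in \<open>auto simp: lookup_add lookup_minus lookup_single when_def\<close>)
  qed (auto simp: lookup_add)
  have "Var v * f = Var v * (\<Sum>\<alpha>\<in>keys f. single \<alpha> (coef f \<alpha>))"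
    by (simp flip: poly_mapping_eq_sum)
  then have "coef (Var v * f) \<beta> = (\<Sum>\<alpha>\<in>keys f. coef (single (single v 1 + \<alpha>) (coef f \<alpha>)) \<beta>)"
    by (simp add: Var_def Monom_def sum_distrib_left mult_single lookup_sum)
  also have "\<dots> = (\<Sum>\<alpha>\<in>keys f. if \<alpha> = \<beta> - single v 1 then (if coef \<beta> v = 0 then 0 else coef f \<alpha>) else 0)"
    unfolding lookup_single when_def eq by (intro sum.cong) auto
  also have "\<dots> = (if coef \<beta> v = 0 then 0 else coef f (\<beta> - single v 1))"
    by (simp add: sum.delta in_keys_iff)
  finally show ?thesis .
qed

lemma pdv_add: "pdv v (f + g) = pdv v f + pdv v g"
  by (rule poly_mapping_eqI) (simp add: lookup_pdv lookup_add algebra_simps)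

lemma pdv_pscale: "pdv v (pscale c f) = pscale c (pdv v f)"
  by (rule poly_mapping_eqI) (simp add: lookup_pdv)

lemma pdv_Const [simp]: "pdv v (Const c) = 0"
proof (rule poly_mapping_eqI)
  fix \<beta> :: mono
  have "\<beta> + single v 1 \<noteq> 0"
    by (metis add_eq_0_iff_both_eq_0 lookup_add lookup_single_eq lookup_zero one_neq_zero)
  then show "coef (pdv v (Const c)) \<beta> = coef 0 \<beta>"
    by (simp add: lookup_pdv Const_def lookup_single when_def del: One_nat_def)
qed

lemma pdv_0 [simp]: "pdv v 0 = 0"
  by (rule poly_mapping_eqI) (simp add: lookup_pdv)

lemma pdv_sum: "pdv v (\<Sum>i\<in>I. f i) = (\<Sum>i\<in>I. pdv v (f i))"
  by (induction I rule: infinite_finite_induct) (simp_all add: pdv_add)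

lemma pdv_pcnj: "pdv v (pcnj f) = pcnj (pdv v f)"
  by (rule poly_mapping_eqI) (simp add: lookup_pdv)

lemma pdv_Var_mult: "pdv u (Var v * f) = (if u = v then f else 0) + Var v * pdv u f"
proof (rule poly_mapping_eqI)
  fix \<beta> :: mono
  show "coef (pdv u (Var v * f)) \<beta> = coef ((if u = v then f else 0) + Var v * pdv u f) \<beta>"
  proof (cases "u = v")
    case True
    have "\<beta> - single v 1 + single v 1 = \<beta>" if "coef \<beta> v \<noteq> 0"
      by (rule poly_mapping_eqI)
        (use that in \<open>auto simp: lookup_add lookup_minus lookup_single when_def\<close>)
    then show ?thesis
      using True
      by (cases "coef \<beta> v")
        (simp_all add: lookup_add lookup_pdv coef_Var_mult lookup_minus distrib_right del: One_nat_def)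
  next
    case False
    have "\<beta> + single u 1 - single v 1 = \<beta> - single v 1 + single u 1" if "coef \<beta> v \<noteq> 0"
      by (rule poly_mapping_eqI)
        (use that False in \<open>auto simp: lookup_add lookup_minus lookup_single when_def\<close>)
    then show ?thesis
      using False
      by (auto simp: lookup_add lookup_pdv coef_Var_mult lookup_minus lookup_single when_def
          simp del: One_nat_def)
  qed
qed

lemma coef_Var_mult_pdv: "coef (Var v * pdv v f) \<beta> = of_nat (coef \<beta> v) * coef f \<beta>"
proof -
  have "\<beta> - single v 1 + single v 1 = \<beta>" if "coef \<beta> v \<noteq> 0"
    by (rule poly_mapping_eqI)
      (use that in \<open>auto simp: lookup_add lookup_minus lookup_single when_def\<close>)
  then show ?thesis
    by (simp add: lookup_pdv coef_Var_mult lookup_minus algebra_simps of_nat_diff del: One_nat_def)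
qed

text \<open>The factor that the factorial weight gains when the exponent of \<open>v\<close> is
  raised by one is the factor produced by differentiation.\<close>

lemma bil_Var_mult: "bil (Var v * f) h = bil f (pdv v h)"
proof -
  let ?s = "\<lambda>\<alpha>. \<alpha> + single v (1::nat)"
  have "keys (Var v * f) \<subseteq> ?s ` keys f"
  proof
    fix \<beta> assume "\<beta> \<in> keys (Var v * f)"
    then have b: "coef \<beta> v \<noteq> 0" "\<beta> - single v 1 \<in> keys f"
      by (auto simp: in_keys_iff coef_Var_mult split: if_splits)
    have "\<beta> = ?s (\<beta> - single v 1)"
      by (rule poly_mapping_eqI)
        (use b(1) in \<open>auto simp: lookup_add lookup_minus lookup_single when_def\<close>)
    then show "\<beta> \<in> ?s ` keys f" using b(2) by blast
  qed
  then have "bil (Var v * f) h =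
      (\<Sum>\<beta>\<in>?s ` keys f. of_real (mfact \<beta>) * (coef (Var v * f) \<beta> * coef h \<beta>))"
    by (intro bil_superset) auto
  also have "\<dots> = (\<Sum>\<alpha>\<in>keys f. of_real (mfact (?s \<alpha>)) * (coef (Var v * f) (?s \<alpha>) * coef h (?s \<alpha>)))"
    by (simp add: sum.reindex inj_on_def)
  also have "\<dots> = bil f (pdv v h)"
    unfolding bil_superset[of "keys f" f, OF finite_keys subset_refl]
    by (intro sum.cong refl)
      (simp add: coef_Var_mult lookup_add mfact_add_single[unfolded One_nat_def] lookup_pdv)
  finally show ?thesis .
qed

text \<open>Finite rows are needed for \<open>lsubst M\<close> and finite columns for the transposed
  substitution, because a sum over an infinite support is 0.\<close>

definition lfin :: "vmat \<Rightarrow> bool" where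
  "lfin M \<longleftrightarrow> (\<forall>v. finite {u. M v u \<noteq> 0}) \<and> (\<forall>u. finite {v. M v u \<noteq> 0})"

text \<open>The chain rule for a linear substitution.\<close>

lemma pdv_lsubst:
  assumes M: "lfin M"
  shows "pdv u (lsubst M h) = (\<Sum>v\<in>{v. M v u \<noteq> 0}. pscale (M v u) (lsubst M (pdv v h)))"
proof (induction h rule: cpoly_induct)
  case (Const c)
  show ?case by simp
next
  case (add f g)
  then show ?case
    by (simp add: lsubst_add pdv_add pscale.scale_right_distrib sum.distrib)
next
  case (Var_mult v' h)
  let ?C = "{v. M v u \<noteq> 0}"
  have C: "finite ?C" and R: "finite {w. M v' w \<noteq> 0}"
    using M unfolding lfin_def by blast+
  have "pdv u (lsubst M (Var v' * h)) =
      (\<Sum>w\<in>{w. M v' w \<noteq> 0}. pdv u (pscale (M v' w) (Var w * lsubst M h)))"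
    by (simp add: lsubst_mult lsubst_Var sum_distrib_right pdv_sum pscale_def mult.assoc)
  also have "\<dots> = (\<Sum>w\<in>{w. M v' w \<noteq> 0}. if u = w then pscale (M v' w) (lsubst M h) else 0) +
      (\<Sum>w\<in>{w. M v' w \<noteq> 0}. Const (M v' w) * Var w) * pdv u (lsubst M h)"
    unfolding sum_distrib_right sum.distrib[symmetric]
    by (intro sum.cong refl) (simp add: pdv_pscale pdv_Var_mult, simp add: pscale_def algebra_simps)
  also have "(\<Sum>w\<in>{w. M v' w \<noteq> 0}. if u = w then pscale (M v' w) (lsubst M h) else 0) =
      pscale (M v' u) (lsubst M h)"
    using R by (simp add: sum.delta')
  also have "\<dots> = (\<Sum>v\<in>?C. if v = v' then pscale (M v' u) (lsubst M h) else 0)"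
    using C by (simp add: sum.delta)
  also have "(\<Sum>w\<in>{w. M v' w \<noteq> 0}. Const (M v' w) * Var w) * pdv u (lsubst M h) =
      (\<Sum>v\<in>?C. pscale (M v u) (lsubst M (Var v' * pdv v h)))"
    unfolding Var_mult by (simp add: lsubst_mult lsubst_Var sum_distrib_left pscale_def mult_ac)
  finally show ?case
    unfolding sum.distrib[symmetric]
    by (auto intro!: sum.cong simp: pdv_Var_mult lsubst_add pscale.scale_right_distrib)
qed

text \<open>Induction on \<open>f\<close>: a variable crosses the pairing as a derivative, and the
  chain rule for the transposed substitution collects the terms. Constants see only the value of
  \<open>h\<close> at the origin, which linear substitutions preserve.\<close>

lemma bil_lsubst:
  assumes M: "lfin M"
  shows "bil (lsubst M f) h = bil f (lsubst (\<lambda>u v. M v u) h)"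
proof (induction f arbitrary: h rule: cpoly_induct)
  case (Const c)
  have "coef (lsubst N h) 0 = coef h 0" for N
    by (simp add: coef_0_eq_pev pev_lsubst vapply_def[abs_def])
  then show ?case by (simp add: bil_Const)
next
  case (add f g)
  then show ?case by (simp add: lsubst_add bil_add_left)
next
  case (Var_mult v f)
  have M': "lfin (\<lambda>u v. M v u)" using M unfolding lfin_def by blast
  have "bil (lsubst M (Var v * f)) h = (\<Sum>u\<in>{u. M v u \<noteq> 0}. M v u * bil (Var u * lsubst M f) h)"
    by (simp add: lsubst_mult lsubst_Var sum_distrib_right bil_sum_left mult.assoc
        bil_scale_left[unfolded pscale_def])
  also have "\<dots> = (\<Sum>u\<in>{u. M v u \<noteq> 0}. M v u * bil f (lsubst (\<lambda>u v. M v u) (pdv u h)))"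
    by (simp add: bil_Var_mult Var_mult)
  also have "\<dots> = bil f (pdv v (lsubst (\<lambda>u v. M v u) h))"
    by (simp add: pdv_lsubst[OF M'] bil_sum_right bil_scale_right)
  finally show ?case by (simp add: bil_Var_mult)
qed

lemma pcnj_lsubst: "pcnj (lsubst M f) = lsubst (\<lambda>v u. cnj (M v u)) (pcnj f)"
  by (rule poly_ext) (simp add: pev_pcnj pev_lsubst vapply_def[abs_def])

lemma pinner_lsubst:
  assumes M: "lfin M"
  shows "pinner (lsubst M f) h = pinner f (lsubst (\<lambda>u v. cnj (M v u)) h)"
  unfolding pinner_bil pcnj_lsubst bil_lsubst[OF M] by simp

subsection \<open>Orthonormal bases\<close>

definition pnsq :: "cpoly \<Rightarrow> real" where
  "pnsq f = Re (pinner f f)"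

lemma pnsq_superset:
  assumes "finite S" "keys f \<subseteq> S"
  shows "pnsq f = (\<Sum>\<alpha>\<in>S. mfact \<alpha> * (cmod (coef f \<alpha>))\<^sup>2)"
proof -
  have "complex_of_real (mfact \<alpha> * (cmod (coef f \<alpha>))\<^sup>2) =
      of_real (mfact \<alpha>) * (coef f \<alpha> * cnj (coef f \<alpha>))" for \<alpha>
    by (simp add: complex_norm_square[symmetric])
  then have "pinner f f = of_real (\<Sum>\<alpha>\<in>S. mfact \<alpha> * (cmod (coef f \<alpha>))\<^sup>2)"
    by (simp only: pinner_superset[OF assms] of_real_sum)
  then show ?thesis by (simp add: pnsq_def)
qed

lemma pnsq_nonneg: "0 \<le> pnsq f"
  by (simp add: pnsq_superset[of "keys f"] sum_nonneg mfact_pos less_imp_le)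

lemma pinner_self: "pinner f f = of_real (pnsq f)"
proof -
  have "Im (pinner f f) = 0"
    using pinner_commute[of f f] by (metis Im_complex_of_real complex_cnj_cancel_iff Reals_cnj_iff complex_is_Real_iff)
  then show ?thesis by (simp add: complex_eq_iff pnsq_def)
qed

lemma pnsq_eq_0_iff: "pnsq f = 0 \<longleftrightarrow> f = 0"
proof
  assume "pnsq f = 0"
  then have "\<forall>\<alpha>\<in>keys f. mfact \<alpha> * (cmod (coef f \<alpha>))\<^sup>2 = 0"
    by (simp add: pnsq_superset[of "keys f"] sum_nonneg_eq_0_iff mfact_pos less_imp_le)
  then have "coef f \<alpha> = 0" for \<alpha>
    using mfact_pos[of \<alpha>] by (cases "\<alpha> \<in> keys f") (force simp: in_keys_iff)+
  then show "f = 0" by (intro poly_mapping_eqI) simp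
qed (simp add: pnsq_def)

lemma pnsq_0 [simp]: "pnsq 0 = 0"
  by (simp add: pnsq_eq_0_iff)

lemma pnsq_pscale: "pnsq (pscale c f) = (cmod c)\<^sup>2 * pnsq f"
proof -
  have "pnsq (pscale c f) = (\<Sum>\<alpha>\<in>keys f. mfact \<alpha> * (cmod (coef (pscale c f) \<alpha>))\<^sup>2)"
    by (rule pnsq_superset) (auto simp: in_keys_iff)
  then show ?thesis
    by (simp add: pnsq_superset[of "keys f"] sum_distrib_left norm_mult power_mult_distrib mult_ac)
qed

lemma fnorm_coef: "fnorm (coef f) = sqrt (pnsq f)"
  by (simp add: fnorm_lookup pnsq_def)

text \<open>Induction on the set of monomials. The vectors without the new monomial form a subspace
  of codimension at most one, so at most one basis vector has to be added.\<close>

lemma onb_exists: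
  assumes "finite M" "pscale.subspace S" "\<And>f. f \<in> S \<Longrightarrow> keys f \<subseteq> M"
  shows "\<exists>E. finite E \<and> E \<subseteq> S \<and> (\<forall>e\<in>E. \<forall>e'\<in>E. pinner e e' = (if e = e' then 1 else 0)) \<and>
    (\<forall>f\<in>S. f = (\<Sum>e\<in>E. pscale (pinner f e) e))"
  using assms
proof (induction M arbitrary: S rule: finite_induct)
  case empty
  then have "\<forall>f\<in>S. f = 0" by (metis keys_eq_empty subset_empty)
  then show ?case by (intro exI[of _ "{}"]) simp
next
  case (insert \<alpha> M)
  note sub = insert.prems(1)
  let ?S = "{f\<in>S. coef f \<alpha> = 0}"
  have sub': "pscale.subspace ?S"
    using sub by (auto simp: pscale.subspace_def lookup_add)
  have "keys f \<subseteq> M" if "f \<in> ?S" for f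
    using that insert.prems(2)[of f] by (auto simp: in_keys_iff)
  from insert.IH[OF sub' this] obtain E where E: "finite E" "E \<subseteq> ?S"
    "\<forall>e\<in>E. \<forall>e'\<in>E. pinner e e' = (if e = e' then 1 else 0)"
    "\<forall>f\<in>?S. f = (\<Sum>e\<in>E. pscale (pinner f e) e)" by blast
  show ?case
  proof (cases "?S = S")
    case True
    with E show ?thesis by (intro exI[of _ E]) (simp only: True)
  next
    case False
    then obtain f0 where f0: "f0 \<in> S" "coef f0 \<alpha> \<noteq> 0" by blast
    have ES: "E \<subseteq> S" using E(2) by blast
    \<comment> \<open>Gram-Schmidt: the part of \<open>f0\<close> orthogonal to \<open>E\<close>.
      Its coefficient at \<open>\<alpha>\<close> survives because the elements of \<open>E\<close>
      have none there.\<close>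
    define e1 where "e1 = f0 - (\<Sum>e\<in>E. pscale (pinner f0 e) e)"
    have e1S: "e1 \<in> S" unfolding e1_def
      by (intro pscale.subspace_diff[OF sub] f0 pscale.subspace_sum[OF sub] pscale.subspace_scale[OF sub])
        (use ES in auto)
    have e1a: "coef e1 \<alpha> \<noteq> 0"
    proof -
      have "(\<Sum>e\<in>E. pinner f0 e * coef e \<alpha>) = 0" using E(2) by (intro sum.neutral) auto
      then show ?thesis using f0 by (simp add: e1_def lookup_minus lookup_sum)
    qed
    then have n: "pnsq e1 > 0"
      using pnsq_nonneg[of e1] pnsq_eq_0_iff[of e1] by (cases "e1 = 0") auto
    define e2 where "e2 = pscale (of_real (1 / sqrt (pnsq e1))) e1"
    have orth1: "pinner e1 e = 0" if "e \<in> E" for e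
    proof -
      have "(\<Sum>e'\<in>E. pinner f0 e' * pinner e' e) = (\<Sum>e'\<in>E. if e' = e then pinner f0 e' else 0)"
        using E(3) that by (intro sum.cong) auto
      also have "\<dots> = pinner f0 e" using E(1) that by (simp add: sum.delta)
      finally show ?thesis
        by (simp add: e1_def pinner_diff_left pinner_sum_left pinner_scale_left)
    qed
    have orth: "pinner e2 e = 0" "pinner e e2 = 0" if "e \<in> E" for e
      using orth1[OF that] pinner_commute[of e e1]
      by (simp_all add: e2_def pinner_scale_left pinner_scale_right)
    have nrm: "pinner e2 e2 = 1"
      using n by (simp add: e2_def pinner_self pnsq_pscale norm_divide power_divide)
    have e2S: "e2 \<in> S" and e2a: "coef e2 \<alpha> \<noteq> 0"
      using e1S e1a n pscale.subspace_scale[OF sub] by (auto simp: e2_def)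
    have e2E: "e2 \<notin> E" using e2a E(2) by auto
    have rep: "f = (\<Sum>e\<in>insert e2 E. pscale (pinner f e) e)" if f: "f \<in> S" for f
    proof -
      let ?a = "coef f \<alpha> / coef e2 \<alpha>"
      let ?g = "f - pscale ?a e2"
      have "?g \<in> ?S"
        using e2a by (simp add: lookup_minus pscale.subspace_diff[OF sub f] pscale.subspace_scale[OF sub e2S])
      then have g: "?g = (\<Sum>e\<in>E. pscale (pinner ?g e) e)" using E(4) by blast
      also have "\<dots> = (\<Sum>e\<in>E. pscale (pinner f e) e)"
        by (intro sum.cong refl) (simp add: pinner_diff_left pinner_scale_left orth)
      finally have f2: "f = pscale ?a e2 + (\<Sum>e\<in>E. pscale (pinner f e) e)"
        by (simp add: algebra_simps)
      have "pinner f e2 = ?a"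
        by (subst f2) (simp add: pinner_add_left pinner_scale_left pinner_sum_left nrm orth sum.neutral)
      with f2 show ?thesis using E(1) e2E by simp
    qed
    show ?thesis
      using E ES e2S nrm orth rep by (intro exI[of _ "insert e2 E"]) auto
  qed
qed

text \<open>The Riesz vector, written down in an orthonormal basis of \<open>S\<close>;
  \<open>L\<close> is linear on \<open>S\<close> only.\<close>

lemma functional_representation:
  assumes "finite M" "pscale.subspace S" "\<And>f. f \<in> S \<Longrightarrow> keys f \<subseteq> M"
    and L: "\<And>f g. f \<in> S \<Longrightarrow> g \<in> S \<Longrightarrow> L (f + g) = L f + L g"
      "\<And>c f. f \<in> S \<Longrightarrow> L (pscale c f) = c * L f"
  shows "\<exists>\<phi>\<in>S. \<forall>f\<in>S. L f = pinner f \<phi>"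
proof -
  obtain E where E: "finite E" "E \<subseteq> S" "\<forall>f\<in>S. f = (\<Sum>e\<in>E. pscale (pinner f e) e)"
    using onb_exists[OF assms(1-3)] by blast
  have L0: "L 0 = 0"
    using L(2)[of 0 0] pscale.subspace_0[OF assms(2)] by simp
  have sum: "L (\<Sum>e\<in>A. pscale (c e) e) = (\<Sum>e\<in>A. c e * L e)" if "A \<subseteq> S" "finite A" for A c
    using that(2,1)
  proof (induction A rule: finite_induct)
    case (insert e A)
    then show ?case
      by (simp add: L pscale.subspace_scale[OF assms(2)] pscale.subspace_sum[OF assms(2)] subset_iff)
  qed (simp add: L0)
  show ?thesis
  proof (intro bexI ballI)
    show "(\<Sum>e\<in>E. pscale (cnj (L e)) e) \<in> S"
      using E(2) by (intro pscale.subspace_sum[OF assms(2)] pscale.subspace_scale[OF assms(2)]) auto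
    fix f assume "f \<in> S"
    then have "f = (\<Sum>e\<in>E. pscale (pinner f e) e)" using E(3) by blast
    then have "L f = L (\<Sum>e\<in>E. pscale (pinner f e) e)" by (rule arg_cong)
    also have "\<dots> = (\<Sum>e\<in>E. pinner f e * L e)" using E by (intro sum) auto
    finally show "L f = pinner f (\<Sum>e\<in>E. pscale (cnj (L e)) e)"
      by (simp add: pinner_sum_right pinner_scale_right mult_ac)
  qed
qed

subsection \<open>Homogeneous polynomials\<close>

definition deg :: "mono \<Rightarrow> nat" where
  "deg \<alpha> = (\<Sum>v\<in>keys \<alpha>. coef \<alpha> v)"

lemma deg_superset: "finite S \<Longrightarrow> keys \<alpha> \<subseteq> S \<Longrightarrow> deg \<alpha> = (\<Sum>v\<in>S. coef \<alpha> v)"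
  unfolding deg_def by (intro sum.mono_neutral_left) (auto simp: in_keys_iff)

lemma deg_add: "deg (\<alpha> + \<beta>) = deg \<alpha> + deg \<beta>"
proof -
  let ?S = "keys \<alpha> \<union> keys \<beta>"
  have "deg (\<alpha> + \<beta>) = (\<Sum>v\<in>?S. coef (\<alpha> + \<beta>) v)"
    by (rule deg_superset) (use Poly_Mapping.keys_add[of \<alpha> \<beta>] in auto)
  then show ?thesis
    by (simp add: deg_superset[of ?S] lookup_add sum.distrib)
qed

lemma deg_single [simp]: "deg (single v n) = n"
  by (simp add: deg_def)

definition homog :: "nat \<Rightarrow> cpoly \<Rightarrow> bool" where
  "homog d f \<longleftrightarrow> (\<forall>\<alpha>\<in>keys f. deg \<alpha> = d)"

lemma mev_const: "mev (\<lambda>_. z) \<alpha> = z ^ deg \<alpha>"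
  by (simp add: mev_def deg_def power_sum)

lemma finite_monos: "finite X \<Longrightarrow> finite {\<alpha>::mono. keys \<alpha> \<subseteq> X \<and> deg \<alpha> = d}"
proof (induction d)
  case 0
  have "{\<alpha>::mono. keys \<alpha> \<subseteq> X \<and> deg \<alpha> = 0} \<subseteq> {0}"
    by (auto simp: deg_def in_keys_iff intro!: poly_mapping_eqI)
  then show ?case using finite_subset by blast
next
  case (Suc d)
  have "{\<alpha>::mono. keys \<alpha> \<subseteq> X \<and> deg \<alpha> = Suc d} \<subseteq>
      (\<Union>v\<in>X. (\<lambda>\<alpha>. \<alpha> + single v 1) ` {\<alpha>. keys \<alpha> \<subseteq> X \<and> deg \<alpha> = d})"
  proof clarify
    fix \<alpha> :: mono assume a: "keys \<alpha> \<subseteq> X" "deg \<alpha> = Suc d"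
    then have "keys \<alpha> \<noteq> {}" by (auto simp: deg_def)
    then obtain v where v: "v \<in> keys \<alpha>" by blast
    have e: "\<alpha> = (\<alpha> - single v 1) + single v 1"
      by (rule poly_mapping_eqI)
        (use v in \<open>auto simp: lookup_add lookup_minus lookup_single when_def in_keys_iff\<close>)
    have "deg (\<alpha> - single v 1) = d"
      using a(2) arg_cong[OF e, of deg] by (simp add: deg_add del: One_nat_def)
    moreover have "keys (\<alpha> - single v 1) \<subseteq> X"
      using a(1) by (auto simp: in_keys_iff lookup_minus)
    ultimately show "\<alpha> \<in> (\<Union>v\<in>X. (\<lambda>\<alpha>. \<alpha> + single v 1) ` {\<alpha>. keys \<alpha> \<subseteq> X \<and> deg \<alpha> = d})"
      using e v a(1) by blast
  qed
  moreover have "finite (\<Union>v\<in>X. (\<lambda>\<alpha>. \<alpha> + single v 1) ` {\<alpha>::mono. keys \<alpha> \<subseteq> X \<and> deg \<alpha> = d})"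
    using Suc by auto
  ultimately show ?case by (rule finite_subset)
qed

section \<open>Scalings of the variables and homogeneity\<close>

definition diag_mat :: "(var \<Rightarrow> complex) \<Rightarrow> vmat" where
  "diag_mat d = (\<lambda>v u. if u = v then d v else 0)"

lemma vapply_diag: "vapply (diag_mat d) x v = d v * x v"
  by (subst vapply_superset[of "{v}"]) (auto simp: diag_mat_def split: if_splits)

lemma coef_lsubst_diag: "coef (lsubst (diag_mat d) f) \<alpha> = mev d \<alpha> * coef f \<alpha>"
proof -
  have m: "mev (vapply (diag_mat d) x) \<alpha> = mev d \<alpha> * mev x \<alpha>" for x \<alpha>
    by (simp add: mev_def vapply_diag power_mult_distrib prod.distrib)
  have "lsubst (diag_mat d) f = (\<Sum>\<alpha>\<in>keys f. single \<alpha> (mev d \<alpha> * coef f \<alpha>))"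
    by (rule poly_ext)
      (simp add: pev_lsubst pev_sum pev_single, simp add: pev_def m mult_ac)
  then show ?thesis
    by (simp add: lookup_sum lookup_single when_def sum.delta in_keys_iff)
qed

text \<open>Distinct powers of 2 are different, so a single scaling separates all degrees. In this
  form homogeneity visibly survives linear substitutions, since these commute with scalings.\<close>

lemma homog_iff: "homog d f \<longleftrightarrow> lsubst (diag_mat (\<lambda>_. 2)) f = pscale (2 ^ d) f"
proof -
  have "homog d f \<longleftrightarrow> (\<forall>\<alpha>. (2::complex) ^ deg \<alpha> * coef f \<alpha> = 2 ^ d * coef f \<alpha>)"
  proof -
    have "(2::complex) ^ a = 2 ^ b \<longleftrightarrow> a = b" for a b
    proof
      assume "(2::complex) ^ a = 2 ^ b"
      then have "norm ((2::complex) ^ a) = norm ((2::complex) ^ b)" by simp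
      then show "a = b" by (simp add: norm_power)
    qed simp
    then show ?thesis by (auto simp: homog_def in_keys_iff)
  qed
  then show ?thesis
    by (simp add: poly_mapping_eq_iff fun_eq_iff coef_lsubst_diag mev_const)
qed

lemma homog_lsubst: "homog d f \<Longrightarrow> homog d (lsubst M f)"
proof -
  have "lsubst (diag_mat (\<lambda>_. 2)) (lsubst M f) = lsubst M (lsubst (diag_mat (\<lambda>_. 2)) f)"
    by (rule poly_ext)
      (simp add: pev_lsubst vapply_diag[abs_def], simp add: vapply_def[abs_def] vapply_diag sum_distrib_left mult_ac)
  then show "homog d f \<Longrightarrow> homog d (lsubst M f)"
    by (simp add: homog_iff lsubst_pscale)
qed

lemma homog_pdv: "homog (Suc d) f \<Longrightarrow> homog d (pdv v f)"
  unfolding homog_def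
proof
  fix \<alpha> assume h: "\<forall>\<alpha>\<in>keys f. deg \<alpha> = Suc d" and a: "\<alpha> \<in> keys (pdv v f)"
  then have "\<alpha> + single v 1 \<in> keys f"
    by (auto simp: in_keys_iff lookup_pdv)
  then have "deg (\<alpha> + single v 1) = Suc d" using h by blast
  then show "deg \<alpha> = d" by (simp add: deg_add)
qed

text \<open>Pair \<open>\<Sum>x\<^sub>v \<partial>\<^sub>v f = d f\<close> with \<open>f\<close>.\<close>

lemma pnsq_euler:
  assumes "homog d f" "finite X" "\<And>\<alpha>. \<alpha> \<in> keys f \<Longrightarrow> keys \<alpha> \<subseteq> X"
  shows "real d * pnsq f = (\<Sum>v\<in>X. pnsq (pdv v f))"
proof -
  have "(\<Sum>v\<in>X. Var v * pdv v f) = pscale (of_nat d) f"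
  proof (rule poly_mapping_eqI)
    fix \<alpha>
    have "(\<Sum>v\<in>X. of_nat (coef \<alpha> v) :: complex) = of_nat d" if "\<alpha> \<in> keys f"
      using assms that deg_superset[of X \<alpha>] by (auto simp: homog_def simp flip: of_nat_sum)
    then show "coef (\<Sum>v\<in>X. Var v * pdv v f) \<alpha> = coef (pscale (of_nat d) f) \<alpha>"
      by (cases "\<alpha> \<in> keys f")
        (simp_all add: lookup_sum coef_Var_mult_pdv sum_distrib_right[symmetric] in_keys_iff)
  qed
  moreover have "pinner (Var v * pdv v f) f = pinner (pdv v f) (pdv v f)" for v
    by (simp add: pinner_bil bil_Var_mult pdv_pcnj)
  ultimately have "of_nat d * pinner f f = (\<Sum>v\<in>X. pinner (pdv v f) (pdv v f))"
    using pinner_scale_left[of "of_nat d" f f] by (metis (no_types, lifting) pinner_sum_left sum.cong)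
  then have "complex_of_real (real d * pnsq f) = of_real (\<Sum>v\<in>X. pnsq (pdv v f))"
    by (simp add: pinner_self)
  then show ?thesis by (simp only: of_real_eq_iff)
qed

text \<open>The Cauchy-Schwarz inequality, applied to each coefficient.\<close>

lemma pnsq_sum_le:
  assumes "finite I"
  shows "pnsq (\<Sum>i\<in>I. f i) \<le> real (card I) * (\<Sum>i\<in>I. pnsq (f i))"
proof -
  let ?S = "\<Union>i\<in>I. keys (f i)"
  have fin: "finite ?S" using assms by auto
  have "pnsq (\<Sum>i\<in>I. f i) = (\<Sum>\<alpha>\<in>?S. mfact \<alpha> * (cmod (coef (\<Sum>i\<in>I. f i) \<alpha>))\<^sup>2)"
    by (rule pnsq_superset[OF fin keys_sum])
  also have "\<dots> \<le> (\<Sum>\<alpha>\<in>?S. mfact \<alpha> * (real (card I) * (\<Sum>i\<in>I. (cmod (coef (f i) \<alpha>))\<^sup>2)))"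
  proof (intro sum_mono mult_left_mono)
    fix \<alpha>
    have "(cmod (coef (\<Sum>i\<in>I. f i) \<alpha>))\<^sup>2 \<le> (\<Sum>i\<in>I. cmod (coef (f i) \<alpha>))\<^sup>2"
      by (intro power_mono) (simp_all add: lookup_sum norm_sum)
    also have "\<dots> \<le> real (card I) * (\<Sum>i\<in>I. (cmod (coef (f i) \<alpha>))\<^sup>2)"
      using sum_squared_le_sum_of_squares[of "\<lambda>i. cmod (coef (f i) \<alpha>)" I]
      by (simp add: mult.commute)
    finally show "(cmod (coef (\<Sum>i\<in>I. f i) \<alpha>))\<^sup>2 \<le> real (card I) * (\<Sum>i\<in>I. (cmod (coef (f i) \<alpha>))\<^sup>2)" .
  qed (simp add: mfact_pos less_imp_le)
  also have "\<dots> = real (card I) * (\<Sum>i\<in>I. \<Sum>\<alpha>\<in>?S. mfact \<alpha> * (cmod (coef (f i) \<alpha>))\<^sup>2)"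
    by (subst sum.swap) (simp add: sum_distrib_left mult_ac)
  also have "\<dots> = real (card I) * (\<Sum>i\<in>I. pnsq (f i))"
    using fin by (intro arg_cong2[where f = "(*)"] sum.cong refl pnsq_superset[symmetric]) auto
  finally show ?thesis .
qed

subsection \<open>Matrices\<close>

lemma carrier_mono: "k \<le> l \<Longrightarrow> cmat_carrier k \<subseteq> cmat_carrier l"
  by (auto simp: cmat_carrier_def)

lemma carrier_outside: "g \<in> cmat_carrier k \<Longrightarrow> k \<le> i \<or> k \<le> j \<Longrightarrow> g i j = (if i = j then 1 else 0)"
  unfolding cmat_carrier_def by blast

lemma carrier_nonzero: "g \<in> cmat_carrier k \<Longrightarrow> g i j \<noteq> 0 \<Longrightarrow> i = j \<or> i < k \<and> j < k"
  by (metis carrier_outside not_le)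

lemma cmat_mult_superset:
  "finite S \<Longrightarrow> {l. g i l \<noteq> 0} \<subseteq> S \<Longrightarrow> cmat_mult g h i j = (\<Sum>l\<in>S. g i l * h l j)"
  unfolding cmat_mult_def by (intro sum.mono_neutral_left) auto

lemma cmat_mult_carrier:
  assumes "g \<in> cmat_carrier k" "k \<le> K" "i < K"
  shows "cmat_mult g h i j = (\<Sum>l<K. g i l * h l j)"
  by (rule cmat_mult_superset) (use carrier_nonzero[OF assms(1)] assms in force)+

lemma cmat_mult_outside:
  assumes "g \<in> cmat_carrier k" "k \<le> i"
  shows "cmat_mult g h i j = h i j"
  using assms by (subst cmat_mult_superset[of "{i}"]) (auto simp: carrier_outside split: if_splits)

lemma cmat_mult_closed: "g \<in> cmat_carrier k \<Longrightarrow> h \<in> cmat_carrier k \<Longrightarrow> cmat_mult g h \<in> cmat_carrier k"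
  unfolding cmat_carrier_def[of k] mem_Collect_eq
proof (intro allI impI)
  fix i j assume g: "\<forall>i j. k \<le> i \<or> k \<le> j \<longrightarrow> g i j = (if i = j then 1 else 0)"
    and h: "\<forall>i j. k \<le> i \<or> k \<le> j \<longrightarrow> h i j = (if i = j then 1 else 0)" and ij: "k \<le> i \<or> k \<le> j"
  have gc: "g \<in> cmat_carrier k" using g by (simp add: cmat_carrier_def)
  show "cmat_mult g h i j = (if i = j then 1 else 0)"
  proof (cases "k \<le> i")
    case True
    then show ?thesis using h cmat_mult_outside[OF gc] by simp
  next
    case False
    then have "cmat_mult g h i j = (\<Sum>l<k. g i l * h l j)"
      by (intro cmat_mult_carrier[OF gc]) auto
    also have "\<dots> = 0" using False ij h by (intro sum.neutral) auto
    finally show ?thesis using False ij by auto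
  qed
qed

lemma cmat_one_carrier: "cmat_one \<in> cmat_carrier k"
  by (simp add: cmat_carrier_def cmat_one_def)

lemma cmat_transpose_carrier: "g \<in> cmat_carrier k \<Longrightarrow> cmat_transpose g \<in> cmat_carrier k"
  by (auto simp: cmat_carrier_def cmat_transpose_def)

lemma cmat_adjoint_carrier: "g \<in> cmat_carrier k \<Longrightarrow> cmat_adjoint g \<in> cmat_carrier k"
  by (auto simp: cmat_carrier_def cmat_adjoint_def)

lemma cmat_mult_one: "g \<in> cmat_carrier k \<Longrightarrow> cmat_mult cmat_one g = g"
  "g \<in> cmat_carrier k \<Longrightarrow> cmat_mult g cmat_one = g"
proof -
  have "{l. cmat_one i l \<noteq> 0} = {i}" for i by (auto simp: cmat_one_def)
  then show "cmat_mult cmat_one g = g"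
    by (simp add: cmat_mult_def) (simp add: cmat_one_def)
  assume g: "g \<in> cmat_carrier k"
  show "cmat_mult g cmat_one = g"
  proof (intro ext)
    fix i j
    have "cmat_mult g cmat_one i j = (\<Sum>l<max k (Suc (max i j)). g i l * cmat_one l j)"
      by (rule cmat_mult_carrier[OF g]) auto
    also have "\<dots> = (\<Sum>l<max k (Suc (max i j)). if l = j then g i l else 0)"
      by (intro sum.cong) (auto simp: cmat_one_def)
    also have "\<dots> = g i j" by (subst sum.delta) auto
    finally show "cmat_mult g cmat_one i j = g i j" .
  qed
qed

lemma cmat_mult_assoc:
  assumes "g \<in> cmat_carrier k" "h \<in> cmat_carrier k"
  shows "cmat_mult (cmat_mult g h) l = cmat_mult g (cmat_mult h l)"
proof (intro ext)
  fix i j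
  define K where "K = max k (Suc i)"
  have K: "k \<le> K" "i < K" by (auto simp: K_def)
  have "cmat_mult (cmat_mult g h) l i j = (\<Sum>c<K. (\<Sum>a<K. g i a * h a c) * l c j)"
    by (simp add: cmat_mult_carrier[OF cmat_mult_closed[OF assms] K] cmat_mult_carrier[OF assms(1) K])
  also have "\<dots> = (\<Sum>a<K. g i a * (\<Sum>c<K. h a c * l c j))"
    by (simp add: sum_distrib_left sum_distrib_right mult.assoc) (rule sum.swap)
  also have "\<dots> = cmat_mult g (cmat_mult h l) i j"
    by (simp add: cmat_mult_carrier[OF assms(1) K] cmat_mult_carrier[OF assms(2) K(1)])
  finally show "cmat_mult (cmat_mult g h) l i j = cmat_mult g (cmat_mult h l) i j" .
qed

lemma cmat_transpose_mult:
  assumes "g \<in> cmat_carrier k" "h \<in> cmat_carrier k"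
  shows "cmat_transpose (cmat_mult g h) = cmat_mult (cmat_transpose h) (cmat_transpose g)"
proof (intro ext)
  fix i j
  define K where "K = max k (Suc (max i j))"
  have K: "k \<le> K" "i < K" "j < K" by (auto simp: K_def)
  show "cmat_transpose (cmat_mult g h) i j = cmat_mult (cmat_transpose h) (cmat_transpose g) i j"
    unfolding cmat_mult_carrier[OF cmat_transpose_carrier[OF assms(2)] K(1,2)]
    by (simp add: cmat_transpose_def cmat_mult_carrier[OF assms(1) K(1,3)] mult.commute)
qed

lemma GL_carrier: "g \<in> GL_group k \<Longrightarrow> g \<in> cmat_carrier k"
  by (simp add: GL_group_def)

lemma U_subset_GL: "U_group k \<subseteq> GL_group k"
  unfolding U_group_def GL_group_def using cmat_adjoint_carrier by blast

lemma GL_mono: "k \<le> l \<Longrightarrow> GL_group k \<subseteq> GL_group l"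
  unfolding GL_group_def using carrier_mono by blast

lemma U_mono: "k \<le> l \<Longrightarrow> U_group k \<subseteq> U_group l"
  unfolding U_group_def using carrier_mono by blast

lemma cmat_inverse_props:
  assumes "g \<in> GL_group k"
  shows "cmat_inverse g \<in> cmat_carrier k" "cmat_mult g (cmat_inverse g) = cmat_one"
    "cmat_mult (cmat_inverse g) g = cmat_one"
proof -
  obtain h where h: "g \<in> cmat_carrier k" "h \<in> cmat_carrier k" "cmat_mult g h = cmat_one" "cmat_mult h g = cmat_one"
    using assms by (auto simp: GL_group_def)
  have "cmat_inverse g = h" unfolding cmat_inverse_def
  proof (rule the_equality)
    show "h \<in> (\<Union>k. cmat_carrier k) \<and> cmat_mult g h = cmat_one \<and> cmat_mult h g = cmat_one"
      using h by blast
    fix h' assume h': "h' \<in> (\<Union>k. cmat_carrier k) \<and> cmat_mult g h' = cmat_one \<and> cmat_mult h' g = cmat_one"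
    then obtain l where l: "h' \<in> cmat_carrier l" by blast
    \<comment> \<open>A competing inverse may belong to a larger size, so both are compared in a
      common one.\<close>
    let ?K = "max k l"
    have c: "g \<in> cmat_carrier ?K" "h \<in> cmat_carrier ?K" "h' \<in> cmat_carrier ?K"
      using h l carrier_mono[of k ?K] carrier_mono[of l ?K] by auto
    have "h' = cmat_mult (cmat_mult h' g) h"
      using cmat_mult_assoc[OF c(3,1)] h(3) cmat_mult_one(2)[OF c(3)] by simp
    also have "\<dots> = h" using h' cmat_mult_one(1)[OF c(2)] by simp
    finally show "h' = h" .
  qed
  with h show "cmat_inverse g \<in> cmat_carrier k" "cmat_mult g (cmat_inverse g) = cmat_one"
    "cmat_mult (cmat_inverse g) g = cmat_one" by simp_all
qed

lemma cmat_dual_carrier: "g \<in> GL_group k \<Longrightarrow> cmat_dual g \<in> cmat_carrier k"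
  by (simp add: cmat_dual_def cmat_transpose_carrier cmat_inverse_props)

lemma cmat_adjoint_U: "g \<in> U_group k \<Longrightarrow> cmat_adjoint g \<in> U_group k"
  by (simp add: U_group_def cmat_adjoint_carrier) (simp add: cmat_adjoint_def)

subsection \<open>Column substitutions\<close>

lemma vapply_act:
  assumes "g \<in> cmat_carrier k" "k \<le> K" "t < K"
  shows "vapply (col_mat (\<lambda>_. g)) x (i, a, t) = (\<Sum>s<K. g s t * x (i, a, s))"
  unfolding vapply_col using carrier_nonzero[OF assms(1)] assms
  by (intro sum.mono_neutral_left) force+

lemma vapply_act_outside:
  assumes "g \<in> cmat_carrier k" "k \<le> t"
  shows "vapply (col_mat (\<lambda>_. g)) x (i, a, t) = x (i, a, t)"
proof -
  have "{s. g s t \<noteq> 0} = {t}" using assms by (auto simp: carrier_outside)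
  then show ?thesis using assms by (simp add: vapply_col carrier_outside)
qed

lemma act_eq: "act g = lsubst (col_mat (\<lambda>_. g))"
  by (simp add: act_def col_subst_eq)

text \<open>The value of \<open>act g f\<close> at Z is that of \<open>f\<close> at Zg, and
  multiplication of points from the right makes this a left action.\<close>

lemma act_act:
  assumes "g \<in> cmat_carrier k" "h \<in> cmat_carrier k"
  shows "act g (act h f) = act (cmat_mult g h) f"
proof -
  have "vapply (col_mat (\<lambda>_. h)) (vapply (col_mat (\<lambda>_. g)) x) = vapply (col_mat (\<lambda>_. cmat_mult g h)) x" for x
  proof
    fix v :: var
    obtain i a t where v: "v = (i, a, t)" by (cases v)
    define K where "K = max k (Suc t)"
    have K: "k \<le> K" "t < K" by (auto simp: K_def)
    have "vapply (col_mat (\<lambda>_. h)) (vapply (col_mat (\<lambda>_. g)) x) v =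
        (\<Sum>s<K. h s t * (\<Sum>l<K. g l s * x (i, a, l)))"
      by (simp add: v vapply_act[OF assms(2) K] vapply_act[OF assms(1) K(1)])
    also have "\<dots> = (\<Sum>l<K. (\<Sum>s<K. g l s * h s t) * x (i, a, l))"
      by (simp add: sum_distrib_left sum_distrib_right mult_ac) (rule sum.swap)
    also have "\<dots> = vapply (col_mat (\<lambda>_. cmat_mult g h)) x v"
      by (simp add: v vapply_act[OF cmat_mult_closed[OF assms] K] cmat_mult_carrier[OF assms(1) K(1)])
    finally show "vapply (col_mat (\<lambda>_. h)) (vapply (col_mat (\<lambda>_. g)) x) v =
        vapply (col_mat (\<lambda>_. cmat_mult g h)) x v" .
  qed
  then show ?thesis
    by (intro poly_ext) (simp add: act_eq pev_lsubst)
qed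

lemma act_one: "act cmat_one f = f"
proof -
  have "vapply (col_mat (\<lambda>_. cmat_one)) x = x" for x
  proof
    show "vapply (col_mat (\<lambda>_. cmat_one)) x v = x v" for v
      by (cases v) (simp add: vapply_act_outside[OF cmat_one_carrier[of 0]])
  qed
  then show ?thesis
    by (intro poly_ext) (simp add: act_eq pev_lsubst)
qed

lemma lfin_col:
  assumes "\<And>i t. finite {s. \<gamma> i s t \<noteq> 0}" "\<And>i s. finite {t. \<gamma> i s t \<noteq> 0}"
  shows "lfin (col_mat \<gamma>)"
  unfolding lfin_def
proof (intro conjI allI)
  fix v :: var
  obtain i a t where v: "v = (i, a, t)" by (cases v)
  have "{u. col_mat \<gamma> v u \<noteq> 0} \<subseteq> (\<lambda>s. (i, a, s)) ` {s. \<gamma> i s t \<noteq> 0}"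
    by (auto simp: v col_mat_def split: if_splits)
  then show "finite {u. col_mat \<gamma> v u \<noteq> 0}" using assms(1) finite_subset by blast
  have "{u. col_mat \<gamma> u v \<noteq> 0} \<subseteq> (\<lambda>s. (i, a, s)) ` {s. \<gamma> i t s \<noteq> 0}"
    by (auto simp: v col_mat_def split: if_splits)
  then show "finite {u. col_mat \<gamma> u v \<noteq> 0}" using assms(2) finite_subset by blast
qed

lemma finite_carrier_support:
  assumes "g \<in> cmat_carrier k"
  shows "finite {s. g s t \<noteq> 0}" "finite {t. g s t \<noteq> 0}"
  by (rule finite_subset[of _ "insert t {..<k}"], use carrier_nonzero[OF assms] in blast, simp,
      rule finite_subset[of _ "insert s {..<k}"], use carrier_nonzero[OF assms] in blast, simp)

lemma lfin_act: "g \<in> cmat_carrier k \<Longrightarrow> lfin (col_mat (\<lambda>_. g))"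
  by (intro lfin_col finite_carrier_support)

lemma lfin_proj: "lfin (col_mat (\<lambda>_. proj k))"
proof (rule lfin_col)
  show "finite {s. proj k s t \<noteq> 0}" "finite {t. proj k s t \<noteq> 0}" for s t
    by (rule finite_subset[of _ "{..<k}"]; auto simp: proj_def split: if_splits)+
qed

text \<open>On the other side of the pairing \<open>g\<close> becomes its transpose, which cancels
  against \<open>cmat_dual g\<close>.\<close>

lemma bil_act_dual:
  assumes g: "g \<in> GL_group k"
  shows "bil (act g f) (act (cmat_dual g) h) = bil f h"
proof -
  note c = GL_carrier[OF g] cmat_inverse_props[OF g]
  have "bil (act g f) (act (cmat_dual g) h) = bil f (act (cmat_transpose g) (act (cmat_dual g) h))"
    unfolding act_eq[of g] bil_lsubst[OF lfin_act[OF c(1)]]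
    by (simp add: act_eq col_mat_def cmat_transpose_def case_prod_unfold)
      (rule arg_cong2[where f = bil], rule refl, rule arg_cong2[where f = lsubst], auto simp: fun_eq_iff)
  also have "act (cmat_transpose g) (act (cmat_dual g) h) = h"
  proof -
    have "cmat_mult (cmat_transpose g) (cmat_dual g) = cmat_transpose cmat_one"
      using cmat_transpose_mult[OF c(2,1)] c(4) by (simp add: cmat_dual_def)
    also have "\<dots> = cmat_one" by (auto simp: cmat_transpose_def cmat_one_def fun_eq_iff)
    finally show ?thesis
      using act_act[OF cmat_transpose_carrier[OF c(1)] cmat_dual_carrier[OF g], of h] by (simp add: act_one)
  qed
  finally show ?thesis .
qed

lemma pinner_act_adjoint:
  assumes g: "g \<in> cmat_carrier k"
  shows "pinner (act g f) h = pinner f (act (cmat_adjoint g) h)"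
  unfolding act_eq[of g] pinner_lsubst[OF lfin_act[OF g]]
  by (simp add: act_eq) (rule arg_cong2[where f = pinner], rule refl,
     rule arg_cong2[where f = lsubst], auto simp: fun_eq_iff col_mat_def cmat_adjoint_def)

lemma col_subst_add: "col_subst \<gamma> (f + g) = col_subst \<gamma> f + col_subst \<gamma> g"
  and col_subst_pscale: "col_subst \<gamma> (pscale c f) = pscale c (col_subst \<gamma> f)"
  and col_subst_mult: "col_subst \<gamma> (f * g) = col_subst \<gamma> f * col_subst \<gamma> g"
  and col_subst_prod: "col_subst \<gamma> (\<Prod>i\<in>I. F i) = (\<Prod>i\<in>I. col_subst \<gamma> (F i))"
  and col_subst_0: "col_subst \<gamma> 0 = 0"
  by (simp_all add: col_subst_eq lsubst_add lsubst_pscale lsubst_mult lsubst_prod)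

lemma act_add: "act g (f + h) = act g f + act g h"
  and act_diff: "act g (f - h) = act g f - act g h"
  and act_pscale: "act g (pscale c f) = pscale c (act g f)"
  by (simp_all add: act_eq lsubst_add lsubst_pscale lsubst_diff)

subsection \<open>Polynomials in given variables\<close>

definition invars :: "var set \<Rightarrow> cpoly set" where
  "invars X = {f. \<forall>\<alpha>\<in>keys f. keys \<alpha> \<subseteq> X}"

lemma polys_invars: "polys b p k = invars {(b', a, t). b' = b \<and> a < p \<and> t < k}"
  by (auto simp: polys_def invars_def)

lemma invars_mono: "X \<subseteq> Y \<Longrightarrow> invars X \<subseteq> invars Y"
  by (auto simp: invars_def)

lemma pev_cong_invars: "f \<in> invars X \<Longrightarrow> (\<And>v. v \<in> X \<Longrightarrow> x v = y v) \<Longrightarrow> pev x f = pev y f"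
  by (intro pev_cong) (unfold invars_def, blast)

lemma invars_Const [simp]: "Const c \<in> invars X"
  by (auto simp: invars_def Const_def)

lemma invars_0 [simp]: "0 \<in> invars X" and invars_1 [simp]: "1 \<in> invars X"
  by (auto simp: invars_def)

lemma invars_Var: "v \<in> X \<Longrightarrow> Var v \<in> invars X"
  by (auto simp: invars_def Var_def Monom_def)

lemma invars_add: "f \<in> invars X \<Longrightarrow> g \<in> invars X \<Longrightarrow> f + g \<in> invars X"
  using Poly_Mapping.keys_add[of f g] by (auto simp: invars_def)

lemma invars_mult: "f \<in> invars X \<Longrightarrow> g \<in> invars X \<Longrightarrow> f * g \<in> invars X"
  unfolding invars_def
proof clarify
  fix \<gamma> v assume h: "\<forall>\<alpha>\<in>keys f. keys \<alpha> \<subseteq> X" "\<forall>\<alpha>\<in>keys g. keys \<alpha> \<subseteq> X" "\<gamma> \<in> keys (f * g)" "v \<in> keys \<gamma>"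
  then obtain \<alpha> \<beta> where "\<alpha> \<in> keys f" "\<beta> \<in> keys g" "\<gamma> = \<alpha> + \<beta>"
    using Poly_Mapping.keys_mult[of f g] by blast
  then show "v \<in> X" using h Poly_Mapping.keys_add[of \<alpha> \<beta>] by blast
qed

lemma invars_pscale: "f \<in> invars X \<Longrightarrow> pscale c f \<in> invars X"
  by (simp add: pscale_def invars_mult)

lemma invars_sum: "(\<And>i. i \<in> I \<Longrightarrow> f i \<in> invars X) \<Longrightarrow> (\<Sum>i\<in>I. f i) \<in> invars X"
  by (induction I rule: infinite_finite_induct) (auto intro: invars_add)

lemma invars_prod: "(\<And>i. i \<in> I \<Longrightarrow> f i \<in> invars X) \<Longrightarrow> (\<Prod>i\<in>I. f i) \<in> invars X"
  by (induction I rule: infinite_finite_induct) (auto intro: invars_mult)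

lemma invars_power: "f \<in> invars X \<Longrightarrow> f ^ n \<in> invars X"
  by (induction n) (auto intro: invars_mult)

lemma invars_psubst:
  assumes "f \<in> invars X" "\<And>v. v \<in> X \<Longrightarrow> \<sigma> v \<in> invars Y"
  shows "psubst \<sigma> f \<in> invars Y"
  unfolding psubst_def using assms
  by (intro invars_sum invars_mult invars_prod invars_power invars_Const assms(2)) (auto simp: invars_def)

lemma invars_subspace: "pscale.subspace (invars X)"
  by (auto simp: pscale.subspace_def intro: invars_add invars_pscale)

lemma invars_lsubst:
  assumes "f \<in> invars X" "\<And>v u. v \<in> X \<Longrightarrow> M v u \<noteq> 0 \<Longrightarrow> u \<in> Y"
  shows "lsubst M f \<in> invars Y"
  unfolding lsubst_def using assms
  by (intro invars_psubst[of f X] invars_sum invars_mult invars_Const invars_Var) auto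

lemma invars_homog_keys: "f \<in> invars X \<Longrightarrow> homog d f \<Longrightarrow> keys f \<subseteq> {\<alpha>. keys \<alpha> \<subseteq> X \<and> deg \<alpha> = d}"
  by (auto simp: invars_def homog_def)

lemma homog_add: "homog d f \<Longrightarrow> homog d g \<Longrightarrow> homog d (f + g)"
  using Poly_Mapping.keys_add[of f g] by (auto simp: homog_def)

lemma homog_pscale: "homog d f \<Longrightarrow> homog d (pscale c f)"
  by (auto simp: homog_def in_keys_iff)

lemma homog_0 [simp]: "homog d 0"
  by (simp add: homog_def)

lemma homog_mult: "homog d f \<Longrightarrow> homog e g \<Longrightarrow> homog (d + e) (f * g)"
  unfolding homog_def
proof
  fix \<gamma> assume h: "\<forall>\<alpha>\<in>keys f. deg \<alpha> = d" "\<forall>\<alpha>\<in>keys g. deg \<alpha> = e" "\<gamma> \<in> keys (f * g)"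
  then obtain \<alpha> \<beta> where "\<alpha> \<in> keys f" "\<beta> \<in> keys g" "\<gamma> = \<alpha> + \<beta>"
    using Poly_Mapping.keys_mult[of f g] by blast
  then show "deg \<gamma> = d + e" using h by (simp add: deg_add)
qed

lemma homog_1: "homog 0 1"
  by (simp add: homog_def deg_def)

lemma homog_prod: "finite I \<Longrightarrow> (\<And>i. i \<in> I \<Longrightarrow> homog (d i) (f i)) \<Longrightarrow> homog (\<Sum>i\<in>I. d i) (\<Prod>i\<in>I. f i)"
  by (induction I rule: finite_induct) (auto intro: homog_mult homog_1)

subsection \<open>Boundedness of the action in each degree\<close>

lemma finite_box: "finite {(i::nat, a::nat, t::nat). i < R \<and> a < R \<and> t < K}"
  by (rule finite_subset[of _ "{..<R} \<times> {..<R} \<times> {..<K}"]) auto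

text \<open>A box allows sums over the variables to be split by rows. The bound
  \<open>K \<ge> k\<close> makes it contain all the columns that an element of size \<open>k\<close>
  mixes.\<close>

lemma box_exists:
  assumes "finite X"
  shows "\<exists>R K. k \<le> K \<and> X \<subseteq> {(i::nat, a::nat, t::nat). i < R \<and> a < R \<and> t < K}"
  using assms
proof (induction X rule: finite_induct)
  case (insert v X)
  then obtain R K where rk: "k \<le> K" "X \<subseteq> {(i, a, t). i < R \<and> a < R \<and> t < K}" by auto
  obtain i a t where "v = (i, a, t)" by (cases v)
  then show ?case using rk
    by (intro exI[of _ "R + Suc i + Suc a"] exI[of _ "K + Suc t"]) auto
qed auto

text \<open>By Euler's identity, the norm in degree \<open>d + 1\<close> is given by the norms in degree \<open>d\<close> of the
  partial derivatives, and \<open>g\<close> mixes these linearly. The bound is therefore uniform in the number of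
  columns.\<close>

lemma act_bounded:
  assumes g: "g \<in> cmat_carrier k"
  shows "\<exists>C\<ge>0. \<forall>d f. homog d f \<longrightarrow> pnsq (act g f) \<le> C ^ d * pnsq f"
proof -
  define B where "B = (\<Sum>s<k. \<Sum>t<k. (cmod (g s t))\<^sup>2)"
  have B0: "0 \<le> B" by (simp add: B_def sum_nonneg)
  have Bg: "(cmod (g s t))\<^sup>2 \<le> B" if "s < k" "t < k" for s t
  proof -
    have "(cmod (g s t))\<^sup>2 \<le> (\<Sum>t<k. (cmod (g s t))\<^sup>2)" using that by (intro member_le_sum) auto
    also have "\<dots> \<le> B" unfolding B_def
      using that by (intro member_le_sum[of s _ "\<lambda>s. \<Sum>t<k. (cmod (g s t))\<^sup>2"]) (auto intro: sum_nonneg)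
    finally show ?thesis .
  qed
  \<comment> \<open>Each of the \<open>k\<close> columns that \<open>g\<close> mixes costs
    \<open>real k * B\<close> times the sum over its row; the summand 1 accounts for the columns
    that \<open>g\<close> fixes.\<close>
  define C where "C = real k * (real k * B) + 1"
  have C1: "0 \<le> C" using B0 by (simp add: C_def)
  let ?M = "col_mat (\<lambda>_. g)"
  have "pnsq (act g f) \<le> C ^ d * pnsq f" if "homog d f" for d f
    using that
  proof (induction d arbitrary: f)
    case 0
    have "keys f \<subseteq> {0}"
    proof
      fix \<alpha> assume "\<alpha> \<in> keys f"
      then have "deg \<alpha> = 0" using 0 by (simp add: homog_def)
      then have "\<forall>v\<in>keys \<alpha>. coef \<alpha> v = 0" by (simp add: deg_def)
      then have "keys \<alpha> = {}" using in_keys_iff by blast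
      then show "\<alpha> \<in> {0}" by simp
    qed
    then have "f = Const (coef f 0)"
      by (intro poly_mapping_eqI) (auto simp: Const_def lookup_single when_def in_keys_iff)
    then have "act g f = f" by (metis act_eq lsubst_Const)
    then show ?case by simp
  next
    case (Suc d)
    define F where "F = act g f"
    have hF: "homog (Suc d) F" using Suc.prems by (simp add: F_def act_eq homog_lsubst)
    obtain R K where RK: "k \<le> K"
      "(\<Union>\<alpha>\<in>keys f. keys \<alpha>) \<union> (\<Union>\<alpha>\<in>keys F. keys \<alpha>) \<subseteq> {(i, a, t). i < R \<and> a < R \<and> t < K}"
      using box_exists[of "(\<Union>\<alpha>\<in>keys f. keys \<alpha>) \<union> (\<Union>\<alpha>\<in>keys F. keys \<alpha>)" k] by auto
    define X where "X = {(i, a, t). i < R \<and> a < R \<and> t < K}"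
    have Xfin: "finite X" unfolding X_def by (rule finite_box)
    have Xprod: "X = {..<R} \<times> {..<R} \<times> {..<K}" by (auto simp: X_def)
    \<comment> \<open>The chain rule expresses the derivatives of \<open>act g f\<close> by these
      polynomials, and the induction hypothesis bounds them.\<close>
    define h where "h v = act g (pdv v f)" for v
    have pF: "pdv (i, a, s) F = (\<Sum>t\<in>{t. g s t \<noteq> 0}. pscale (g s t) (h (i, a, t)))" for i a s
    proof -
      have "{v. ?M v (i, a, s) \<noteq> 0} = (\<lambda>t. (i, a, t)) ` {t. g s t \<noteq> 0}"
        by (auto simp: col_mat_def split: if_splits)
      then show ?thesis
        unfolding F_def act_eq pdv_lsubst[OF lfin_act[OF g]] h_def
        by (simp add: sum.reindex inj_on_def) (simp add: col_mat_def)
    qed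
    have row: "(\<Sum>s<K. pnsq (pdv (i, a, s) F)) \<le> C * (\<Sum>s<K. pnsq (h (i, a, s)))" for i a
    proof -
      let ?P = "\<Sum>t<K. pnsq (h (i, a, t))"
      have hi: "pdv (i, a, s) F = h (i, a, s)" if "k \<le> s" for s
      proof -
        have "{t. g s t \<noteq> 0} = {s}" using that g by (auto simp: carrier_outside)
        then show ?thesis using that g by (simp add: pF carrier_outside)
      qed
      have lo: "pnsq (pdv (i, a, s) F) \<le> real k * B * ?P" if s: "s < k" for s
      proof -
        have "pdv (i, a, s) F = (\<Sum>t<k. pscale (g s t) (h (i, a, t)))"
          unfolding pF using carrier_nonzero[OF g, of s] s
          by (intro sum.mono_neutral_left) auto
        then have "pnsq (pdv (i, a, s) F) \<le> real k * (\<Sum>t<k. pnsq (pscale (g s t) (h (i, a, t))))"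
          using pnsq_sum_le[of "{..<k}"] by simp
        also have "\<dots> \<le> real k * (\<Sum>t<k. B * pnsq (h (i, a, t)))"
          using s Bg by (intro mult_left_mono sum_mono) (auto simp: pnsq_pscale pnsq_nonneg intro!: mult_right_mono)
        also have "\<dots> = real k * B * (\<Sum>t<k. pnsq (h (i, a, t)))" by (simp add: sum_distrib_left mult_ac)
        also have "\<dots> \<le> real k * B * ?P"
          using RK(1) B0 by (intro mult_left_mono sum_mono2) (auto simp: pnsq_nonneg)
        finally show ?thesis .
      qed
      have "(\<Sum>s<K. pnsq (pdv (i, a, s) F)) = (\<Sum>s<k. pnsq (pdv (i, a, s) F)) + (\<Sum>s\<in>{k..<K}. pnsq (pdv (i, a, s) F))"
        using RK(1) by (simp add: sum.atLeastLessThan_concat[of 0 k K, symmetric] atLeast0LessThan[symmetric])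
      also have "\<dots> \<le> (\<Sum>s<k. real k * B * ?P) + ?P"
      proof (rule add_mono)
        show "(\<Sum>s<k. pnsq (pdv (i, a, s) F)) \<le> (\<Sum>s<k. real k * B * ?P)"
          using lo by (intro sum_mono) auto
        have "(\<Sum>s\<in>{k..<K}. pnsq (pdv (i, a, s) F)) = (\<Sum>s\<in>{k..<K}. pnsq (h (i, a, s)))"
          by (intro sum.cong) (auto simp: hi)
        also have "\<dots> \<le> ?P" by (intro sum_mono2) (auto simp: pnsq_nonneg)
        finally show "(\<Sum>s\<in>{k..<K}. pnsq (pdv (i, a, s) F)) \<le> ?P" .
      qed
      also have "\<dots> = C * ?P" by (simp add: C_def algebra_simps)
      finally show ?thesis .
    qed
    have "real (Suc d) * pnsq F = (\<Sum>v\<in>X. pnsq (pdv v F))"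
      by (rule pnsq_euler[OF hF Xfin]) (use RK(2) in \<open>auto simp: X_def\<close>)
    also have "\<dots> = (\<Sum>i<R. \<Sum>a<R. \<Sum>s<K. pnsq (pdv (i, a, s) F))"
      by (simp add: Xprod sum.cartesian_product)
    also have "\<dots> \<le> (\<Sum>i<R. \<Sum>a<R. C * (\<Sum>s<K. pnsq (h (i, a, s))))"
      by (intro sum_mono row)
    also have "\<dots> = C * (\<Sum>v\<in>X. pnsq (h v))"
      by (simp add: Xprod sum_distrib_left sum.cartesian_product)
    also have "\<dots> \<le> C * (\<Sum>v\<in>X. C ^ d * pnsq (pdv v f))"
      unfolding h_def using Suc.IH[OF homog_pdv[OF Suc.prems]] C1
      by (intro mult_left_mono sum_mono) auto
    also have "\<dots> = C ^ Suc d * (\<Sum>v\<in>X. pnsq (pdv v f))"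
      by (simp add: sum_distrib_left mult_ac)
    also have "(\<Sum>v\<in>X. pnsq (pdv v f)) = real (Suc d) * pnsq f"
      by (rule pnsq_euler[symmetric, OF Suc.prems Xfin]) (use RK(2) in \<open>auto simp: X_def\<close>)
    finally have "real (Suc d) * pnsq F \<le> real (Suc d) * (C ^ Suc d * pnsq f)"
      by (simp add: mult_ac)
    then have "pnsq F \<le> C ^ Suc d * pnsq f"
      by (rule mult_left_le_imp_le) simp
    then show ?case by (simp add: F_def)
  qed
  then show ?thesis using C1 by blast
qed

subsection \<open>The modules\<close>

text \<open>Multiplication from the left commutes with multiplication from the right, even if the
  matrices on the right are singular or vary with the block.\<close>

lemma row_col_commute: "row_subst b (col_subst \<gamma> f) = col_subst \<gamma> (row_subst b f)"
proof -
  have "vapply (col_mat \<gamma>) (vapply (row_mat b) x) = vapply (row_mat b) (vapply (col_mat \<gamma>) x)" for x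
  proof
    fix v :: var
    show "vapply (col_mat \<gamma>) (vapply (row_mat b) x) v = vapply (row_mat b) (vapply (col_mat \<gamma>) x) v"
    proof (cases v)
      case (fields i a t)
      show ?thesis
        by (simp add: fields vapply_col vapply_row sum_distrib_left mult_ac) (rule sum.swap)
    qed
  qed
  then show ?thesis
    by (intro poly_ext) (simp add: row_subst_eq col_subst_eq pev_lsubst)
qed

lemma hw_spaceD:
  assumes "f \<in> hw_space b m k"
  shows "f \<in> polys b (length m) k"
    "g \<in> GL_group (length m) \<Longrightarrow> (\<And>i j. i < j \<Longrightarrow> g i j = 0) \<Longrightarrow>
      row_subst g f = pscale (\<Prod>i<length m. g i i ^ (m ! i)) f"
  using assms by (auto simp: hw_space_def pscale_def)

text \<open>The hypothesis on \<open>\<gamma>\<close> is wide enough for the action, the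
  contragredient action and truncation at once.\<close>

lemma hw_col:
  assumes f: "f \<in> hw_space b m k" and \<gamma>: "\<And>s t. t < k \<Longrightarrow> \<gamma> b s t \<noteq> 0 \<Longrightarrow> s < j"
  shows "col_subst \<gamma> f \<in> hw_space b m j"
proof -
  have "col_subst \<gamma> f \<in> polys b (length m) j"
    unfolding col_subst_eq polys_invars
    by (rule invars_lsubst[OF hw_spaceD(1)[OF f, unfolded polys_invars]])
      (use \<gamma> in \<open>auto simp: col_mat_def split: if_splits\<close>)
  then show ?thesis
    using f by (auto simp: hw_space_def row_col_commute col_subst_mult)
      (simp add: col_subst_eq)
qed

lemma hw_subspace: "pscale.subspace (hw_space b m k)"
proof -
  have "row_subst g (f + h) = row_subst g f + row_subst g h" "row_subst g (pscale c f) = pscale c (row_subst g f)"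
    "row_subst g 0 = 0" for g f h c
    by (simp_all add: row_subst_eq lsubst_add lsubst_pscale)
  then show ?thesis
    using invars_subspace unfolding pscale.subspace_def hw_space_def polys_invars pscale_def[symmetric]
    by (simp add: pscale.scale_right_distrib mult.commute)
qed

lemma hw_mono:
  assumes "k \<le> l"
  shows "hw_space b m k \<subseteq> hw_space b m l"
proof -
  have "polys b (length m) k \<subseteq> polys b (length m) l"
    unfolding polys_invars by (intro invars_mono) (use assms in auto)
  then show ?thesis unfolding hw_space_def by blast
qed

text \<open>Conjugating the coefficients of \<open>f\<close> amounts to conjugating the entries of
  the triangular matrix, and this permutes the matrices over which the weight condition
  quantifies.\<close>

lemma hw_pcnj:
  assumes f: "f \<in> hw_space b m k"
  shows "pcnj f \<in> hw_space b m k"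
proof -
  have "row_subst g (pcnj f) = Const (\<Prod>i<length m. g i i ^ (m ! i)) * pcnj f"
    if g: "g \<in> GL_group (length m)" and tri: "\<And>i j. i < j \<Longrightarrow> g i j = 0" for g
  proof -
    define c where "c g = (\<lambda>i j. cnj (g i j))" for g :: cmat
    have c1: "cmat_mult (c g) (c h) = c (cmat_mult g h)" for g h
      by (simp add: cmat_mult_def c_def)
    have c2: "c g \<in> cmat_carrier l" if "g \<in> cmat_carrier l" for g l
      using that by (auto simp: c_def cmat_carrier_def)
    have c3: "c cmat_one = cmat_one" by (intro ext) (simp add: c_def cmat_one_def)
    have "c g \<in> GL_group (length m)"
    proof -
      obtain h where h: "g \<in> cmat_carrier (length m)" "h \<in> cmat_carrier (length m)"
        "cmat_mult g h = cmat_one" "cmat_mult h g = cmat_one"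
        using g by (auto simp: GL_group_def)
      then have "cmat_mult (c g) (c h) = cmat_one" "cmat_mult (c h) (c g) = cmat_one"
        by (simp_all add: c1 c3)
      then show ?thesis using h c2 unfolding GL_group_def by blast
    qed
    then have "row_subst (c g) f = pscale (\<Prod>i<length m. c g i i ^ (m ! i)) f"
      by (rule hw_spaceD(2)[OF f]) (simp add: c_def tri)
    then have "pcnj (row_subst (c g) f) = pcnj (pscale (\<Prod>i<length m. c g i i ^ (m ! i)) f)"
      by (rule arg_cong)
    moreover have "(\<lambda>v u. cnj (row_mat (c g) v u)) = row_mat g"
      by (auto simp: row_mat_def c_def fun_eq_iff)
    ultimately show ?thesis
      using pcnj_pscale[of "\<Prod>i<length m. c g i i ^ (m ! i)" f]
      by (simp add: row_subst_eq pcnj_lsubst) (simp add: c_def pscale_def)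
  qed
  then show ?thesis
    using f by (auto simp: hw_space_def polys_def)
qed

lemma row_diag_GL:
  assumes "\<And>i. i < p \<Longrightarrow> z i \<noteq> 0"
  shows "(\<lambda>i j. if i = j then (if i < p then z i else 1) else 0) \<in> GL_group p" (is "?D z \<in> _")
proof -
  have c: "?D z \<in> cmat_carrier p" for z :: "nat \<Rightarrow> complex" by (auto simp: cmat_carrier_def)
  have "cmat_mult (?D y) (?D z) = cmat_one" if "\<And>i. i < p \<Longrightarrow> y i * z i = 1" for y z
  proof (intro ext)
    fix i j
    have "cmat_mult (?D y) (?D z) i j = (\<Sum>l\<in>{i}. ?D y i l * ?D z l j)"
      by (rule cmat_mult_superset) auto
    then show "cmat_mult (?D y) (?D z) i j = cmat_one i j"
      using that by (auto simp: cmat_one_def)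
  qed
  then have "cmat_mult (?D z) (?D (\<lambda>i. 1 / z i)) = cmat_one" "cmat_mult (?D (\<lambda>i. 1 / z i)) (?D z) = cmat_one"
    using assms by simp_all
  then show ?thesis
    unfolding GL_group_def mem_Collect_eq by (intro conjI bexI[of _ "?D (\<lambda>i. 1 / z i)"] c)
qed

text \<open>Twice the identity is among the lower triangular matrices of the weight condition. It
  scales every variable of the block by 2.\<close>

lemma hw_homog:
  assumes f: "f \<in> hw_space b m k"
  shows "homog (sum_list m) f"
proof -
  let ?p = "length m"
  let ?g = "\<lambda>i j. if i = j then (if i < ?p then (2::complex) else 1) else 0"
  have "row_subst ?g f = pscale (\<Prod>i<?p. ?g i i ^ (m ! i)) f"
    by (rule hw_spaceD(2)[OF f row_diag_GL]) auto
  also have "(\<Prod>i<?p. ?g i i ^ (m ! i)) = 2 ^ sum_list m"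
    by (simp add: sum_list_sum_nth atLeast0LessThan power_sum)
  finally have "row_subst ?g f = pscale (2 ^ sum_list m) f" .
  moreover have "row_subst ?g f = lsubst (diag_mat (\<lambda>_. 2)) f"
  proof (rule poly_ext)
    fix x
    show "pev x (row_subst ?g f) = pev x (lsubst (diag_mat (\<lambda>_. 2)) f)"
      unfolding row_subst_eq pev_lsubst
    proof (rule pev_cong_invars[OF hw_spaceD(1)[OF f, unfolded polys_invars]])
      fix v assume "v \<in> {(b', a, t). b' = b \<and> a < ?p \<and> t < k}"
      then obtain a t where v: "v = (b, a, t)" "a < ?p" by auto
      have "{c. ?g a c \<noteq> 0} = {a}" by auto
      then show "vapply (row_mat ?g) x v = vapply (diag_mat (\<lambda>_. 2)) x v"
        using v by (simp add: vapply_row vapply_diag)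
    qed
  qed
  ultimately show ?thesis by (simp add: homog_iff)
qed

section \<open>Tensor products of the modules\<close>

definition tvars :: "nat list list \<Rightarrow> nat \<Rightarrow> var set" where
  "tvars ms k = {(i, a, t). i < length ms \<and> a < length (ms ! i) \<and> t < k}"

definition tdeg :: "nat list list \<Rightarrow> nat" where
  "tdeg ms = (\<Sum>i<length ms. sum_list (ms ! i))"

lemma finite_tvars: "finite (tvars ms k)"
proof -
  have "tvars ms k = (SIGMA i:{..<length ms}. {..<length (ms ! i)} \<times> {..<k})"
    by (auto simp: tvars_def)
  then show ?thesis by simp
qed

lemma tensor_subspace: "pscale.subspace (tensor_space ms k)"
  by (simp add: tensor_space_def)

lemma tensor_induct [consumes 1, case_names prod 0 add scale]:
  assumes "f \<in> tensor_space ms k"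
    and "\<And>F. (\<And>i. i < length ms \<Longrightarrow> F i \<in> hw_space i (ms ! i) k) \<Longrightarrow> P (\<Prod>i<length ms. F i)"
    and "P 0" "\<And>f g. P f \<Longrightarrow> P g \<Longrightarrow> P (f + g)" "\<And>c f. P f \<Longrightarrow> P (pscale c f)"
  shows "P f"
proof -
  have "pscale.subspace (Collect P)" using assms(3-5) by (auto simp: pscale.subspace_def)
  then have "pscale.span {(\<Prod>i<length ms. f i) | f. \<forall>i<length ms. f i \<in> hw_space i (ms ! i) k} \<subseteq> Collect P"
    by (rule pscale.span_minimal[rotated]) (use assms(2) in auto)
  then show ?thesis using assms(1) by (auto simp: tensor_space_def)
qed

lemma tensor_prod:
  "(\<And>i. i < length ms \<Longrightarrow> F i \<in> hw_space i (ms ! i) k) \<Longrightarrow> (\<Prod>i<length ms. F i) \<in> tensor_space ms k"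
  unfolding tensor_space_def by (intro pscale.span_base) auto

lemma tensor_invars: "f \<in> tensor_space ms k \<Longrightarrow> f \<in> invars (tvars ms k)"
proof (induction rule: tensor_induct)
  case (prod F)
  have "F i \<in> invars (tvars ms k)" if "i < length ms" for i
    by (rule subsetD[OF invars_mono hw_spaceD(1)[OF prod[OF that], unfolded polys_invars]])
      (use that in \<open>auto simp: tvars_def\<close>)
  then show ?case by (intro invars_prod) auto
qed (auto intro: invars_add invars_pscale)

lemma tensor_homog: "f \<in> tensor_space ms k \<Longrightarrow> homog (tdeg ms) f"
  by (induction rule: tensor_induct)
    (auto intro: homog_add homog_pscale homog_prod hw_homog simp: tdeg_def)

lemma tensor_keys: "f \<in> tensor_space ms k \<Longrightarrow> keys f \<subseteq> {\<alpha>. keys \<alpha> \<subseteq> tvars ms k \<and> deg \<alpha> = tdeg ms}"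
  by (intro invars_homog_keys tensor_invars tensor_homog)

lemma finite_tensor_keys: "finite {\<alpha>. keys \<alpha> \<subseteq> tvars ms k \<and> deg \<alpha> = tdeg ms}"
  by (intro finite_monos finite_tvars)

lemma tensor_col:
  assumes "f \<in> tensor_space ms k" and \<gamma>: "\<And>i s t. t < k \<Longrightarrow> \<gamma> i s t \<noteq> 0 \<Longrightarrow> s < j"
  shows "col_subst \<gamma> f \<in> tensor_space ms j"
  using assms(1)
proof (induction rule: tensor_induct)
  case (prod F)
  then show ?case unfolding col_subst_prod by (intro tensor_prod hw_col \<gamma>) auto
qed (auto simp: col_subst_add col_subst_pscale col_subst_0
    intro: pscale.subspace_add pscale.subspace_scale pscale.subspace_0 tensor_subspace)

lemma tensor_mono: "k \<le> l \<Longrightarrow> tensor_space ms k \<subseteq> tensor_space ms l"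
  unfolding tensor_space_def by (intro pscale.span_mono) (use hw_mono in blast)

text \<open>With the source regarded as a tensor product with one factor, facts about tensor spaces
  apply to source and target alike.\<close>

lemma tensor_single: "tensor_space [m] k = hw_space 0 m k"
proof -
  have "{(\<Prod>i<length [m]. f i) | f. \<forall>i<length [m]. f i \<in> hw_space i ([m] ! i) k} = hw_space 0 m k"
    by (auto intro: exI[of _ "\<lambda>_. _"])
  then show ?thesis
    unfolding tensor_space_def by (simp add: pscale.span_eq_iff hw_subspace)
qed

lemma tensor_act: "f \<in> tensor_space ms k \<Longrightarrow> g \<in> cmat_carrier k \<Longrightarrow> act g f \<in> tensor_space ms k"
  unfolding act_def by (erule tensor_col) (use carrier_nonzero in blast)

lemma tensor_trunc: "f \<in> tensor_space ms k \<Longrightarrow> trunc j f \<in> tensor_space ms j"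
  unfolding trunc_eq by (erule tensor_col) (auto simp: proj_def split: if_splits)

subsection \<open>Column weights\<close>

text \<open>The torus of column \<open>l\<close>. Its elements with \<open>cmod z = 1\<close> are
  unitary and hence available for both choices of the group.\<close>

definition tor :: "nat \<Rightarrow> complex \<Rightarrow> cmat" where
  "tor l z = (\<lambda>i j. if i = j then (if i = l then z else 1) else 0)"

definition cwt :: "nat \<Rightarrow> mono \<Rightarrow> nat" where
  "cwt l \<alpha> = (\<Sum>v\<in>{v\<in>keys \<alpha>. snd (snd v) = l}. coef \<alpha> v)"

lemma tor_carrier: "l < k \<Longrightarrow> tor l z \<in> cmat_carrier k"
  by (auto simp: tor_def cmat_carrier_def)

lemma tor_mult: "cmat_mult (tor l y) (tor l z) = tor l (y * z)"
proof (intro ext)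
  fix i j
  have "cmat_mult (tor l y) (tor l z) i j = (\<Sum>a\<in>{i}. tor l y i a * tor l z a j)"
    by (rule cmat_mult_superset) (auto simp: tor_def)
  then show "cmat_mult (tor l y) (tor l z) i j = tor l (y * z) i j" by (simp add: tor_def)
qed

lemma tor_adjoint: "cmat_adjoint (tor l z) = tor l (cnj z)"
  by (auto simp: cmat_adjoint_def tor_def fun_eq_iff)

lemma tor_1: "tor l 1 = cmat_one"
  by (auto simp: tor_def cmat_one_def fun_eq_iff)

lemma tor_U: "l < k \<Longrightarrow> cmod z = 1 \<Longrightarrow> tor l z \<in> U_group k"
proof -
  assume "cmod z = 1"
  then have "z * cnj z = 1" using complex_norm_square[of z] by simp
  then show "l < k \<Longrightarrow> tor l z \<in> U_group k"
    by (simp add: U_group_def tor_carrier tor_adjoint tor_mult tor_1 mult.commute)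
qed

lemma coef_act_tor: "coef (act (tor l z) f) \<alpha> = z ^ cwt l \<alpha> * coef f \<alpha>"
proof -
  define d :: "var \<Rightarrow> complex" where "d v = (if snd (snd v) = l then z else 1)" for v
  have "vapply (col_mat (\<lambda>_. tor l z)) x = vapply (diag_mat d) x" for x
  proof
    fix v :: var
    obtain i a t where v: "v = (i, a, t)" by (cases v)
    have "vapply (col_mat (\<lambda>_. tor l z)) x v = (\<Sum>s<Suc (max l t). tor l z s t * x (i, a, s))"
      unfolding v by (rule vapply_act[OF tor_carrier[of l "Suc (max l t)"]]) auto
    also have "\<dots> = (\<Sum>s<Suc (max l t). if s = t then (if t = l then z else 1) * x (i, a, t) else 0)"
      by (intro sum.cong) (auto simp: tor_def)
    also have "\<dots> = vapply (diag_mat d) x v"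
      by (subst sum.delta) (auto simp: vapply_diag d_def v)
    finally show "vapply (col_mat (\<lambda>_. tor l z)) x v = vapply (diag_mat d) x v" .
  qed
  then have "act (tor l z) f = lsubst (diag_mat d) f"
    by (intro poly_ext) (simp add: act_eq pev_lsubst)
  moreover have "mev d \<alpha> = z ^ cwt l \<alpha>"
  proof -
    have "mev d \<alpha> = (\<Prod>v\<in>{v\<in>keys \<alpha>. snd (snd v) = l}. z ^ coef \<alpha> v)"
      unfolding mev_def by (intro prod.mono_neutral_cong_right) (auto simp: d_def)
    then show ?thesis by (simp add: cwt_def power_sum)
  qed
  ultimately show ?thesis by (simp add: coef_lsubst_diag)
qed

lemma circle_weight:
  assumes "\<And>z. cmod z = 1 \<Longrightarrow> z ^ a * c = z ^ b * c" "c \<noteq> 0"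
  shows "a = b"
proof -
  have aux: False if "a < b" "\<And>z. cmod z = 1 \<Longrightarrow> z ^ a * c = z ^ b * c" for a b :: nat
  proof -
    \<comment> \<open>With this root of -1 the two characters of the circle take opposite
      values.\<close>
    let ?z = "cis (pi / real (b - a))"
    have "real (b - a) * (pi / real (b - a)) = pi" using that(1) by simp
    moreover have "?z ^ (b - a) = cis (real (b - a) * (pi / real (b - a)))" by (rule Complex.DeMoivre)
    ultimately have "?z ^ (b - a) = -1" by (simp only: cis_pi)
    then have "?z ^ b = - (?z ^ a)"
      using that(1) by (metis le_add_diff_inverse less_imp_le mult_minus1_right power_add)
    with that(2)[of ?z] \<open>c \<noteq> 0\<close> show False by simp
  qed
  show ?thesis using aux[of a b] aux[of b a] assms(1) by (metis nat_neq_iff)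
qed

lemma weight_of_act_tor:
  assumes "\<And>z. cmod z = 1 \<Longrightarrow> act (tor l z) f = pscale (z ^ e) f" "\<alpha> \<in> keys f"
  shows "cwt l \<alpha> = e"
proof (rule circle_weight)
  show "coef f \<alpha> \<noteq> 0" using assms(2) by (simp add: in_keys_iff)
  show "z ^ cwt l \<alpha> * coef f \<alpha> = z ^ e * coef f \<alpha>" if "cmod z = 1" for z
    using arg_cong[OF assms(1)[OF that], of "\<lambda>h. coef h \<alpha>"] by (simp add: coef_act_tor)
qed

lemma cwt_0: "cwt l \<alpha> = 0 \<Longrightarrow> v \<in> keys \<alpha> \<Longrightarrow> snd (snd v) \<noteq> l"
proof
  assume "cwt l \<alpha> = 0" and v: "v \<in> keys \<alpha>" "snd (snd v) = l"
  then have "\<forall>u\<in>{v\<in>keys \<alpha>. snd (snd v) = l}. coef \<alpha> u = 0" by (simp add: cwt_def)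
  with v show False using in_keys_iff by blast
qed

lemma trunc_id:
  assumes "f \<in> invars {v. snd (snd v) < k}"
  shows "trunc k f = f"
proof (rule poly_ext)
  fix x
  show "pev x (trunc k f) = pev x f"
    unfolding trunc_eq col_subst_eq pev_lsubst
  proof (rule pev_cong_invars[OF assms])
    fix v :: var assume v: "v \<in> {v. snd (snd v) < k}"
    obtain i a t where iat: "v = (i, a, t)" by (cases v)
    have "{s. proj k s t \<noteq> 0} = {t}" using v iat by (auto simp: proj_def)
    then show "vapply (col_mat (\<lambda>_. proj k)) x v = x v"
      using v iat by (simp add: vapply_col) (simp add: proj_def)
  qed
qed

lemma tvars_lt: "tvars ms k \<subseteq> {v. snd (snd v) < k}"
  by (auto simp: tvars_def)

lemma tensor_trunc_id: "f \<in> tensor_space ms k \<Longrightarrow> trunc k f = f"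
  using trunc_id tensor_invars invars_mono[OF tvars_lt] by blast

lemma act_outside:
  assumes "f \<in> invars {v. snd (snd v) < k}" "\<And>s t. t < k \<Longrightarrow> g s t = (if s = t then 1 else 0)"
  shows "act g f = f"
proof (rule poly_ext)
  fix x
  show "pev x (act g f) = pev x f"
    unfolding act_eq pev_lsubst
  proof (rule pev_cong_invars[OF assms(1)])
    fix v :: var assume v: "v \<in> {v. snd (snd v) < k}"
    obtain i a t where iat: "v = (i, a, t)" by (cases v)
    have "{s. g s t \<noteq> 0} = {t}" using v iat assms(2) by auto
    then show "vapply (col_mat (\<lambda>_. g)) x v = x v"
      using v iat by (simp add: vapply_col) (simp add: assms(2))
  qed
qed

lemma act_tor_outside: "f \<in> tensor_space ms k \<Longrightarrow> k \<le> l \<Longrightarrow> act (tor l z) f = f"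
  by (rule act_outside[of f k], use tensor_invars invars_mono[OF tvars_lt] in blast) (auto simp: tor_def)

lemma fixed_in_columns:
  assumes "\<And>\<alpha> l. \<alpha> \<in> keys f \<Longrightarrow> k \<le> l \<Longrightarrow> cwt l \<alpha> = 0"
  shows "f \<in> invars {v. snd (snd v) < k}"
  unfolding invars_def using assms cwt_0 by (blast intro: leI)

text \<open>Being fixed by the tori of all columns from \<open>k\<close> on means weight 0 there, so
  these columns do not occur. Truncation then changes nothing, and it is truncation that provides
  membership in the smaller tensor space.\<close>

lemma tensor_fixed:
  assumes "f \<in> tensor_space ms L" "\<And>l z. k \<le> l \<Longrightarrow> cmod z = 1 \<Longrightarrow> act (tor l z) f = f"
  shows "f \<in> tensor_space ms k"
proof -
  have "f \<in> invars {v. snd (snd v) < k}"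
    by (rule fixed_in_columns, rule weight_of_act_tor) (use assms(2) in auto)
  then show ?thesis using tensor_trunc[OF assms(1), of k] trunc_id by simp
qed

subsection \<open>Evaluation at matrices\<close>

text \<open>The same matrix is put into every block; vectors of \<open>hw_space 0 m k\<close> see
  only the copy in block 0.\<close>

definition pt :: "cmat \<Rightarrow> var \<Rightarrow> complex" where
  "pt y = (\<lambda>(i, a, t). y a t)"

lemma pev_limit:
  assumes "\<And>v. ((\<lambda>z. x z v) \<longlongrightarrow> x0 v) F" "F \<noteq> bot" "eventually (\<lambda>z. pev (x z) f = c) F"
  shows "pev x0 f = c"
proof -
  have "((\<lambda>z. pev (x z) f) \<longlongrightarrow> pev x0 f) F"
    unfolding pev_def mev_def by (intro tendsto_intros assms(1))
  moreover have "((\<lambda>z. pev (x z) f) \<longlongrightarrow> c) F"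
    by (rule tendsto_eventually[OF assms(3)])
  ultimately show ?thesis using assms(2) tendsto_unique by blast
qed

lemma hw_invars: "f \<in> hw_space 0 m k \<Longrightarrow> f \<in> invars {(i, a, t). i = 0 \<and> a < length m \<and> t < k}"
  using hw_spaceD(1)[of f 0 m k] by (simp add: polys_invars)

lemma pev_pt_cong:
  assumes "f \<in> hw_space 0 m k" "\<And>a t. a < length m \<Longrightarrow> t < k \<Longrightarrow> x (0, a, t) = y a t"
  shows "pev x f = pev (pt y) f"
  by (rule pev_cong_invars[OF hw_invars[OF assms(1)]]) (use assms(2) in \<open>auto simp: pt_def\<close>)

lemma vapply_row_pt: "vapply (row_mat b) (pt y) = pt (cmat_mult b y)"
  by (auto simp: fun_eq_iff vapply_row pt_def cmat_mult_def)

lemma pev_row: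
  assumes "f \<in> hw_space 0 m k" "b \<in> GL_group (length m)" "\<And>i j. i < j \<Longrightarrow> b i j = 0"
  shows "pev (pt (cmat_mult b y)) f = (\<Prod>i<length m. b i i ^ (m ! i)) * pev (pt y) f"
proof -
  have "pev (pt (cmat_mult b y)) f = pev (pt y) (row_subst b f)"
    by (simp add: row_subst_eq pev_lsubst vapply_row_pt)
  then show ?thesis by (simp add: hw_spaceD(2)[OF assms] pev_pscale)
qed

lemma pev_act_pt:
  assumes "f \<in> hw_space 0 m k" "length m \<le> k" "g \<in> cmat_carrier k"
  shows "pev (pt y) (act g f) = pev (pt (\<lambda>a t. \<Sum>s<k. y a s * g s t)) f"
  unfolding act_eq pev_lsubst
  by (rule pev_pt_cong[OF assms(1)]) (simp add: vapply_act[OF assms(3) order_refl] pt_def mult.commute)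

lemma pev_act_mult:
  assumes "f \<in> hw_space 0 m k" "length m \<le> k" "g \<in> cmat_carrier k" "h \<in> cmat_carrier k"
  shows "pev (pt h) (act g f) = pev (pt (cmat_mult h g)) f"
  unfolding pev_act_pt[OF assms(1-3)]
  by (rule pev_pt_cong[OF assms(1)])
    (use assms(2) in \<open>simp add: pt_def cmat_mult_carrier[OF assms(4) order_refl]\<close>)

lemma pev_act_one:
  assumes "f \<in> hw_space 0 m k" "length m \<le> k" "g \<in> cmat_carrier k"
  shows "pev (pt cmat_one) (act g f) = pev (pt g) f"
  using pev_act_mult[OF assms cmat_one_carrier] cmat_mult_one(1)[OF assms(3)] by simp

text \<open>Multiplying by \<open>elim_mat q r c\<close> from the left adds multiples of row \<open>r\<close> to the rows below and
  rescales row \<open>r\<close>.\<close>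

definition elim_mat :: "nat \<Rightarrow> nat \<Rightarrow> (nat \<Rightarrow> complex) \<Rightarrow> cmat" where
  "elim_mat q r c = (\<lambda>i j. if j = r \<and> r \<le> i \<and> i < q then c i else if i = j then 1 else 0)"

lemma elim_mult:
  assumes "r < q"
  shows "cmat_mult (elim_mat q r c) y i t =
    (if i = r then c r * y r t else if r < i \<and> i < q then y i t + c i * y r t else y i t)"
proof -
  have "cmat_mult (elim_mat q r c) y i t = (\<Sum>l\<in>{i, r}. elim_mat q r c i l * y l t)"
    by (rule cmat_mult_superset) (auto simp: elim_mat_def split: if_splits)
  then show ?thesis using assms by (cases "i = r") (auto simp: elim_mat_def)
qed

lemma elim_GL:
  assumes "r < q" "c r \<noteq> 0"
  shows "elim_mat q r c \<in> GL_group q"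
proof -
  have car: "elim_mat q r c \<in> cmat_carrier q" for c
    using assms(1) by (auto simp: elim_mat_def cmat_carrier_def)
  define c' where "c' i = (if i = r then 1 / c r else - c i / c r)" for i
  have "cmat_mult (elim_mat q r c) (elim_mat q r c') = cmat_one"
    "cmat_mult (elim_mat q r c') (elim_mat q r c) = cmat_one"
    using assms by (auto simp: fun_eq_iff elim_mult cmat_one_def) (auto simp: elim_mat_def c'_def)
  with car show ?thesis unfolding GL_group_def by blast
qed

text \<open>The diagonal of the elimination matrix has no zero, so the weight condition multiplies
  the value by a nonzero factor.\<close>

lemma pev_elim:
  assumes "f \<in> hw_space 0 m k" "r < length m" "c r \<noteq> 0"
    and "pev (pt (cmat_mult (elim_mat (length m) r c) y)) f = 0"
  shows "pev (pt y) f = 0"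
proof -
  let ?E = "elim_mat (length m) r c"
  have "?E i i \<noteq> 0" for i
    using assms(3) by (auto simp: elim_mat_def)
  then have "(\<Prod>i<length m. ?E i i ^ (m ! i)) \<noteq> 0"
    by simp
  moreover have "pev (pt (cmat_mult ?E y)) f = (\<Prod>i<length m. ?E i i ^ (m ! i)) * pev (pt y) f"
    by (rule pev_row[OF assms(1) elim_GL[of r "length m" c, OF assms(2,3)]]) (auto simp: elim_mat_def)
  ultimately show ?thesis using assms(4) by (metis mult_eq_0_iff)
qed

text \<open>Perturb the pivot \<open>y r r\<close> and pass to the limit.\<close>

lemma pev_perturb:
  assumes "\<And>z. y r r + z \<noteq> 0 \<Longrightarrow> pev (pt (\<lambda>a t. y a t + (if a = r \<and> t = r then z else 0))) f = 0"
  shows "pev (pt y) f = 0"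
proof (rule pev_limit[where F = "at 0"])
  let ?x = "\<lambda>z. pt (\<lambda>a t. y a t + (if a = r \<and> t = r then z else 0))"
  show "((\<lambda>z. ?x z v) \<longlongrightarrow> pt y v) (at 0)" for v
  proof (cases v)
    case (fields i a t)
    have "((\<lambda>z. y a t + (if a = r \<and> t = r then z else 0)) \<longlongrightarrow> y a t + 0) (at 0)"
      by (intro tendsto_intros) (cases "a = r \<and> t = r"; auto intro: tendsto_ident_at)
    then show ?thesis by (simp add: fields pt_def)
  qed
  have "eventually (\<lambda>z. z \<noteq> - y r r) (at 0)"
    by (rule eventually_neq_at_within)
  then show "eventually (\<lambda>z. pev (?x z) f = 0) (at 0)"
  proof (rule eventually_mono)
    fix z assume "z \<noteq> - y r r"
    then have "y r r + z \<noteq> 0" by (simp add: add_eq_0_iff)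
    then show "pev (?x z) f = 0" by (rule assms)
  qed
qed simp

text \<open>Conjugation by the torus contracts an upper triangular matrix to its diagonal, so \<open>f\<close> vanishes on
  the upper triangular matrices. Row operations reduce the other matrices to these.\<close>

lemma hw_weight_unique:
  assumes f: "f \<in> hw_space 0 m k" and qk: "length m \<le> k"
    and wt: "\<And>\<alpha> l. \<alpha> \<in> keys f \<Longrightarrow> l < k \<Longrightarrow> cwt l \<alpha> = (if l < length m then m ! l else 0)"
    and one: "pev (pt cmat_one) f = 0"
  shows "f = 0"
proof -
  let ?q = "length m"
  have cols: "snd (snd v) < ?q" if "\<alpha> \<in> keys f" "v \<in> keys \<alpha>" for \<alpha> v
  proof (rule ccontr)
    assume n: "\<not> snd (snd v) < ?q"
    have "v \<in> {(i, a, t). i = 0 \<and> a < length m \<and> t < k}"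
      using hw_invars[OF f] that unfolding invars_def by blast
    then have "snd (snd v) < k" by auto
    then have "cwt (snd (snd v)) \<alpha> = 0" using wt[OF that(1)] n by simp
    then show False using cwt_0 that(2) by blast
  qed
  \<comment> \<open>All monomials of \<open>f\<close> have the same column weights, so scaling the
    columns multiplies the values by a character. Zeros in \<open>D\<close> are allowed, which
    matters for singular diagonal matrices.\<close>
  have colscale: "pev (pt (\<lambda>a t. y a t * D t)) f = (\<Prod>l<?q. D l ^ (m ! l)) * pev (pt y) f" for y D
  proof -
    have "mev (pt (\<lambda>a t. y a t * D t)) \<alpha> = (\<Prod>l<?q. D l ^ (m ! l)) * mev (pt y) \<alpha>" if a: "\<alpha> \<in> keys f" for \<alpha>
    proof -
      have "mev (pt (\<lambda>a t. y a t * D t)) \<alpha> = mev (pt y) \<alpha> * (\<Prod>v\<in>keys \<alpha>. D (snd (snd v)) ^ coef \<alpha> v)"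
        by (simp add: mev_def pt_def case_prod_unfold power_mult_distrib prod.distrib)
      also have "(\<Prod>v\<in>keys \<alpha>. D (snd (snd v)) ^ coef \<alpha> v) =
          (\<Prod>l<?q. \<Prod>v\<in>{v\<in>keys \<alpha>. snd (snd v) = l}. D (snd (snd v)) ^ coef \<alpha> v)"
        by (rule prod.group[symmetric]) (use cols[OF a] in auto)
      also have "\<dots> = (\<Prod>l<?q. D l ^ cwt l \<alpha>)"
        by (intro prod.cong) (auto simp: cwt_def power_sum)
      also have "\<dots> = (\<Prod>l<?q. D l ^ (m ! l))"
        using wt[OF a] qk by (intro prod.cong) auto
      finally show ?thesis by (simp add: mult.commute)
    qed
    then show ?thesis by (simp add: pev_def sum_distrib_left mult_ac)
  qed
  have loc: "pev (pt y) f = pev (pt y') f" if "\<And>a t. a < ?q \<Longrightarrow> t < ?q \<Longrightarrow> y a t = y' a t" for y y'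
  proof (rule pev_cong)
    fix \<alpha> v assume av: "\<alpha> \<in> keys f" "v \<in> keys \<alpha>"
    obtain i a t where v: "v = (i, a, t)" by (cases v)
    have "v \<in> {(i, a, t). i = 0 \<and> a < length m \<and> t < k}"
      using hw_invars[OF f] av unfolding invars_def by blast
    then show "pt y v = pt y' v" using cols[OF av] that by (simp add: v pt_def)
  qed
  have upper: "pev (pt y) f = 0" if y: "\<And>a t. t < a \<Longrightarrow> a < ?q \<Longrightarrow> y a t = 0" for y
  proof -
    \<comment> \<open>Dividing row \<open>a\<close> by \<open>z ^ a\<close> and multiplying column
      \<open>t\<close> by \<open>z ^ t\<close> produces the exponent \<open>t - a\<close>. The
      characters of the two scalings cancel because the row and column weights agree, and at
      \<open>z = 0\<close> only the diagonal is left.\<close>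
    define yz where "yz z = (\<lambda>a t. if a \<le> t then y a t * z ^ (t - a) else 0)" for z :: complex
    have c: "pev (pt (yz z)) f = pev (pt y) f" if z: "z \<noteq> 0" for z
    proof -
      let ?d = "\<lambda>i j. if i = j then (if i < ?q then (1 / z) ^ i else 1) else 0"
      have G: "?d \<in> GL_group ?q" by (rule row_diag_GL) (use z in auto)
      have "cmat_mult ?d (\<lambda>a t. y a t * z ^ t) a t = ?d a a * (y a t * z ^ t)" for a t
        by (subst cmat_mult_superset[of "{a}"]) auto
      then have "pev (pt (yz z)) f = pev (pt (cmat_mult ?d (\<lambda>a t. y a t * z ^ t))) f"
        using z y by (intro loc) (auto simp: yz_def power_diff field_simps)
      also have "\<dots> = (\<Prod>i<?q. ?d i i ^ (m ! i)) * ((\<Prod>l<?q. (z ^ l) ^ (m ! l)) * pev (pt y) f)"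
        by (subst pev_row[OF f G]) (auto simp: colscale)
      also have "(\<Prod>i<?q. ?d i i ^ (m ! i)) * (\<Prod>l<?q. (z ^ l) ^ (m ! l)) = 1"
        unfolding prod.distrib[symmetric]
        by (intro prod.neutral) (use z in \<open>auto simp: power_mult_distrib[symmetric]\<close>)
      ultimately show ?thesis by (simp add: mult.assoc[symmetric])
    qed
    have "pev (pt (yz 0)) f = pev (pt y) f"
    proof (rule pev_limit[where F = "at 0"])
      show "((\<lambda>z. pt (yz z) v) \<longlongrightarrow> pt (yz 0) v) (at 0)" for v
        unfolding pt_def yz_def case_prod_unfold by (cases "fst (snd v) \<le> snd (snd v)") (auto intro!: tendsto_intros)
      show "eventually (\<lambda>z. pev (pt (yz z)) f = pev (pt y) f) (at 0)"
        using c by (auto simp: eventually_at_filter)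
    qed simp
    moreover have "pev (pt (yz 0)) f = pev (pt (\<lambda>a t. cmat_one a t * y t t)) f"
      by (intro loc) (auto simp: yz_def cmat_one_def)
    ultimately show ?thesis using one by (simp add: colscale)
  qed
  \<comment> \<open>Gaussian elimination by descending induction: \<open>r\<close> columns are
    already cleared below the diagonal, and for \<open>r = ?q\<close> the matrix is upper
    triangular.\<close>
  have step: "pev (pt y) f = 0" if "r \<le> ?q" "\<And>j i. j < r \<Longrightarrow> j < i \<Longrightarrow> i < ?q \<Longrightarrow> y i j = 0" for r y
    using that
  proof (induction r arbitrary: y rule: inc_induct)
    case base
    then show ?case by (intro upper) auto
  next
    case (step r)
    have main: "pev (pt y) f = 0" if y: "\<And>j i. j < r \<Longrightarrow> j < i \<Longrightarrow> i < ?q \<Longrightarrow> y i j = 0" "y r r \<noteq> 0" for y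
    proof (rule pev_elim[OF f step.hyps(2), of "\<lambda>i. if i = r then 1 else - y i r / y r r"])
      show "pev (pt (cmat_mult (elim_mat ?q r (\<lambda>i. if i = r then 1 else - y i r / y r r)) y)) f = 0"
        by (rule step.IH) (use y step.hyps in \<open>auto simp: elim_mult less_Suc_eq\<close>)
    qed simp
    show ?case
      by (rule pev_perturb[where r = r], rule main) (use step.prems in auto)
  qed
  have "pev x f = 0" for x
  proof -
    have "pev x f = pev (pt (\<lambda>a t. x (0, a, t))) f" by (rule pev_pt_cong[OF f]) simp
    also have "\<dots> = 0" by (rule step[of 0]) auto
    finally show ?thesis .
  qed
  then show ?thesis by (rule poly_eq_0I)
qed

subsection \<open>Cyclicity\<close>

lemma U_mult:
  assumes "g \<in> U_group k" "h \<in> U_group k"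
  shows "cmat_mult g h \<in> U_group k"
proof -
  have g: "g \<in> cmat_carrier k" "cmat_adjoint g \<in> cmat_carrier k"
      "cmat_mult g (cmat_adjoint g) = cmat_one" "cmat_mult (cmat_adjoint g) g = cmat_one"
    and h: "h \<in> cmat_carrier k" "cmat_adjoint h \<in> cmat_carrier k"
      "cmat_mult h (cmat_adjoint h) = cmat_one" "cmat_mult (cmat_adjoint h) h = cmat_one"
    using assms cmat_adjoint_carrier by (auto simp: U_group_def)
  have cc: "cmat_adjoint (cmat_mult g h) = cmat_mult (cmat_adjoint h) (cmat_adjoint g)"
  proof (intro ext)
    fix i j
    define K where "K = max k (Suc (max i j))"
    have K: "k \<le> K" "i < K" "j < K" by (auto simp: K_def)
    show "cmat_adjoint (cmat_mult g h) i j = cmat_mult (cmat_adjoint h) (cmat_adjoint g) i j"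
      unfolding cmat_mult_carrier[OF h(2) K(1,2)]
      by (simp add: cmat_adjoint_def cmat_mult_carrier[OF g(1) K(1,3)] mult.commute)
  qed
  have "cmat_mult (cmat_mult g h) (cmat_mult (cmat_adjoint h) (cmat_adjoint g)) = cmat_one"
    using cmat_mult_assoc[OF g(1) h(1)] cmat_mult_assoc[OF h(1,2), of "cmat_adjoint g"] g h
      cmat_mult_one(1)[OF g(2)] by simp
  moreover have "cmat_mult (cmat_mult (cmat_adjoint h) (cmat_adjoint g)) (cmat_mult g h) = cmat_one"
    using cmat_mult_assoc[OF h(2) g(2)] cmat_mult_assoc[OF g(2,1), of h] g h
      cmat_mult_one(1)[OF h(1)] by simp
  ultimately show ?thesis
    using cmat_mult_closed[OF g(1) h(1)] by (simp add: U_group_def cc)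
qed

lemma U_one: "cmat_one \<in> U_group k"
proof -
  have "cmat_adjoint cmat_one = cmat_one" by (auto simp: cmat_adjoint_def cmat_one_def fun_eq_iff)
  then show ?thesis
    using cmat_mult_one(1)[OF cmat_one_carrier] by (simp add: U_group_def cmat_one_carrier)
qed

text \<open>The Householder reflection that fixes the first \<open>r\<close> coordinates and takes
  the tail of the row \<open>x\<close> to a multiple of the basis vector with index
  \<open>r\<close>. If the tail is such a multiple already, the identity serves; otherwise the
  denominator \<open>c\<close> below is positive.\<close>

lemma householder:
  assumes r: "r < k"
  shows "\<exists>u\<in>U_group k. (\<forall>s t. s < r \<or> t < r \<longrightarrow> u s t = (if s = t then 1 else 0)) \<and>
    (\<forall>t. r < t \<and> t < k \<longrightarrow> (\<Sum>s\<in>{r..<k}. x s * u s t) = 0)"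
proof (cases "\<forall>s. r < s \<and> s < k \<longrightarrow> x s = 0")
  case True
  have "(\<Sum>s\<in>{r..<k}. x s * cmat_one s t) = 0" if "r < t" "t < k" for t
    using True that by (intro sum.neutral) (auto simp: cmat_one_def)
  then show ?thesis using U_one by (intro bexI[of _ cmat_one]) (auto simp: cmat_one_def)
next
  case False
  then obtain s0 where s0: "r < s0" "s0 < k" "x s0 \<noteq> 0" by blast
  let ?I = "{r..<k}"
  define N where "N = (\<Sum>s\<in>?I. (cmod (x s))\<^sup>2)"
  define n where "n = sqrt N"
  have N0: "0 \<le> N" by (simp add: N_def sum_nonneg)
  have nN: "n\<^sup>2 = N" using N0 by (simp add: n_def)
  have lt: "cmod (x r) < n"
  proof -
    have "(\<Sum>s\<in>{r, s0}. (cmod (x s))\<^sup>2) \<le> N"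
      unfolding N_def using r s0 by (intro sum_mono2) auto
    then have "(cmod (x r))\<^sup>2 + (cmod (x s0))\<^sup>2 \<le> N" using s0 by simp
    moreover have "0 < (cmod (x s0))\<^sup>2" using s0 by simp
    ultimately have "(cmod (x r))\<^sup>2 < n\<^sup>2" using nN by linarith
    then show ?thesis by (rule power2_less_imp_less) (simp add: n_def N0)
  qed
  have n0: "0 < n" using lt norm_ge_zero[of "x r"] by linarith
  \<comment> \<open>Modulus \<open>n\<close> and the phase of \<open>x r\<close> make the product of
    \<open>x\<close> with \<open>v\<close> real and equal to half the squared norm of
    \<open>v\<close>. The reflection in \<open>v\<close> therefore takes \<open>x\<close> to
    \<open>\<alpha>\<close> times the basis vector.\<close>
  obtain \<alpha> where \<alpha>: "cmod \<alpha> = n" "x r * cnj \<alpha> = of_real (n * cmod (x r))"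
  proof (cases "x r = 0")
    case True
    then show ?thesis using that[of "of_real n"] n0 by simp
  next
    case False
    have "x r * cnj (x r) = of_real ((cmod (x r))\<^sup>2)" by (rule complex_norm_square[symmetric])
    then have "x r * cnj (x r * of_real (n / cmod (x r))) = of_real ((cmod (x r))\<^sup>2 * (n / cmod (x r)))"
      by (simp only: complex_cnj_mult complex_cnj_complex_of_real mult.assoc[symmetric] of_real_mult)
    also have "(cmod (x r))\<^sup>2 * (n / cmod (x r)) = n * cmod (x r)"
      using False by (simp add: power2_eq_square)
    finally have "x r * cnj (x r * of_real (n / cmod (x r))) = of_real (n * cmod (x r))" .
    moreover have "cmod (x r * of_real (n / cmod (x r))) = n"
      using False n0 by (simp add: norm_mult norm_divide)
    ultimately show ?thesis by (rule that[rotated])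
  qed
  define v where "v s = (if s \<in> ?I then x s - (if s = r then \<alpha> else 0) else 0)" for s
  define c where "c = n\<^sup>2 - n * cmod (x r)"
  have c0: "0 < c" using lt n0 by (simp add: c_def power2_eq_square)
  have sq: "(\<Sum>s\<in>?I. x s * cnj (x s)) = of_real N"
    by (simp add: N_def complex_norm_square[symmetric])
  have S: "finite ?I" "r \<in> ?I" using r by auto
  have xv: "(\<Sum>s\<in>?I. x s * cnj (v s)) = of_real c"
  proof -
    have "(\<Sum>s\<in>?I. x s * cnj (v s)) = (\<Sum>s\<in>?I. x s * cnj (x s) - (if s = r then x r * cnj \<alpha> else 0))"
      by (intro sum.cong) (auto simp: v_def algebra_simps)
    also have "\<dots> = of_real N - x r * cnj \<alpha>"
      using S by (simp add: sum_subtractf sq sum.delta)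
    finally show ?thesis by (simp add: \<alpha>(2) c_def nN)
  qed
  have vv: "(\<Sum>s\<in>?I. v s * cnj (v s)) = of_real (2 * c)"
  proof -
    have "(\<Sum>s\<in>?I. v s * cnj (v s)) = (\<Sum>s\<in>?I. x s * cnj (v s) - (if s = r then \<alpha> * cnj (v r) else 0))"
      by (intro sum.cong) (auto simp: v_def algebra_simps)
    also have "\<dots> = of_real c - \<alpha> * cnj (v r)"
      using S by (simp add: sum_subtractf xv sum.delta)
    also have "\<alpha> * cnj (v r) = cnj (x r * cnj \<alpha>) - \<alpha> * cnj \<alpha>"
      using S by (simp add: v_def algebra_simps)
    also have "\<alpha> * cnj \<alpha> = of_real N" using \<alpha>(1) nN by (simp add: complex_norm_square[symmetric])
    finally show ?thesis by (simp add: \<alpha>(2) c_def nN)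
  qed
  define u :: cmat where "u s t = (if s = t then 1 else 0) - cnj (v s) * v t / of_real c" for s t
  have v0: "v s = 0" if "s \<notin> ?I" for s using that unfolding v_def by (simp only: if_False)
  have car: "u \<in> cmat_carrier k" using v0 by (auto simp: cmat_carrier_def u_def)
  have adj: "cmat_adjoint u = u"
    by (auto simp: cmat_adjoint_def u_def fun_eq_iff mult.commute)
  have uu: "cmat_mult u u = cmat_one"
  proof (intro ext)
    fix i j
    define K where "K = max k (Suc (max i j))"
    have K: "k \<le> K" "i < K" "j < K" by (auto simp: K_def)
    have vvK: "(\<Sum>s<K. v s * cnj (v s)) = of_real (2 * c)"
      unfolding vv[symmetric] using K v0 by (intro sum.mono_neutral_right) auto
    have "cmat_mult u u i j = (\<Sum>l<K. u i l * u l j)" by (rule cmat_mult_carrier[OF car K(1,2)])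
    also have "\<dots> = (\<Sum>l<K. (if l = i then u i j else 0) - (if l = j then cnj (v i) * v j / of_real c else 0)
        + cnj (v i) * v j / (of_real c * of_real c) * (v l * cnj (v l)))"
      by (intro sum.cong refl) (auto simp: u_def algebra_simps)
    also have "\<dots> = u i j - cnj (v i) * v j / of_real c
        + cnj (v i) * v j / (of_real c * of_real c) * of_real (2 * c)"
      unfolding sum.distrib sum_subtractf sum_distrib_left[symmetric] vvK using K by (simp add: sum.delta)
    also have "\<dots> = cmat_one i j"
      using c0 by (simp add: u_def cmat_one_def field_simps)
    finally show "cmat_mult u u i j = cmat_one i j" .
  qed
  have "u \<in> U_group k" using car adj uu by (simp add: U_group_def)
  moreover have "u s t = (if s = t then 1 else 0)" if "s < r \<or> t < r" for s t
    using that v0 by (auto simp: u_def)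
  moreover have "(\<Sum>s\<in>?I. x s * u s t) = 0" if t: "r < t" "t < k" for t
  proof -
    have "(\<Sum>s\<in>?I. x s * u s t) = (\<Sum>s\<in>?I. (if s = t then x t else 0) - v t / of_real c * (x s * cnj (v s)))"
      by (intro sum.cong) (auto simp: u_def algebra_simps)
    also have "\<dots> = x t - v t / of_real c * of_real c"
      unfolding sum_subtractf sum_distrib_left[symmetric] xv using t by (simp add: sum.delta)
    also have "\<dots> = 0" using c0 t by (simp add: v_def)
    finally show ?thesis .
  qed
  ultimately show ?thesis by blast
qed

lemma hw_act: "f \<in> hw_space b m k \<Longrightarrow> g \<in> cmat_carrier k \<Longrightarrow> act g f \<in> hw_space b m k"
  unfolding act_def by (erule hw_col) (use carrier_nonzero in blast)

text \<open>Unitary column operations make a matrix lower triangular, and then row operations reduce it to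
  the first rows of the identity.\<close>

lemma hw_cyclic:
  assumes f: "f \<in> hw_space 0 m k" and qk: "length m \<le> k"
    and van: "\<And>u. u \<in> U_group k \<Longrightarrow> pev (pt u) f = 0"
  shows "f = 0"
proof -
  let ?q = "length m"
  \<comment> \<open>This set is stable under U(k), so the reductions below may replace the vector
    \<open>h\<close> along with the matrix \<open>y\<close>.\<close>
  define N where "N = {f \<in> hw_space 0 m k. \<forall>u\<in>U_group k. pev (pt u) f = 0}"
  have NH: "h \<in> hw_space 0 m k" if "h \<in> N" for h using that by (simp add: N_def)
  have Uc: "u \<in> cmat_carrier k" if "u \<in> U_group k" for u using that by (simp add: U_group_def)
  have Nact: "act u h \<in> N" if "h \<in> N" "u \<in> U_group k" for u h
    using that U_mult[OF _ that(2)] unfolding N_def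
    by (auto simp: hw_act Uc pev_act_mult[OF _ qk])
  \<comment> \<open>Lower triangular \<open>y\<close>: descending induction on the number
    \<open>r\<close> of columns that already agree with those of the identity.\<close>
  have low: "pev (pt y) h = 0" if h: "h \<in> N" and "r \<le> ?q"
    and "\<And>a t. a < ?q \<Longrightarrow> a < t \<Longrightarrow> t < k \<Longrightarrow> y a t = 0"
    and "\<And>a t. a < ?q \<Longrightarrow> t < r \<Longrightarrow> y a t = (if a = t then 1 else 0)" for r y h
    using that(2-)
  proof (induction r arbitrary: y rule: inc_induct)
    case base
    have "pev (pt y) h = pev (pt cmat_one) h"
    proof (rule pev_pt_cong[OF NH[OF h]])
      fix a t assume "a < ?q" "t < k"
      then show "pt y (0, a, t) = cmat_one a t"
        using base(1)[of a t] base(2)[of a t] by (cases a t rule: linorder_cases) (auto simp: pt_def cmat_one_def)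
    qed
    then show ?case using h U_one by (simp add: N_def)
  next
    case (step r)
    have main: "pev (pt y) h = 0" if y: "\<And>a t. a < ?q \<Longrightarrow> a < t \<Longrightarrow> t < k \<Longrightarrow> y a t = 0"
      "\<And>a t. a < ?q \<Longrightarrow> t < r \<Longrightarrow> y a t = (if a = t then 1 else 0)" "y r r \<noteq> 0" for y
    \<comment> \<open>Here the pivot is also scaled to 1, because the reduction has to end at the
      identity, where \<open>h\<close> vanishes.\<close>
    proof (rule pev_elim[OF NH[OF h] step.hyps(2), of "\<lambda>i. if i = r then 1 / y r r else - y i r / y r r"])
      show "pev (pt (cmat_mult (elim_mat ?q r (\<lambda>i. if i = r then 1 / y r r else - y i r / y r r)) y)) h = 0"
      proof (rule step.IH)
        fix a t assume "a < ?q" "a < t" "t < k"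
        then show "cmat_mult (elim_mat ?q r (\<lambda>i. if i = r then 1 / y r r else - y i r / y r r)) y a t = 0"
          using y(1)[of a t] y(1)[of r t] step.hyps by (auto simp: elim_mult)
      next
        fix a t assume at: "a < ?q" "t < Suc r"
        have "y a r = 0" if "a < r" using y(1)[OF at(1) that] step.hyps qk by simp
        then show "cmat_mult (elim_mat ?q r (\<lambda>i. if i = r then 1 / y r r else - y i r / y r r)) y a t =
            (if a = t then 1 else 0)"
          using y(2)[of a t] y(2)[of r t] y(3) at step.hyps by (auto simp: elim_mult less_Suc_eq)
      qed
    qed (use y in auto)
    show ?case
      by (rule pev_perturb[where r = r], rule main) (use step.prems in auto)
  qed
  \<comment> \<open>General \<open>y\<close>: descending induction on the number \<open>r\<close> of
    rows that already vanish to the right of the diagonal.\<close>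
  have red: "pev (pt y) h = 0" if "h \<in> N" "r \<le> ?q" "\<And>a t. a < r \<Longrightarrow> a < t \<Longrightarrow> t < k \<Longrightarrow> y a t = 0" for r y h
    using that(2,1,3)
  proof (induction r arbitrary: y h rule: inc_induct)
    case base
    then show ?case by (intro low[of h 0]) auto
  next
    case (step r)
    have rk: "r < k" using step.hyps qk by simp
    obtain u where u: "u \<in> U_group k" "\<And>s t. s < r \<or> t < r \<Longrightarrow> u s t = (if s = t then 1 else 0)"
      "\<And>t. r < t \<Longrightarrow> t < k \<Longrightarrow> (\<Sum>s\<in>{r..<k}. y r s * u s t) = 0"
      using householder[OF rk, of "y r"] by blast
    have u': "cmat_adjoint u \<in> U_group k" by (rule cmat_adjoint_U[OF u(1)])
    have h: "h = act u (act (cmat_adjoint u) h)"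
      using act_act[OF Uc[OF u(1)] Uc[OF u']] u(1) by (simp add: U_group_def act_one)
    have h': "act (cmat_adjoint u) h \<in> N" by (rule Nact[OF step.prems(1) u'])
    \<comment> \<open>Multiplication of \<open>y\<close> by \<open>u\<close> from the right is
      compensated by letting the inverse of \<open>u\<close> act on \<open>h\<close>.\<close>
    have "pev (pt y) h = pev (pt (\<lambda>a t. \<Sum>s<k. y a s * u s t)) (act (cmat_adjoint u) h)"
      by (subst h) (rule pev_act_pt[OF NH[OF h'] qk Uc[OF u(1)]])
    also have "\<dots> = 0"
    proof (rule step.IH[OF h'])
      fix a t assume at: "a < Suc r" "a < t" "t < k"
      \<comment> \<open>Row \<open>r\<close> is cleared by the choice of \<open>u\<close>. The
        earlier rows are supported on the first \<open>r\<close> columns, where \<open>u\<close> is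
        the identity, and thus keep their zeros.\<close>
      show "(\<Sum>s<k. y a s * u s t) = 0"
      proof (cases "a = r")
        case True
        have "(\<Sum>s<k. y a s * u s t) = (\<Sum>s\<in>{r..<k}. y r s * u s t)"
          unfolding True using u(2)[of _ t] at True by (intro sum.mono_neutral_right) auto
        then show ?thesis using u(3)[of t] at True by simp
      next
        case False
        have "y a s * u s t = 0" if "s < k" for s
        proof (cases "a < s")
          case True
          then show ?thesis using step.prems(2)[of a s] at False that by simp
        next
          case False
          then show ?thesis using u(2)[of s t] at \<open>a \<noteq> r\<close> by simp
        qed
        then show ?thesis by (intro sum.neutral) auto
      qed
    qed
    finally show ?case .
  qed
  have "f \<in> N" using f van by (simp add: N_def)
  have "pev x f = 0" for x
  proof -
    have "pev x f = pev (pt (\<lambda>a t. x (0, a, t))) f" by (rule pev_pt_cong[OF f]) simp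
    also have "\<dots> = 0" by (rule red[OF \<open>f \<in> N\<close>, of 0]) auto
    finally show ?thesis .
  qed
  then show ?thesis by (rule poly_eq_0I)
qed

subsection \<open>Intertwining maps are multiples of isometries\<close>

lemma finite_hw_keys: "finite {\<alpha>. keys \<alpha> \<subseteq> tvars [m] k \<and> deg \<alpha> = tdeg [m]}"
  and hw_keys: "f \<in> hw_space 0 m k \<Longrightarrow> keys f \<subseteq> {\<alpha>. keys \<alpha> \<subseteq> tvars [m] k \<and> deg \<alpha> = tdeg [m]}"
  using finite_tensor_keys[of "[m]" k] tensor_keys[of f "[m]" k] by (auto simp: tensor_single)

lemma hw_riesz:
  assumes "\<And>f g. f \<in> hw_space 0 m k \<Longrightarrow> g \<in> hw_space 0 m k \<Longrightarrow> L (f + g) = L f + L g"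
    "\<And>c f. f \<in> hw_space 0 m k \<Longrightarrow> L (pscale c f) = c * L f"
  shows "\<exists>\<phi>\<in>hw_space 0 m k. \<forall>f\<in>hw_space 0 m k. L f = pinner f \<phi>"
  using finite_hw_keys hw_subspace hw_keys assms by (rule functional_representation)

lemma pinner_act_shift:
  assumes "u \<in> U_group k"
  shows "pinner f (act u h) = pinner (act (cmat_adjoint u) f) h"
  using pinner_act_adjoint[of "cmat_adjoint u" k f h] assms
  by (auto simp: U_group_def cmat_adjoint_carrier) (simp add: cmat_adjoint_def)

text \<open>A character of the functional represented by \<open>\<psi>\<close> passes to
  \<open>\<psi>\<close>: the torus crosses the inner product with \<open>z\<close> conjugated, and
  antilinearity in the second argument undoes the conjugation.\<close>

lemma hw_weight_vector:
  assumes \<psi>: "\<psi> \<in> hw_space 0 m k" and l: "l < k"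
    and w: "\<And>z f. cmod z = 1 \<Longrightarrow> f \<in> hw_space 0 m k \<Longrightarrow> pinner (act (tor l z) f) \<psi> = z ^ e * pinner f \<psi>"
    and z: "cmod z = 1"
  shows "act (tor l z) \<psi> = pscale (z ^ e) \<psi>"
proof -
  let ?d = "act (tor l z) \<psi> - pscale (z ^ e) \<psi>"
  have "?d \<in> hw_space 0 m k"
    by (intro pscale.subspace_diff[OF hw_subspace] hw_act \<psi> tor_carrier l pscale.subspace_scale[OF hw_subspace])
  moreover have "pinner f ?d = 0" if f: "f \<in> hw_space 0 m k" for f
  proof -
    have "pinner f (act (tor l z) \<psi>) = pinner (act (tor l (cnj z)) f) \<psi>"
      using pinner_act_shift[OF tor_U[OF l z]] by (simp add: tor_adjoint)
    also have "\<dots> = cnj z ^ e * pinner f \<psi>" using w[of "cnj z" f] f z by simp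
    finally show ?thesis by (simp add: pinner_diff_right pinner_scale_right)
  qed
  ultimately have "pinner ?d ?d = 0" by blast
  then show ?thesis using pnsq_eq_0_iff[of ?d] by (simp add: pnsq_def)
qed

text \<open>The vector \<open>v\<close> represents evaluation at the first rows of the identity matrix, and \<open>\<phi>\<close>
  represents \<open>f \<mapsto> \<langle>T f, T v\<rangle>\<close>. Both have the highest weight, whence \<open>\<phi>\<close> is a multiple of \<open>v\<close>, and
  \<open>v\<close> is cyclic.\<close>

lemma intertwiner_scalar:
  assumes qk: "length m \<le> k"
    and add: "\<And>f g. f \<in> hw_space 0 m k \<Longrightarrow> g \<in> hw_space 0 m k \<Longrightarrow> T (f + g) = T f + T g"
    and scale: "\<And>c f. f \<in> hw_space 0 m k \<Longrightarrow> T (pscale c f) = pscale c (T f)"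
    and act: "\<And>u f. u \<in> U_group k \<Longrightarrow> f \<in> hw_space 0 m k \<Longrightarrow> T (act u f) = act u (T f)"
  shows "\<exists>c. \<forall>f\<in>hw_space 0 m k. pnsq (T f) = c * pnsq f"
proof -
  let ?V = "hw_space 0 m k" and ?q = "length m"
  define e where "e l = (if l < ?q then m ! l else 0)" for l
  note sub = hw_subspace[of 0 m k]
  have Uc: "u \<in> cmat_carrier k" if "u \<in> U_group k" for u using that by (simp add: U_group_def)
  obtain v where v: "v \<in> ?V" "\<And>f. f \<in> ?V \<Longrightarrow> pev (pt cmat_one) f = pinner f v"
    using hw_riesz[of m k "pev (pt cmat_one)"] by (auto simp: pev_add pev_pscale)
  obtain \<phi> where \<phi>: "\<phi> \<in> ?V" "\<And>f. f \<in> ?V \<Longrightarrow> pinner (T f) (T v) = pinner f \<phi>"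
    using hw_riesz[of m k "\<lambda>f. pinner (T f) (T v)"]
    by (auto simp: add scale pinner_add_left pinner_scale_left)
  have torT: "tor l z \<in> U_group k" if "l < k" "cmod z = 1" for l z using tor_U that .
  have vw: "act (tor l z) v = pscale (z ^ e l) v" if l: "l < k" and z: "cmod z = 1" for l z
  proof (rule hw_weight_vector[OF v(1) l _ z])
    fix y f assume y: "cmod y = 1" and f: "f \<in> ?V"
    have "pinner (act (tor l y) f) v = pev (pt (tor l y)) f"
      using v(2)[OF hw_act[OF f Uc[OF torT[OF l y]]]] pev_act_one[OF f qk Uc[OF torT[OF l y]]] by simp
    also have "\<dots> = y ^ e l * pev (pt cmat_one) f"
    proof (cases "l < ?q")
      case True
      have y0: "y \<noteq> 0" using y by auto
      let ?d = "\<lambda>i j. if i = j then (if i < ?q then (if i = l then y else 1) else 1) else 0"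
      have td: "?d = tor l y" using True by (auto simp: tor_def fun_eq_iff)
      have "pev (pt (cmat_mult ?d cmat_one)) f = (\<Prod>i<?q. ?d i i ^ (m ! i)) * pev (pt cmat_one) f"
        by (rule pev_row[OF f row_diag_GL]) (use y0 in auto)
      also have "(\<Prod>i<?q. ?d i i ^ (m ! i)) = (\<Prod>i<?q. if i = l then y ^ (m ! l) else 1)"
        by (intro prod.cong) auto
      also have "\<dots> = y ^ e l" using True by (simp add: e_def prod.delta)
      finally show ?thesis
        unfolding td cmat_mult_one(2)[OF tor_carrier[OF l]] .
    next
      case False
      then show ?thesis
        by (simp add: e_def) (rule pev_pt_cong[OF f], auto simp: pt_def tor_def cmat_one_def)
    qed
    finally show "pinner (act (tor l y) f) v = y ^ e l * pinner f v" by (simp add: v(2)[OF f])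
  qed
  have \<phi>w: "act (tor l z) \<phi> = pscale (z ^ e l) \<phi>" if l: "l < k" and z: "cmod z = 1" for l z
  proof (rule hw_weight_vector[OF \<phi>(1) l _ z])
    fix y f assume y: "cmod y = 1" and f: "f \<in> ?V"
    have cy: "cmod (cnj y) = 1" using y by simp
    have "pinner (act (tor l y) f) \<phi> = pinner (act (tor l y) (T f)) (T v)"
      using \<phi>(2)[OF hw_act[OF f Uc[OF torT[OF l y]]]] by (simp add: act f torT l y)
    also have "\<dots> = pinner (T f) (T (act (tor l (cnj y)) v))"
      by (simp add: pinner_act_adjoint[OF tor_carrier[OF l]] tor_adjoint act[OF torT[OF l cy] v(1)])
    also have "\<dots> = y ^ e l * pinner (T f) (T v)"
      by (simp add: vw[OF l cy] scale v(1) pinner_scale_right)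
    finally show "pinner (act (tor l y) f) \<phi> = y ^ e l * pinner f \<phi>" by (simp add: \<phi>(2)[OF f])
  qed
  have ptu: "pev (pt u) f = pinner (act u f) v" if "f \<in> ?V" "u \<in> U_group k" for u f
    using pev_act_one[OF that(1) qk Uc[OF that(2)]] v(2)[OF hw_act[OF that(1) Uc[OF that(2)]]] by simp
  show ?thesis
  proof (cases "v = 0")
    case True
    \<comment> \<open>If evaluation at the identity vanishes on the whole module, so does evaluation
      at every unitary matrix, and the module is 0 by cyclicity.\<close>
    then have "f = 0" if "f \<in> ?V" for f
      using hw_cyclic[OF that qk] ptu[OF that] by simp
    moreover have "T 0 = 0" using scale[OF pscale.subspace_0[OF sub], of 0] by simp
    ultimately show ?thesis by (metis mult_zero_right pnsq_0)
  next
    case False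
    then have v0: "pev (pt cmat_one) v \<noteq> 0"
      using v pnsq_eq_0_iff[of v] by (simp add: pinner_self)
    \<comment> \<open>The choice for which \<open>\<phi> - pscale c v\<close> vanishes at the
      identity; as a vector of the highest weight it is then 0.\<close>
    define c where "c = pev (pt cmat_one) \<phi> / pev (pt cmat_one) v"
    have "\<phi> - pscale c v = 0"
    proof (rule hw_weight_unique[OF _ qk])
      show "\<phi> - pscale c v \<in> ?V"
        by (intro pscale.subspace_diff[OF sub] pscale.subspace_scale[OF sub] v \<phi>)
      show "pev (pt cmat_one) (\<phi> - pscale c v) = 0"
        using v0 by (simp add: pev_diff pev_pscale c_def)
      fix \<alpha> l assume "\<alpha> \<in> keys (\<phi> - pscale c v)" "l < k"
      then show "cwt l \<alpha> = (if l < ?q then m ! l else 0)"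
        unfolding e_def[symmetric]
        by (intro weight_of_act_tor)
          (simp_all add: act_diff act_pscale vw \<phi>w pscale.scale_right_diff_distrib pscale.scale_left_commute)
    qed
    then have \<phi>v: "\<phi> = pscale c v" by simp
    have "pnsq (T f) = Re (cnj c) * pnsq f" if f: "f \<in> ?V" for f
    proof -
      \<comment> \<open>The vector \<open>\<psi>\<close> represents the defect of the claim as a
        functional of \<open>h\<close>. It turns out to be orthogonal to the orbit of
        \<open>v\<close>, so cyclicity makes it 0.\<close>
      obtain \<psi> where \<psi>: "\<psi> \<in> ?V" "\<And>h. h \<in> ?V \<Longrightarrow> pinner (T h) (T f) - c * pinner h f = pinner h \<psi>"
        using hw_riesz[of m k "\<lambda>h. pinner (T h) (T f) - c * pinner h f"]
        by (auto simp: add scale pinner_add_left pinner_scale_left algebra_simps)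
      have "\<psi> = 0"
      proof (rule hw_cyclic[OF \<psi>(1) qk])
        fix u assume u: "u \<in> U_group k"
        let ?u = "cmat_adjoint u"
        have u': "?u \<in> U_group k" using cmat_adjoint_U[OF u] .
        have fu: "act u f \<in> ?V" by (intro hw_act f Uc u)
        have "pinner (T (act ?u v)) (T f) = cnj (pinner (T (act u f)) (T v))"
          using pinner_act_shift[OF u', of "T f" "T v"] pinner_commute[of "act ?u (T v)" "T f"]
          by (simp add: act u u' v(1) f) (simp add: cmat_adjoint_def)
        also have "\<dots> = c * cnj (pinner (act u f) v)"
          by (simp add: \<phi>(2)[OF fu] \<phi>v pinner_scale_right)
        also have "\<dots> = c * pinner (act ?u v) f"
          using pinner_act_shift[OF u', of f v] pinner_commute[of "act ?u v" f]
          by simp (simp add: cmat_adjoint_def)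
        finally have "pinner (act ?u v) \<psi> = 0"
          using \<psi>(2)[OF hw_act[OF v(1) Uc[OF u']]] by simp
        then have "pinner (act u \<psi>) v = 0"
          using pinner_act_shift[OF u', of \<psi> v] pinner_commute[of "act ?u v" \<psi>]
          by simp (simp add: cmat_adjoint_def)
        then show "pev (pt u) \<psi> = 0" using ptu[OF \<psi>(1) u] by simp
      qed
      then have "of_real (pnsq (T f)) = c * of_real (pnsq f)"
        using \<psi>(2)[OF f] by (simp add: pinner_self)
      from arg_cong[OF this, of Re] show ?thesis by simp
    qed
    then show ?thesis by blast
  qed
qed

subsection \<open>Exchanging two blocks\<close>

text \<open>As the source of intertwining maps the module of signature \<open>m\<close> lives in block 0, whereas its
  contragredient lives in block \<open>r\<close>.\<close>

definition swv :: "nat \<Rightarrow> var \<Rightarrow> var" where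
  "swv r v = (if fst v = 0 then r else if fst v = r then 0 else fst v, snd v)"

definition swp :: "nat \<Rightarrow> cpoly \<Rightarrow> cpoly" where
  "swp r = lsubst (\<lambda>v u. if u = swv r v then 1 else 0)"

lemma swv_swv [simp]: "swv r (swv r v) = v"
  by (cases v) (auto simp: swv_def)

lemma pev_swp: "pev x (swp r f) = pev (\<lambda>v. x (swv r v)) f"
proof -
  have "vapply (\<lambda>v u. if u = swv r v then 1 else 0) x v = x (swv r v)" for v
    by (subst vapply_superset[of "{swv r v}"]) auto
  then have "vapply (\<lambda>v u. if u = swv r v then 1 else 0) x = (\<lambda>v. x (swv r v))" by (rule ext)
  then show ?thesis by (simp add: swp_def pev_lsubst)
qed

lemma swp_swp [simp]: "swp r (swp r f) = f"
  by (rule poly_ext) (simp add: pev_swp)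

lemma bil_swp: "bil (swp r f) h = bil f (swp r h)"
proof -
  have s: "u = swv r v \<longleftrightarrow> v = swv r u" for u v by (metis swv_swv)
  have "lfin (\<lambda>v u. if u = swv r v then 1 else 0)"
    unfolding lfin_def by (simp) (simp add: s)
  then have "bil (swp r f) h = bil f (lsubst (\<lambda>u v. if u = swv r v then 1 else 0) h)"
    unfolding swp_def by (rule bil_lsubst)
  also have "(\<lambda>u v. if u = swv r v then 1 else 0) = (\<lambda>v u. if u = swv r v then 1 else (0::complex))"
    by (intro ext) (simp add: s)
  finally show ?thesis by (simp add: swp_def)
qed

lemma swp_add: "swp r (f + g) = swp r f + swp r g"
  and swp_pscale: "swp r (pscale c f) = pscale c (swp r f)"
  and swp_sum: "swp r (\<Sum>i\<in>I. F i) = (\<Sum>i\<in>I. swp r (F i))"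
  by (simp_all add: swp_def lsubst_add lsubst_pscale lsubst_sum)

lemma act_swp: "act g (swp r f) = swp r (act g f)"
proof (rule poly_ext)
  fix x
  have "(\<lambda>v. vapply (col_mat (\<lambda>_. g)) x (swv r v)) = vapply (col_mat (\<lambda>_. g)) (\<lambda>v. x (swv r v))"
    by (rule ext) (simp add: swv_def vapply_col split_paired_all)
  then show "pev x (act g (swp r f)) = pev x (swp r (act g f))"
    by (simp add: act_eq pev_lsubst pev_swp)
qed

lemma row_swp: "row_subst g (swp r f) = swp r (row_subst g f)"
proof (rule poly_ext)
  fix x
  have "(\<lambda>v. vapply (row_mat g) x (swv r v)) = vapply (row_mat g) (\<lambda>v. x (swv r v))"
    by (rule ext) (simp add: swv_def vapply_row split_paired_all)
  then show "pev x (row_subst g (swp r f)) = pev x (swp r (row_subst g f))"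
    by (simp add: row_subst_eq pev_lsubst pev_swp)
qed

lemma swp_invars: "f \<in> invars X \<Longrightarrow> swv r ` X \<subseteq> Y \<Longrightarrow> swp r f \<in> invars Y"
  unfolding swp_def by (erule invars_lsubst) (auto split: if_splits)

text \<open>The condition on \<open>b\<close> and \<open>b'\<close> covers both directions of the
  exchange, as well as \<open>r = 0\<close>, where both blocks coincide.\<close>

lemma swp_hw:
  assumes "f \<in> hw_space b m k" "{b, b'} = {0, r}"
  shows "swp r f \<in> hw_space b' m k"
proof -
  have "swp r f \<in> polys b' (length m) k"
    unfolding polys_invars
    by (rule swp_invars[OF hw_spaceD(1)[OF assms(1), unfolded polys_invars]])
      (use assms(2) in \<open>auto simp: swv_def doubleton_eq_iff\<close>)
  moreover have "swp r (Const c * f) = Const c * swp r f" for c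
    using swp_pscale by (simp add: pscale_def)
  ultimately show ?thesis
    using assms(1) by (auto simp: hw_space_def row_swp)
qed

subsection \<open>Contraction with the last block\<close>

text \<open>A monomial splits into this factor, which collects block \<open>r\<close>, and the
  factor \<open>zm r \<alpha>\<close> from the other blocks.\<close>

definition wm :: "nat \<Rightarrow> mono \<Rightarrow> cpoly" where
  "wm r \<alpha> = (\<Prod>v\<in>{v\<in>keys \<alpha>. fst v = r}. Var v ^ coef \<alpha> v)"

definition zm :: "nat \<Rightarrow> mono \<Rightarrow> cpoly" where
  "zm r \<alpha> = (\<Prod>v\<in>{v\<in>keys \<alpha>. fst v \<noteq> r}. Var v ^ coef \<alpha> v)"

text \<open>The pairing in the variables of block \<open>r\<close> only, with polynomials in the
  other variables as scalars: the contraction of the last tensor factor against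
  \<open>f\<close>.\<close>

definition ctr :: "nat \<Rightarrow> cpoly \<Rightarrow> cpoly \<Rightarrow> cpoly" where
  "ctr r f s = (\<Sum>\<alpha>\<in>keys s. pscale (coef s \<alpha> * bil f (wm r \<alpha>)) (zm r \<alpha>))"

definition peval :: "nat \<Rightarrow> (var \<Rightarrow> complex) \<Rightarrow> cpoly \<Rightarrow> cpoly" where
  "peval r x = psubst (\<lambda>v. if fst v = r then Var v else Const (x v))"

lemma pev_peval: "pev y (peval r x s) = pev (\<lambda>v. if fst v = r then y v else x v) s"
  by (simp add: peval_def pev_psubst if_distrib[of "pev y"] cong: if_cong)

lemma Const_power: "Const (c ^ n) = Const c ^ n"
  by (induction n) (simp_all add: Const_simps)

lemma Const_prod: "Const (\<Prod>i\<in>I. c i) = (\<Prod>i\<in>I. Const (c i))"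
  by (induction I rule: infinite_finite_induct) (simp_all add: Const_simps)

text \<open>The variables outside block \<open>r\<close> may be evaluated before or after
  contracting. This describes \<open>ctr\<close> by the pairing itself, from which linearity in both
  arguments follows.\<close>

lemma pev_ctr: "pev x (ctr r f s) = bil f (peval r x s)"
proof -
  have "(\<Prod>v\<in>keys \<alpha>. (if fst v = r then Var v else Const (x v)) ^ coef \<alpha> v) =
      pscale (pev x (zm r \<alpha>)) (wm r \<alpha>)" for \<alpha> :: mono
  proof -
    have "(\<Prod>v\<in>keys \<alpha>. (if fst v = r then Var v else Const (x v)) ^ coef \<alpha> v) =
        (\<Prod>v\<in>keys \<alpha>. if fst v = r then Var v ^ coef \<alpha> v else Const (x v) ^ coef \<alpha> v)"
      by (intro prod.cong) auto
    also have "\<dots> = (\<Prod>v\<in>keys \<alpha> \<inter> {v. fst v = r}. Var v ^ coef \<alpha> v) *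
        (\<Prod>v\<in>keys \<alpha> \<inter> - {v. fst v = r}. Const (x v) ^ coef \<alpha> v)"
      by (rule prod.If_cases) simp
    also have "keys \<alpha> \<inter> {v. fst v = r} = {v\<in>keys \<alpha>. fst v = r}" by blast
    also have "keys \<alpha> \<inter> - {v. fst v = r} = {v\<in>keys \<alpha>. fst v \<noteq> r}" by blast
    finally show ?thesis
      by (simp add: pscale_def wm_def zm_def pev_prod pev_power Const_prod Const_power mult.commute)
  qed
  then have "peval r x s = (\<Sum>\<alpha>\<in>keys s. pscale (coef s \<alpha> * pev x (zm r \<alpha>)) (wm r \<alpha>))"
    by (simp add: peval_def psubst_def pscale_def Const_simps mult.assoc)
  then show ?thesis
    by (simp add: ctr_def pev_sum pev_pscale bil_sum_right bil_scale_right mult_ac)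
qed

lemma peval_add: "peval r x (s + t) = peval r x s + peval r x t"
  and peval_pscale: "peval r x (pscale c s) = pscale c (peval r x s)"
  by (rule poly_ext, simp add: pev_peval pev_add pev_pscale)+

lemma ctr_add_right: "ctr r f (s + t) = ctr r f s + ctr r f t"
  and ctr_scale_right: "ctr r f (pscale c s) = pscale c (ctr r f s)"
  and ctr_add_left: "ctr r (f + g) s = ctr r f s + ctr r g s"
  and ctr_scale_left: "ctr r (pscale c f) s = pscale c (ctr r f s)"
  by (rule poly_ext, simp add: pev_ctr peval_add peval_pscale pev_add pev_pscale bil_add_right
      bil_scale_right bil_add_left bil_scale_left)+

lemma ctr_0 [simp]: "ctr r f 0 = 0"
  by (simp add: ctr_def)

lemma ctr_sum_right: "ctr r f (\<Sum>i\<in>I. F i) = (\<Sum>i\<in>I. ctr r f (F i))"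
  by (induction I rule: infinite_finite_induct) (simp_all add: ctr_add_right)

lemma ctr_mult:
  assumes "F \<in> invars {v. fst v \<noteq> r}" "h \<in> invars {v. fst v = r}"
  shows "ctr r f (F * h) = pscale (bil f h) F"
proof (rule poly_ext)
  fix x
  have "peval r x (F * h) = pscale (pev x F) h"
  proof (rule poly_ext)
    fix y
    have "pev (\<lambda>v. if fst v = r then y v else x v) F = pev x F"
      by (rule pev_cong_invars[OF assms(1)]) simp
    moreover have "pev (\<lambda>v. if fst v = r then y v else x v) h = pev y h"
      by (rule pev_cong_invars[OF assms(2)]) simp
    ultimately show "pev y (peval r x (F * h)) = pev y (pscale (pev x F) h)"
      by (simp add: pev_peval pev_mult pev_pscale)
  qed
  then show "pev x (ctr r f (F * h)) = pev x (pscale (bil f h) F)"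
    by (simp add: pev_ctr bil_scale_right pev_pscale)
qed

lemma tensor_blocks: "F \<in> tensor_space ms k \<Longrightarrow> F \<in> invars {v. fst v \<noteq> length ms}"
  by (drule tensor_invars, erule subsetD[OF invars_mono, rotated]) (auto simp: tvars_def)

lemma hw_block: "h \<in> hw_space r m k \<Longrightarrow> h \<in> invars {v. fst v = r}"
  by (drule hw_spaceD(1), unfold polys_invars, erule subsetD[OF invars_mono, rotated]) auto

lemma hw_columns: "h \<in> hw_space r m k \<Longrightarrow> h \<in> invars {v. snd (snd v) < k}"
  by (drule hw_spaceD(1), unfold polys_invars, erule subsetD[OF invars_mono, rotated]) auto

section \<open>Augmented tensor products and contraction\<close>

lemma aug_subspace: "pscale.subspace (aug_tensor_space ms m k)"
  by (simp add: aug_tensor_space_def)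

lemma aug_induct [consumes 1, case_names mult 0 add scale]:
  assumes "s \<in> aug_tensor_space ms m k"
    and "\<And>F h. F \<in> tensor_space ms k \<Longrightarrow> h \<in> hw_space (length ms) m k \<Longrightarrow> P (F * h)"
    and "P 0" "\<And>f g. P f \<Longrightarrow> P g \<Longrightarrow> P (f + g)" "\<And>c f. P f \<Longrightarrow> P (pscale c f)"
  shows "P s"
proof -
  have "pscale.subspace (Collect P)" using assms(3-5) by (auto simp: pscale.subspace_def)
  then have "pscale.span {(\<Prod>i<length ms. f i) * h | f h.
      (\<forall>i<length ms. f i \<in> hw_space i (ms ! i) k) \<and> h \<in> hw_space (length ms) m k} \<subseteq> Collect P"
    by (rule pscale.span_minimal[rotated]) (use assms(2) tensor_prod in auto)
  then show ?thesis using assms(1) by (auto simp: aug_tensor_space_def)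
qed

lemma aug_mult:
  assumes "F \<in> tensor_space ms k" "h \<in> hw_space (length ms) m k"
  shows "F * h \<in> aug_tensor_space ms m k"
  using assms(1)
proof (induction rule: tensor_induct)
  case (prod F)
  then show ?case unfolding aug_tensor_space_def by (intro pscale.span_base) (use assms(2) in blast)
next
  case (scale c f)
  then show ?case using pscale.subspace_scale[OF aug_subspace, of _ ms m k c]
    by (simp add: pscale_def mult.assoc)
qed (simp_all add: distrib_right pscale.subspace_0[OF aug_subspace] pscale.subspace_add[OF aug_subspace])

lemma aug_col:
  assumes "s \<in> aug_tensor_space ms m k" and \<gamma>: "\<And>i s t. t < k \<Longrightarrow> \<gamma> i s t \<noteq> 0 \<Longrightarrow> s < j"
  shows "col_subst \<gamma> s \<in> aug_tensor_space ms m j"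
  using assms(1)
proof (induction rule: aug_induct)
  case (mult F h)
  then show ?case
    unfolding col_subst_mult by (intro aug_mult tensor_col hw_col) (use \<gamma> in auto)
qed (simp_all add: col_subst_0 col_subst_add col_subst_pscale pscale.subspace_0[OF aug_subspace]
    pscale.subspace_add[OF aug_subspace] pscale.subspace_scale[OF aug_subspace])

lemma aug_trunc: "s \<in> aug_tensor_space ms m k \<Longrightarrow> trunc j s \<in> aug_tensor_space ms m j"
  unfolding trunc_eq by (erule aug_col) (auto simp: proj_def split: if_splits)

lemma aug_act:
  assumes "s \<in> aug_tensor_space ms m k" "g \<in> GL_group k"
  shows "act_aug r g s \<in> aug_tensor_space ms m k"
  unfolding act_aug_def
  by (rule aug_col[OF assms(1)])
    (use carrier_nonzero[OF GL_carrier[OF assms(2)]] carrier_nonzero[OF cmat_dual_carrier[OF assms(2)]] in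
      \<open>auto split: if_splits\<close>)

lemma act_aug_mult:
  assumes "F \<in> invars {v. fst v \<noteq> r}" "h \<in> invars {v. fst v = r}"
  shows "act_aug r g (F * h) = act g F * act (cmat_dual g) h"
proof -
  have "act_aug r g F = act g F"
    unfolding act_aug_def act_def col_subst_eq
    by (rule poly_ext, unfold pev_lsubst, rule pev_cong_invars[OF assms(1)])
      (auto simp: vapply_col)
  moreover have "act_aug r g h = act (cmat_dual g) h"
    unfolding act_aug_def act_def col_subst_eq
    by (rule poly_ext, unfold pev_lsubst, rule pev_cong_invars[OF assms(2)])
      (auto simp: vapply_col)
  moreover have "act_aug r g (F * h) = act_aug r g F * act_aug r g h"
    by (simp add: act_aug_def col_subst_mult)
  ultimately show ?thesis by simp
qed

lemma act_aug_add: "act_aug r g (s + t) = act_aug r g s + act_aug r g t"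
  and act_aug_pscale: "act_aug r g (pscale c s) = pscale c (act_aug r g s)"
  and act_aug_0: "act_aug r g 0 = 0"
  by (simp_all add: act_aug_def col_subst_add col_subst_pscale col_subst_0)

lemma trunc_add: "trunc j (s + t) = trunc j s + trunc j t"
  and trunc_pscale: "trunc j (pscale c s) = pscale c (trunc j s)"
  and trunc_mult: "trunc j (s * t) = trunc j s * trunc j t"
  and trunc_0 [simp]: "trunc j 0 = 0"
  by (simp_all add: trunc_eq col_subst_add col_subst_pscale col_subst_mult col_subst_0)

text \<open>Source vectors live in block 0 and have to be moved to block \<open>r\<close> before
  they can be contracted.\<close>

definition ct :: "nat \<Rightarrow> cpoly \<Rightarrow> cpoly \<Rightarrow> cpoly" where
  "ct r f = ctr r (swp r f)"

lemma ct_mult: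
  assumes "F \<in> tensor_space ms k" "h \<in> hw_space (length ms) m k"
  shows "ct (length ms) f (F * h) = pscale (bil f (swp (length ms) h)) F"
  unfolding ct_def by (simp add: ctr_mult[OF tensor_blocks[OF assms(1)] hw_block[OF assms(2)]] bil_swp)

lemma ct_tensor:
  assumes "s \<in> aug_tensor_space ms m k"
  shows "ct (length ms) f s \<in> tensor_space ms k"
  using assms
proof (induction rule: aug_induct)
  case (mult F h)
  then show ?case by (simp add: ct_mult pscale.subspace_scale[OF tensor_subspace])
qed (simp_all add: ct_def ctr_add_right ctr_scale_right pscale.subspace_0[OF tensor_subspace]
    pscale.subspace_add[OF tensor_subspace] pscale.subspace_scale[OF tensor_subspace])

text \<open>On a product the actions of \<open>g\<close> and \<open>cmat_dual g\<close> cancel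
  inside the pairing, and only the action on the first factor remains.\<close>

lemma ct_act:
  assumes "s \<in> aug_tensor_space ms m k" "g \<in> GL_group k"
  shows "ct (length ms) (act g f) (act_aug (length ms) g s) = act g (ct (length ms) f s)"
  using assms(1)
proof (induction rule: aug_induct)
  case (mult F h)
  have "ct (length ms) (act g f) (act g F * act (cmat_dual g) h) =
      pscale (bil (act g f) (swp (length ms) (act (cmat_dual g) h))) (act g F)"
    by (rule ct_mult) (use mult assms(2) in \<open>auto intro: tensor_act hw_act GL_carrier cmat_dual_carrier\<close>)
  also have "swp (length ms) (act (cmat_dual g) h) = act (cmat_dual g) (swp (length ms) h)"
    by (simp add: act_swp)
  also have "bil (act g f) \<dots> = bil f (swp (length ms) h)"
    by (rule bil_act_dual[OF assms(2)])
  finally show ?case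
    using mult by (simp add: act_aug_mult[OF tensor_blocks hw_block] ct_mult act_pscale)
qed (simp_all add: act_aug_add act_aug_pscale act_aug_0 ct_def ctr_add_right ctr_scale_right
    act_add act_pscale, simp add: act_eq)

text \<open>Truncation is self-adjoint for the pairing, and it fixes \<open>f\<close>, which
  involves only the first \<open>j\<close> columns.\<close>

lemma ct_trunc:
  assumes "s \<in> aug_tensor_space ms m k" "f \<in> hw_space 0 m j"
  shows "ct (length ms) f (trunc j s) = trunc j (ct (length ms) f s)"
  using assms(1)
proof (induction rule: aug_induct)
  case (mult F h)
  have sym: "(\<lambda>u v. col_mat (\<lambda>_. proj j) v u) = col_mat (\<lambda>_. proj j)"
    by (auto simp: fun_eq_iff col_mat_def proj_def)
  have th: "trunc j h \<in> hw_space (length ms) m j"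
    unfolding trunc_eq by (rule hw_col[OF mult(2)]) (auto simp: proj_def split: if_splits)
  have "bil (swp (length ms) f) (trunc j h) = bil (trunc j (swp (length ms) f)) h"
    unfolding trunc_eq col_subst_eq bil_lsubst[OF lfin_proj] sym ..
  also have "trunc j (swp (length ms) f) = swp (length ms) f"
    by (rule trunc_id[OF hw_columns[OF swp_hw[OF assms(2)]]]) simp
  finally show ?case
    using mult th by (simp add: trunc_mult ct_mult[OF tensor_trunc] ct_mult trunc_pscale bil_swp)
qed (simp_all add: trunc_add trunc_pscale ct_def ctr_add_right ctr_scale_right)

text \<open>Expand the last factor in the conjugates of the vectors in \<open>E\<close>; the
  coefficients are then values of the bilinear pairing and hence contractions. The formula shows
  that contractions determine \<open>s\<close>, and it suggests the inverse construction in
  \<open>\<Phi>_surj\<close>.\<close>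

lemma aug_reconstruct:
  assumes E: "finite E" "E \<subseteq> hw_space 0 m k" "\<And>f. f \<in> hw_space 0 m k \<Longrightarrow> f = (\<Sum>e\<in>E. pscale (pinner f e) e)"
    and s: "s \<in> aug_tensor_space ms m k"
  shows "s = (\<Sum>e\<in>E. ct (length ms) e s * swp (length ms) (pcnj e))"
  using s
proof (induction rule: aug_induct)
  case (mult F h)
  let ?r = "length ms"
  have h0: "pcnj (swp ?r h) \<in> hw_space 0 m k" by (intro hw_pcnj swp_hw[OF mult(2)]) auto
  have "swp ?r h = pcnj (\<Sum>e\<in>E. pscale (pinner (pcnj (swp ?r h)) e) e)"
    using arg_cong[OF E(3)[OF h0], of pcnj] by (simp only: pcnj_pcnj)
  also have "\<dots> = (\<Sum>e\<in>E. pscale (bil e (swp ?r h)) (pcnj e))"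
    unfolding pcnj_sum pcnj_pscale bil_def using pinner_commute by (intro sum.cong refl) metis
  finally have "swp ?r (swp ?r h) = swp ?r (\<Sum>e\<in>E. pscale (bil e (swp ?r h)) (pcnj e))" by (rule arg_cong)
  then have "h = (\<Sum>e\<in>E. pscale (bil e (swp ?r h)) (swp ?r (pcnj e)))"
    by (simp add: swp_sum swp_pscale)
  then have "F * h = F * (\<Sum>e\<in>E. pscale (bil e (swp ?r h)) (swp ?r (pcnj e)))" by (rule arg_cong)
  also have "\<dots> = (\<Sum>e\<in>E. ct ?r e (F * h) * swp ?r (pcnj e))"
    unfolding ct_mult[OF mult] by (simp add: sum_distrib_left pscale_def mult_ac)
  finally show ?case .
next
  case (add f g)
  then have "f + g = (\<Sum>e\<in>E. ct (length ms) e f * swp (length ms) (pcnj e)) +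
      (\<Sum>e\<in>E. ct (length ms) e g * swp (length ms) (pcnj e))" by (rule arg_cong2)
  also have "\<dots> = (\<Sum>e\<in>E. ct (length ms) e (f + g) * swp (length ms) (pcnj e))"
    by (simp add: ct_def ctr_add_right distrib_right sum.distrib)
  finally show ?case .
next
  case (scale c f)
  then have "pscale c f = pscale c (\<Sum>e\<in>E. ct (length ms) e f * swp (length ms) (pcnj e))" by (rule arg_cong)
  also have "\<dots> = (\<Sum>e\<in>E. ct (length ms) e (pscale c f) * swp (length ms) (pcnj e))"
    unfolding ct_def ctr_scale_right by (simp add: pscale_def sum_distrib_left mult_ac)
  finally show ?case .
qed (simp add: ct_def)

lemma hw_onb:
  "\<exists>E. finite E \<and> E \<subseteq> hw_space 0 m k \<and> (\<forall>f\<in>hw_space 0 m k. f = (\<Sum>e\<in>E. pscale (pinner f e) e))"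
proof -
  have "\<exists>E. finite E \<and> E \<subseteq> hw_space 0 m k \<and>
      (\<forall>e\<in>E. \<forall>e'\<in>E. pinner e e' = (if e = e' then 1 else 0)) \<and>
      (\<forall>f\<in>hw_space 0 m k. f = (\<Sum>e\<in>E. pscale (pinner f e) e))"
    using finite_hw_keys hw_subspace hw_keys by (rule onb_exists)
  then show ?thesis by (rule ex_forward) (elim conjE, intro conjI)
qed

lemma aug_eqI:
  assumes "s \<in> aug_tensor_space ms m k" "t \<in> aug_tensor_space ms m k"
    "\<And>f. f \<in> hw_space 0 m k \<Longrightarrow> ct (length ms) f s = ct (length ms) f t"
  shows "s = t"
proof -
  obtain E where E: "finite E" "E \<subseteq> hw_space 0 m k" "\<And>f. f \<in> hw_space 0 m k \<Longrightarrow> f = (\<Sum>e\<in>E. pscale (pinner f e) e)"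
    using hw_onb[of m k] by (elim exE conjE) (rule that, assumption+, erule bspec)
  have "s = (\<Sum>e\<in>E. ct (length ms) e s * swp (length ms) (pcnj e))" by (rule aug_reconstruct[OF E assms(1)])
  also have "\<dots> = (\<Sum>e\<in>E. ct (length ms) e t * swp (length ms) (pcnj e))"
    using E(2) assms(3) by (intro sum.cong) auto
  also have "\<dots> = t" by (rule aug_reconstruct[OF E assms(2), symmetric])
  finally show ?thesis .
qed

subsection \<open>The algebraic inductive limits\<close>

text \<open>By \<open>tensor_single\<close> both the source union and the target union are
  instances, and each argument about unions is given once.\<close>

definition tun :: "nat list list \<Rightarrow> nat \<Rightarrow> cpoly set" where
  "tun L n = (\<Union>k\<in>{n..}. tensor_space L k)"

lemma hw_union_tun: "hw_union ms m = tun [m] (stable_rank ms m)"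
  by (simp add: hw_union_def tun_def tensor_single)

lemma tensor_union_tun: "tensor_union ms m = tun ms (stable_rank ms m)"
  by (simp add: tensor_union_def tun_def)

text \<open>The extra bound \<open>l\<close> leaves room for the level of a group element.\<close>

lemma tun_common:
  assumes "f \<in> tun L n" "g \<in> tun L n"
  shows "\<exists>k\<ge>n. k \<ge> l \<and> f \<in> tensor_space L k \<and> g \<in> tensor_space L k"
proof -
  obtain k1 k2 where k: "n \<le> k1" "f \<in> tensor_space L k1" "n \<le> k2" "g \<in> tensor_space L k2"
    using assms by (auto simp: tun_def)
  let ?K = "max l (max k1 k2)"
  have "f \<in> tensor_space L ?K" by (rule subsetD[OF tensor_mono k(2)]) simp
  moreover have "g \<in> tensor_space L ?K" by (rule subsetD[OF tensor_mono k(4)]) simp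
  ultimately show ?thesis using k by (intro exI[of _ ?K]) auto
qed

lemma tun_I: "n \<le> k \<Longrightarrow> f \<in> tensor_space L k \<Longrightarrow> f \<in> tun L n"
  by (auto simp: tun_def)

lemma tun_subspace: "pscale.subspace (tun L n)"
  unfolding pscale.subspace_def
proof (intro conjI ballI allI)
  show "0 \<in> tun L n" by (rule tun_I[OF order_refl pscale.subspace_0[OF tensor_subspace]])
  fix f assume f: "f \<in> tun L n"
  show "pscale c f \<in> tun L n" for c
    using tun_common[OF f f, of 0] pscale.subspace_scale[OF tensor_subspace] tun_I by blast
  show "f + g \<in> tun L n" if "g \<in> tun L n" for g
    using tun_common[OF f that, of 0] pscale.subspace_add[OF tensor_subspace] tun_I by blast
qed

lemma tun_homog: "f \<in> tun L n \<Longrightarrow> homog (tdeg L) f"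
  by (auto simp: tun_def tensor_homog)

definition alg_hom ::
    "(nat \<Rightarrow> cmat set) \<Rightarrow> nat list list \<Rightarrow> nat list \<Rightarrow> (cpoly \<Rightarrow> cpoly) set" where
  "alg_hom G ms m = intertwiners (group_limit G) pscale (hw_union ms m) act pscale (tensor_union ms m) act"

text \<open>The inverse limit of the spaces of invariants. By \<open>hom_identity_iff\<close> it
  parametrizes the maps from the trivial module.\<close>

definition inv_seqs ::
    "(nat \<Rightarrow> cmat set) \<Rightarrow> nat list list \<Rightarrow> nat list \<Rightarrow> (nat \<Rightarrow> cpoly) set" where
  "inv_seqs G ms m = {s \<in> inverse_limit ms m.
    \<forall>k\<ge>stable_rank ms m. \<forall>g\<in>G k. act_aug (length ms) g (s k) = s k}"

text \<open>Both groups are treated together: each contains the unitary matrices and tori used to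
  detect vectors, and each consists of invertible matrices, for which the contragredient action is
  defined.\<close>

locale tower =
  fixes G :: "nat \<Rightarrow> cmat set" and ms :: "nat list list" and m :: "nat list"
  assumes G: "G = U_group \<or> G = GL_group"
begin

abbreviation "n \<equiv> stable_rank ms m"
abbreviation "r \<equiv> length ms"
abbreviation "V k \<equiv> hw_space 0 m k"
abbreviation "W k \<equiv> tensor_space ms k"
abbreviation "S k \<equiv> aug_tensor_space ms m k"

lemma G_GL: "g \<in> G k \<Longrightarrow> g \<in> GL_group k"
  using G U_subset_GL by blast

lemma U_G: "g \<in> U_group k \<Longrightarrow> g \<in> G k"
  using G U_subset_GL by blast

lemma G_mono: "k \<le> l \<Longrightarrow> g \<in> G k \<Longrightarrow> g \<in> G l"
  using G U_mono GL_mono by blast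

lemma G_carrier: "g \<in> G k \<Longrightarrow> g \<in> cmat_carrier k"
  using G_GL GL_carrier by blast

lemma limit_I: "g \<in> G k \<Longrightarrow> g \<in> group_limit G"
  by (auto simp: group_limit_def)

lemma rank_ge: "length m \<le> n"
  by (simp add: stable_rank_def)

lemma tun_act:
  assumes "f \<in> tun L l" "g \<in> group_limit G"
  shows "act g f \<in> tun L l"
proof -
  obtain i where i: "g \<in> G i" using assms(2) by (auto simp: group_limit_def)
  obtain k where k: "l \<le> k" "i \<le> k" "f \<in> tensor_space L k" using tun_common[OF assms(1,1)] by blast
  have "act g f \<in> tensor_space L k"
    using tensor_act[OF k(3)] G_carrier[OF G_mono[OF k(2) i]] by blast
  with k show ?thesis by (blast intro: tun_I)
qed

lemma V_union: "n \<le> k \<Longrightarrow> f \<in> V k \<Longrightarrow> f \<in> hw_union ms m"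
  by (auto simp: hw_union_def)

lemma V_mono: "j \<le> k \<Longrightarrow> f \<in> V j \<Longrightarrow> f \<in> V k"
  using hw_mono by blast

lemma hw_union_subspace: "pscale.subspace (hw_union ms m)"
  by (simp add: hw_union_tun tun_subspace)

lemma tensor_union_subspace: "pscale.subspace (tensor_union ms m)"
  by (simp add: tensor_union_tun tun_subspace)

lemma alg_homD:
  assumes "T \<in> alg_hom G ms m"
  shows "f \<in> hw_union ms m \<Longrightarrow> T f \<in> tensor_union ms m" "f \<notin> hw_union ms m \<Longrightarrow> T f = 0"
    "f \<in> hw_union ms m \<Longrightarrow> h \<in> hw_union ms m \<Longrightarrow> T (f + h) = T f + T h"
    "f \<in> hw_union ms m \<Longrightarrow> T (pscale c f) = pscale c (T f)"
    "f \<in> hw_union ms m \<Longrightarrow> g \<in> group_limit G \<Longrightarrow> T (act g f) = act g (T f)"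
  using assms by (auto simp: alg_hom_def intertwiners_def)

lemma alg_hom_level:
  assumes T: "T \<in> alg_hom G ms m" and k: "n \<le> k" and f: "f \<in> V k"
  shows "T f \<in> W k"
proof -
  obtain L where "T f \<in> W L" using alg_homD(1)[OF T V_union[OF k f]] by (auto simp: tensor_union_def)
  then show ?thesis
  proof (rule tensor_fixed)
    fix l z assume l: "k \<le> l" and z: "cmod z = 1"
    have "act (tor l z) f = f"
      using act_tor_outside[of f "[m]" k l z] f l by (simp add: tensor_single)
    then show "act (tor l z) (T f) = T f"
      using alg_homD(5)[OF T V_union[OF k f] limit_I[OF U_G[OF tor_U[OF lessI z]]]] by metis
  qed
qed

lemma alg_hom_bounded:
  assumes T: "T \<in> alg_hom G ms m"
  shows "\<exists>C\<ge>0. \<forall>f\<in>hw_union ms m. pnsq (T f) \<le> C * pnsq f"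
proof -
  have lev: "\<exists>c. \<forall>f\<in>V k. pnsq (T f) = c * pnsq f" if k: "n \<le> k" for k
  proof (rule intertwiner_scalar)
    show "length m \<le> k" using rank_ge k by simp
  next
    fix u f assume "u \<in> U_group k" "f \<in> V k"
    then show "T (act u f) = act u (T f)"
      using alg_homD(5)[OF T V_union[OF k] limit_I[OF U_G]] by blast
  qed (use alg_homD[OF T] V_union[OF k] in auto)
  have T0: "T 0 = 0"
    using alg_homD(4)[OF T pscale.subspace_0[OF hw_union_subspace], of 0] by simp
  show ?thesis
  proof (cases "\<exists>f0\<in>hw_union ms m. f0 \<noteq> 0")
    case True
    then obtain f0 k0 where f0: "n \<le> k0" "f0 \<in> V k0" "f0 \<noteq> 0" by (auto simp: hw_union_def)
    have p0: "pnsq f0 > 0" using f0(3) pnsq_nonneg[of f0] pnsq_eq_0_iff[of f0] by linarith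
    \<comment> \<open>A level that contains both \<open>f\<close> and \<open>f0\<close> shows that
      the factor is always the one read off from \<open>f0\<close>.\<close>
    have "pnsq (T f) = pnsq (T f0) / pnsq f0 * pnsq f" if fk: "n \<le> k" "f \<in> V k" for k f
    proof -
      obtain c where "\<forall>f\<in>V (max k k0). pnsq (T f) = c * pnsq f" using lev[of "max k k0"] fk by fastforce
      then have "pnsq (T f) = c * pnsq f" "pnsq (T f0) = c * pnsq f0"
        using V_mono[OF max.cobounded1 fk(2)] V_mono[OF max.cobounded2 f0(2)] by auto
      then show ?thesis using p0 by simp
    qed
    then show ?thesis
      using pnsq_nonneg by (intro exI[of _ "pnsq (T f0) / pnsq f0"]) (auto simp: hw_union_def)
  next
    case False
    then show ?thesis using T0 by (intro exI[of _ 0]) auto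
  qed
qed

subsection \<open>Invariant sequences and intertwining maps\<close>

lemma inv_seqsD:
  assumes "s \<in> inv_seqs G ms m"
  shows "n \<le> k \<Longrightarrow> s k \<in> S k" "n \<le> j \<Longrightarrow> j \<le> k \<Longrightarrow> trunc j (s k) = s j" "k < n \<Longrightarrow> s k = 0"
    "n \<le> k \<Longrightarrow> g \<in> G k \<Longrightarrow> act_aug r g (s k) = s k"
  using assms by (auto simp: inv_seqs_def inverse_limit_def)

text \<open>The tori of the columns from \<open>j\<close> on fix \<open>f\<close> and
  \<open>s k\<close>, hence their contraction, which thus lies in \<open>W j\<close> and is not
  changed by truncation. Moving the truncation onto \<open>s k\<close> then yields
  \<open>s j\<close>.\<close>

lemma ct_level:
  assumes s: "s \<in> inv_seqs G ms m" and j: "n \<le> j" "j \<le> k" and f: "f \<in> V j"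
  shows "ct r f (s k) = ct r f (s j)"
proof -
  have nk: "n \<le> k" using j by simp
  have Wk: "ct r f (s k) \<in> W k" by (rule ct_tensor[OF inv_seqsD(1)[OF s nk]])
  have "ct r f (s k) \<in> W j"
  proof (rule tensor_fixed[OF Wk])
    fix l z assume l: "j \<le> l" and z: "cmod z = 1"
    show "act (tor l z) (ct r f (s k)) = ct r f (s k)"
    proof (cases "l < k")
      case True
      have g: "tor l z \<in> G k" by (rule U_G[OF tor_U[OF True z]])
      have "act (tor l z) f = f"
        using act_tor_outside[of f "[m]" j l z] f l by (simp add: tensor_single)
      then show ?thesis
        using ct_act[OF inv_seqsD(1)[OF s nk] G_GL[OF g], of f] inv_seqsD(4)[OF s nk g] by simp
    qed (simp add: act_tor_outside[OF Wk])
  qed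
  then have "ct r f (s k) = trunc j (ct r f (s k))" by (simp add: tensor_trunc_id)
  also have "\<dots> = ct r f (trunc j (s k))" by (rule ct_trunc[OF inv_seqsD(1)[OF s nk] f, symmetric])
  finally show ?thesis by (simp add: inv_seqsD(2)[OF s j])
qed

text \<open>The map belonging to an invariant sequence. The least level is only a choice: by
  \<open>ct_level\<close> every level that contains \<open>f\<close> gives the same value.\<close>

definition \<Phi> :: "(nat \<Rightarrow> cpoly) \<Rightarrow> cpoly \<Rightarrow> cpoly" where
  "\<Phi> s f = (if f \<in> hw_union ms m then ct r f (s (LEAST k. n \<le> k \<and> f \<in> V k)) else 0)"

lemma \<Phi>_eq:
  assumes s: "s \<in> inv_seqs G ms m" and k: "n \<le> k" "f \<in> V k"
  shows "\<Phi> s f = ct r f (s k)"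
proof -
  let ?j = "LEAST k. n \<le> k \<and> f \<in> V k"
  have "n \<le> ?j \<and> f \<in> V ?j" by (rule LeastI[of _ k]) (use k in simp)
  moreover have "?j \<le> k" by (rule Least_le) (use k in simp)
  ultimately show ?thesis using ct_level[OF s, of ?j k f] V_union[OF k] by (simp add: \<Phi>_def)
qed

lemma \<Phi>_hom:
  assumes s: "s \<in> inv_seqs G ms m"
  shows "\<Phi> s \<in> alg_hom G ms m"
  unfolding alg_hom_def intertwiners_def mem_Collect_eq
proof (intro conjI ballI allI impI)
  fix f assume "f \<in> hw_union ms m"
  then obtain k where k: "n \<le> k" "f \<in> V k" by (auto simp: hw_union_def)
  show "\<Phi> s f \<in> tensor_union ms m"
    unfolding \<Phi>_eq[OF s k] using ct_tensor[OF inv_seqsD(1)[OF s k(1)]] k by (auto simp: tensor_union_def)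
  show "\<Phi> s (pscale c f) = pscale c (\<Phi> s f)" for c
    using k pscale.subspace_scale[OF hw_subspace k(2)]
    by (simp add: \<Phi>_eq[OF s k(1)] ct_def swp_pscale ctr_scale_left)
  fix h assume "h \<in> hw_union ms m"
  then obtain l where l: "n \<le> l" "h \<in> V l" by (auto simp: hw_union_def)
  let ?K = "max k l"
  have K: "n \<le> ?K" "f \<in> V ?K" "h \<in> V ?K"
    using k l V_mono[OF max.cobounded1 k(2)] V_mono[OF max.cobounded2 l(2)] by auto
  show "\<Phi> s (f + h) = \<Phi> s f + \<Phi> s h"
    using K pscale.subspace_add[OF hw_subspace K(2,3)]
    by (simp add: \<Phi>_eq[OF s K(1)] ct_def swp_add ctr_add_left)
next
  fix g f assume "g \<in> group_limit G" "f \<in> hw_union ms m"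
  then obtain k l where k: "n \<le> k" "f \<in> V k" and l: "g \<in> G l" by (auto simp: hw_union_def group_limit_def)
  let ?K = "max k l"
  have K: "n \<le> ?K" "f \<in> V ?K" and g: "g \<in> G ?K"
    using k V_mono[OF max.cobounded1 k(2)] G_mono[OF max.cobounded2 l] by auto
  have "act g f \<in> V ?K" by (rule hw_act[OF K(2) G_carrier[OF g]])
  then show "\<Phi> s (act g f) = act g (\<Phi> s f)"
    using ct_act[OF inv_seqsD(1)[OF s K(1)] G_GL[OF g], of f] inv_seqsD(4)[OF s K(1) g]
    by (simp add: \<Phi>_eq[OF s K(1)] K)
qed (simp add: \<Phi>_def)

lemma \<Phi>_inj: "inj_on \<Phi> (inv_seqs G ms m)"
proof (rule inj_onI, rule ext)
  fix s t k assume s: "s \<in> inv_seqs G ms m" and t: "t \<in> inv_seqs G ms m" and eq: "\<Phi> s = \<Phi> t"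
  show "s k = t k"
  proof (cases "k < n")
    case False
    then have k: "n \<le> k" by simp
    show ?thesis
      by (rule aug_eqI[OF inv_seqsD(1)[OF s k] inv_seqsD(1)[OF t k]])
        (metis eq \<Phi>_eq[OF s k] \<Phi>_eq[OF t k])
  qed (simp add: inv_seqsD(3)[OF s] inv_seqsD(3)[OF t])
qed

lemma \<Phi>_surj:
  assumes T: "T \<in> alg_hom G ms m"
  shows "\<exists>s\<in>inv_seqs G ms m. \<Phi> s = T"
proof -
  define E where "E k = (SOME E. finite E \<and> E \<subseteq> V k \<and> (\<forall>f\<in>V k. f = (\<Sum>e\<in>E. pscale (pinner f e) e)))" for k
  have E: "finite (E k) \<and> E k \<subseteq> V k \<and> (\<forall>f\<in>V k. f = (\<Sum>e\<in>E k. pscale (pinner f e) e))" for k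
    unfolding E_def by (rule someI_ex[OF hw_onb])
  \<comment> \<open>The canonical tensor of \<open>T\<close> at level \<open>k\<close>: each basis
    vector contributes its image times its dual vector, which is realized as the conjugate moved to
    block \<open>r\<close>.\<close>
  define s where "s k = (if k < n then 0 else \<Sum>e\<in>E k. T e * swp r (pcnj e))" for k
  have EV: "e \<in> V k" if "e \<in> E k" for e k using E that by blast
  have h: "swp r (pcnj e) \<in> hw_space r m k" if "e \<in> V k" for e k
    by (rule swp_hw[OF hw_pcnj[OF that]]) simp
  have sS: "s k \<in> S k" if k: "n \<le> k" for k
    using k by (auto simp: s_def intro!: pscale.subspace_sum[OF aug_subspace] aug_mult h
        alg_hom_level[OF T] dest: EV)
  have sT: "ct r f (s k) = T f" if k: "n \<le> k" and f: "f \<in> V k" for k f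
  proof -
    have T0: "T 0 = 0"
      using alg_homD(4)[OF T pscale.subspace_0[OF hw_union_subspace], of 0] by simp
    have Tsum: "T (\<Sum>e\<in>A. pscale (c e) e) = (\<Sum>e\<in>A. pscale (c e) (T e))" if "finite A" "A \<subseteq> V k" for A c
      using that
    proof (induction A rule: finite_induct)
      case (insert e A)
      have "(\<Sum>e\<in>A. pscale (c e) e) \<in> V k"
        by (intro pscale.subspace_sum[OF hw_subspace] pscale.subspace_scale[OF hw_subspace]) (use insert in auto)
      then show ?case
        using insert pscale.subspace_scale[OF hw_subspace, of e 0 m k "c e"]
        by (simp add: alg_homD[OF T] V_union[OF k])
    qed (simp add: T0)
    have "ct r f (s k) = (\<Sum>e\<in>E k. ct r f (T e * swp r (pcnj e)))"
      using k by (simp add: s_def ct_def ctr_sum_right)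
    also have "\<dots> = (\<Sum>e\<in>E k. pscale (pinner f e) (T e))"
      using EV k by (intro sum.cong refl) (simp add: ct_mult[OF alg_hom_level[OF T] h] pinner_bil)
    also have "\<dots> = T (\<Sum>e\<in>E k. pscale (pinner f e) e)"
      using E by (intro Tsum[symmetric]) auto
    also have "(\<Sum>e\<in>E k. pscale (pinner f e) e) = f"
      using E[of k] f by (elim conjE) (rule sym, erule bspec)
    finally show ?thesis .
  qed
  have "s \<in> inverse_limit ms m" unfolding inverse_limit_def mem_Collect_eq
  proof (intro conjI allI impI)
    fix j k assume jk: "n \<le> j \<and> j \<le> k"
    then have nk: "n \<le> k" by simp
    show "trunc j (s k) = s j"
    \<comment> \<open>Contraction with any \<open>f\<close> in \<open>V j\<close> gives
      \<open>T f\<close> on both sides.\<close>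
    proof (rule aug_eqI[OF aug_trunc[OF sS[OF nk]] sS])
      show "n \<le> j" using jk by simp
      fix f assume f: "f \<in> V j"
      have "ct r f (trunc j (s k)) = trunc j (T f)"
        using ct_trunc[OF sS[OF nk] f] sT[OF nk V_mono[OF _ f]] jk by simp
      also have "\<dots> = T f" using tensor_trunc_id[OF alg_hom_level[OF T _ f]] jk by simp
      finally show "ct r f (trunc j (s k)) = ct r f (s j)" using sT[OF _ f] jk by simp
    qed
  qed (use sS in \<open>auto simp: s_def\<close>)
  moreover have "act_aug r g (s k) = s k" if k: "n \<le> k" and g: "g \<in> G k" for g k
  proof (rule aug_eqI[OF aug_act[OF sS[OF k] G_GL[OF g]] sS[OF k]])
    fix f assume f: "f \<in> V k"
    let ?f = "act (cmat_inverse g) f"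
    note i = cmat_inverse_props[OF G_GL[OF g]]
    have f': "?f \<in> V k" by (rule hw_act[OF f i(1)])
    have ff: "act g ?f = f" by (simp add: act_act[OF G_carrier[OF g] i(1)] i act_one)
    \<comment> \<open>Writing \<open>f\<close> as the image of \<open>?f\<close> under
      \<open>g\<close> lets the equivariance of contraction be played against that of
      \<open>T\<close>.\<close>
    have "ct r f (act_aug r g (s k)) = act g (ct r ?f (s k))"
      using ct_act[OF sS[OF k] G_GL[OF g], of ?f] ff by simp
    also have "\<dots> = T (act g ?f)"
      using alg_homD(5)[OF T V_union[OF k f'] limit_I[OF g]] by (simp add: sT[OF k f'])
    finally show "ct r f (act_aug r g (s k)) = ct r f (s k)" by (simp add: ff sT[OF k f])
  qed
  ultimately have s: "s \<in> inv_seqs G ms m" by (simp add: inv_seqs_def)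
  moreover have "\<Phi> s = T"
  proof
    fix f
    show "\<Phi> s f = T f"
    proof (cases "f \<in> hw_union ms m")
      case True
      then obtain k where "n \<le> k" "f \<in> V k" by (auto simp: hw_union_def)
      then show ?thesis using \<Phi>_eq[OF s] sT by simp
    qed (simp add: \<Phi>_def alg_homD(2)[OF T])
  qed
  ultimately show ?thesis by blast
qed

lemma \<Phi>_image: "\<Phi> ` inv_seqs G ms m = alg_hom G ms m"
  using \<Phi>_hom \<Phi>_surj by blast

lemma \<Phi>_add: "\<Phi> (s + t) = \<Phi> s + \<Phi> t"
  by (auto simp: fun_eq_iff \<Phi>_def ct_def ctr_add_right)

lemma \<Phi>_scale: "\<Phi> (seq_scale c s) = map_scale pscale c (\<Phi> s)"
  by (auto simp: fun_eq_iff \<Phi>_def ct_def ctr_scale_right seq_scale_def map_scale_def)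

lemma inv_seqs_closed:
  "0 \<in> inv_seqs G ms m"
  "s \<in> inv_seqs G ms m \<Longrightarrow> t \<in> inv_seqs G ms m \<Longrightarrow> s + t \<in> inv_seqs G ms m"
  "s \<in> inv_seqs G ms m \<Longrightarrow> seq_scale c s \<in> inv_seqs G ms m"
  by (auto simp: inv_seqs_def inverse_limit_def seq_scale_def act_aug_0 act_aug_add act_aug_pscale
      trunc_add trunc_pscale pscale.subspace_0[OF aug_subspace] pscale.subspace_add[OF aug_subspace]
      pscale.subspace_scale[OF aug_subspace])

section \<open>Maps from the trivial module\<close>

lemma aug_trunc_id: "s \<in> S k \<Longrightarrow> trunc k s = s"
proof (induction rule: aug_induct)
  case (mult F h)
  then show ?case by (simp add: trunc_mult tensor_trunc_id trunc_id[OF hw_columns])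
qed (simp_all add: trunc_add trunc_pscale)

text \<open>For \<open>g\<close> in \<open>G k\<close> the level used in component \<open>k\<close>
  is \<open>k\<close> itself, so a fixed sequence is invariant level by level. Conversely, the
  components computed at a higher level are truncations of invariants in a compatible
  sequence.\<close>

lemma act_limit_fixed_iff:
  assumes s: "s \<in> inverse_limit ms m"
  shows "(\<forall>g\<in>group_limit G. act_limit G ms m g s = s) \<longleftrightarrow> s \<in> inv_seqs G ms m"
proof
  assume h: "\<forall>g\<in>group_limit G. act_limit G ms m g s = s"
  have "act_aug r g (s k) = s k" if k: "n \<le> k" and g: "g \<in> G k" for g k
  proof -
    have L: "(LEAST k'. k \<le> k' \<and> g \<in> G k') = k" by (rule Least_equality) (use g in auto)
    have "s k = act_limit G ms m g s k" using h limit_I[OF g] by simp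
    also have "\<dots> = trunc k (act_aug r g (s k))" using k by (simp add: act_limit_def L)
    also have "\<dots> = act_aug r g (s k)"
      using s k by (intro aug_trunc_id aug_act G_GL[OF g]) (auto simp: inverse_limit_def)
    finally show ?thesis by simp
  qed
  then show "s \<in> inv_seqs G ms m" using s by (simp add: inv_seqs_def)
next
  assume s: "s \<in> inv_seqs G ms m"
  show "\<forall>g\<in>group_limit G. act_limit G ms m g s = s"
  proof (intro ballI ext)
    fix g j assume "g \<in> group_limit G"
    then obtain l where l: "g \<in> G l" by (auto simp: group_limit_def)
    let ?L = "LEAST k. j \<le> k \<and> g \<in> G k"
    have L: "j \<le> ?L \<and> g \<in> G ?L"
      by (rule LeastI[of _ "max j l"]) (use G_mono[OF max.cobounded2 l] in auto)
    show "act_limit G ms m g s j = s j"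
    proof (cases "j < n")
      case False
      then have "n \<le> j" "n \<le> ?L" using L by auto
      then show ?thesis
        using L inv_seqsD(4)[OF s, of ?L g] inv_seqsD(2)[OF s, of j ?L] by (simp add: act_limit_def)
    qed (simp add: act_limit_def inv_seqsD(3)[OF s])
  qed
qed

text \<open>A linear map from the scalars is determined by its value at 1, which has to be
  invariant.\<close>

lemma hom_identity_iff:
  "A \<in> hom_identity G ms m \<longleftrightarrow> (\<exists>s\<in>inv_seqs G ms m. A = (\<lambda>x. seq_scale x s))"
proof
  assume "A \<in> hom_identity G ms m"
  then have A: "\<And>x. A x \<in> inverse_limit ms m" "\<And>x c. A (c * x) = seq_scale c (A x)"
    "\<And>g x. g \<in> group_limit G \<Longrightarrow> A x = act_limit G ms m g (A x)"
    by (auto simp: hom_identity_def intertwiners_def)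
  have "\<forall>g\<in>group_limit G. act_limit G ms m g (A 1) = A 1" by (intro ballI sym[OF A(3)])
  then have "A 1 \<in> inv_seqs G ms m" by (simp only: act_limit_fixed_iff[OF A(1)])
  moreover have "A x = seq_scale x (A 1)" for x using A(2)[of x 1] by (simp only: mult_1_right)
  then have "A = (\<lambda>x. seq_scale x (A 1))" by (rule ext)
  ultimately show "\<exists>s\<in>inv_seqs G ms m. A = (\<lambda>x. seq_scale x s)" by blast
next
  assume "\<exists>s\<in>inv_seqs G ms m. A = (\<lambda>x. seq_scale x s)"
  then obtain s where s: "s \<in> inv_seqs G ms m" and A: "A = (\<lambda>x. seq_scale x s)" by blast
  have c: "seq_scale x s \<in> inv_seqs G ms m" for x by (rule inv_seqs_closed(3)[OF s])
  then have "seq_scale x s \<in> inverse_limit ms m" for x by (simp add: inv_seqs_def)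
  moreover have "act_limit G ms m g (seq_scale x s) = seq_scale x s" if "g \<in> group_limit G" for g x
    using act_limit_fixed_iff[OF calculation] c that by blast
  ultimately show "A \<in> hom_identity G ms m"
    unfolding A hom_identity_def intertwiners_def
    by (auto simp: seq_scale_def fun_eq_iff pscale.scale_left_distrib)
qed

end

subsection \<open>Limits in the Hilbert space\<close>

text \<open>Estimates are carried out with squared norms. The inequality \<open>fsq_add_le\<close>
  takes the place of the triangle inequality at the cost of constant factors.\<close>

definition fsq :: "(mono \<Rightarrow> complex) \<Rightarrow> real" where
  "fsq c = (\<Sum>\<^sub>\<infinity>\<alpha>. fterm c \<alpha>)"

lemma fsq_nonneg: "0 \<le> fsq c"
  by (simp add: fsq_def infsum_nonneg fterm_nonneg)

lemma fnorm_fsq: "fnorm c = sqrt (fsq c)"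
  by (simp add: fnorm_def fsq_def)

lemma fsq_coef: "fsq (coef f) = pnsq f"
  using fnorm_coef[of f] by (simp add: fnorm_fsq)

lemma fsq_add_le: "c \<in> fock \<Longrightarrow> d \<in> fock \<Longrightarrow> fsq (c + d) \<le> 2 * fsq c + 2 * fsq d"
proof -
  assume cd: "c \<in> fock" "d \<in> fock"
  then have s: "fterm c summable_on UNIV" "fterm d summable_on UNIV" by (simp_all add: fock_def)
  have "fsq (c + d) \<le> (\<Sum>\<^sub>\<infinity>\<alpha>. 2 * fterm c \<alpha> + 2 * fterm d \<alpha>)"
    unfolding fsq_def
    by (rule infsum_mono)
      (use fock_add[OF cd] s in \<open>auto simp: fock_def fterm_add_le intro!: summable_on_add summable_on_cmult_right\<close>)
  also have "\<dots> = 2 * fsq c + 2 * fsq d"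
    using s by (simp add: fsq_def infsum_add infsum_cmult_right summable_on_cmult_right)
  finally show ?thesis .
qed

lemma fsq_uminus: "fsq (- c) = fsq c"
  by (simp add: fsq_def fterm_uminus)

lemma fsq_diff_le: "c \<in> fock \<Longrightarrow> d \<in> fock \<Longrightarrow> fsq (c - d) \<le> 2 * fsq c + 2 * fsq d"
  using fsq_add_le[of c "- d"] by (simp add: fsq_uminus) (simp add: fock_def fterm_uminus)

lemma fsq_minus_commute: "fsq (c - d) = fsq (d - c)"
  using fsq_uminus[of "c - d"] by simp

lemma fterm_fscale: "fterm (fscale z c) \<alpha> = (cmod z)\<^sup>2 * fterm c \<alpha>"
  by (simp add: fterm_mfact fscale_def norm_mult power_mult_distrib)

lemma fock_fscale: "c \<in> fock \<Longrightarrow> fscale z c \<in> fock"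
  unfolding fock_def mem_Collect_eq fterm_fscale by (rule summable_on_cmult_right)

lemma fsq_fscale: "fsq (fscale z c) = (cmod z)\<^sup>2 * fsq c"
  unfolding fsq_def fterm_fscale by (rule infsum_cmult_right')

text \<open>Monomials have norm at least 1, so convergence in norm implies convergence of every
  coefficient.\<close>

lemma coef_le_fsq: "c \<in> fock \<Longrightarrow> (cmod (c \<alpha>))\<^sup>2 \<le> fsq c"
proof -
  assume c: "c \<in> fock"
  have "1 \<le> mfact \<alpha>" unfolding mfact_def by (rule prod_ge_1) (simp add: fact_ge_1)
  then have "(cmod (c \<alpha>))\<^sup>2 \<le> fterm c \<alpha>"
    using mult_right_mono[of 1 "mfact \<alpha>" "(cmod (c \<alpha>))\<^sup>2"] by (simp add: fterm_mfact)
  also have "\<dots> = sum (fterm c) {\<alpha>}" by simp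
  also have "\<dots> \<le> fsq c"
    unfolding fsq_def by (rule finite_sum_le_infsum) (use c in \<open>auto simp: fock_def fterm_nonneg\<close>)
  finally show ?thesis .
qed

lemma fock_lim_iff: "fock_lim F c \<longleftrightarrow> (\<forall>j. F j \<in> fock) \<and> c \<in> fock \<and> (\<lambda>j. fsq (F j - c)) \<longlonglongrightarrow> 0"
proof -
  have "(\<lambda>j. sqrt (fsq (F j - c))) \<longlonglongrightarrow> 0 \<longleftrightarrow> (\<lambda>j. fsq (F j - c)) \<longlonglongrightarrow> 0"
    using tendsto_real_sqrt[of "\<lambda>j. fsq (F j - c)" 0 sequentially]
      tendsto_power[of "\<lambda>j. sqrt (fsq (F j - c))" 0 sequentially 2]
    by (auto simp: fsq_nonneg)
  then show ?thesis by (simp add: fock_lim_def fnorm_fsq)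
qed

lemma fock_lim_coef: "fock_lim F c \<Longrightarrow> (\<lambda>j. F j \<alpha>) \<longlonglongrightarrow> c \<alpha>"
proof -
  assume l: "fock_lim F c"
  have "(\<lambda>j. (cmod (F j \<alpha> - c \<alpha>))\<^sup>2) \<longlonglongrightarrow> 0"
  proof (rule tendsto_sandwich[OF _ _ tendsto_const])
    show "(\<lambda>j. fsq (F j - c)) \<longlonglongrightarrow> 0" using l by (simp add: fock_lim_iff)
    have "F j - c \<in> fock" for j using l by (auto simp: fock_lim_iff intro: fock_minus)
    from coef_le_fsq[OF this, of _ \<alpha>]
    show "eventually (\<lambda>j. (cmod (F j \<alpha> - c \<alpha>))\<^sup>2 \<le> fsq (F j - c)) sequentially" by simp
  qed simp
  then have "(\<lambda>j. sqrt ((cmod (F j \<alpha> - c \<alpha>))\<^sup>2)) \<longlonglongrightarrow> sqrt 0" by (rule tendsto_real_sqrt)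
  then have "(\<lambda>j. F j \<alpha> - c \<alpha>) \<longlonglongrightarrow> 0" by (simp add: tendsto_norm_zero_iff)
  then show ?thesis by (rule LIM_zero_cancel)
qed

lemma fock_lim_unique: "fock_lim F c \<Longrightarrow> fock_lim F d \<Longrightarrow> c = d"
  using fock_lim_coef LIMSEQ_unique by blast

lemma fock_lim_const: "c \<in> fock \<Longrightarrow> fock_lim (\<lambda>_. c) c"
  by (simp add: fock_lim_iff fsq_def fterm_def)

lemma fock_lim_add:
  assumes "fock_lim F c" "fock_lim H d"
  shows "fock_lim (\<lambda>j. F j + H j) (c + d)"
proof -
  have f: "F j \<in> fock" "H j \<in> fock" "c \<in> fock" "d \<in> fock" for j using assms by (auto simp: fock_lim_iff)
  have "(\<lambda>j. fsq ((F j + H j) - (c + d))) \<longlonglongrightarrow> 0"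
  proof (rule tendsto_sandwich[OF _ _ tendsto_const])
    have "(\<lambda>j. 2 * fsq (F j - c) + 2 * fsq (H j - d)) \<longlonglongrightarrow> 2 * 0 + 2 * 0"
      using assms by (intro tendsto_intros) (auto simp: fock_lim_iff)
    then show "(\<lambda>j. 2 * fsq (F j - c) + 2 * fsq (H j - d)) \<longlonglongrightarrow> 0" by simp
    have "fsq ((F j + H j) - (c + d)) \<le> 2 * fsq (F j - c) + 2 * fsq (H j - d)" for j
      using fsq_add_le[OF fock_minus[OF f(1,3)] fock_minus[OF f(2,4)], of j j] by (simp add: algebra_simps)
    then show "eventually (\<lambda>j. fsq ((F j + H j) - (c + d)) \<le> 2 * fsq (F j - c) + 2 * fsq (H j - d)) sequentially"
      by simp
  qed (simp add: fsq_nonneg)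
  then show ?thesis using f by (simp add: fock_lim_iff fock_add)
qed

lemma fscale_diff: "fscale z c - fscale z d = fscale z (c - d)"
  by (auto simp: fscale_def fun_eq_iff algebra_simps)

lemma fock_lim_fscale:
  assumes "fock_lim F c"
  shows "fock_lim (\<lambda>j. fscale z (F j)) (fscale z c)"
proof -
  have "(\<lambda>j. (cmod z)\<^sup>2 * fsq (F j - c)) \<longlonglongrightarrow> (cmod z)\<^sup>2 * 0"
    using assms by (intro tendsto_intros) (auto simp: fock_lim_iff)
  then show ?thesis
    using assms by (simp add: fock_lim_iff fock_fscale fscale_diff fsq_fscale)
qed

section \<open>Completions and extension of bounded operators\<close>

lemma coef_add_fun: "coef (f + g) = coef f + coef g"
  by (auto simp: fun_eq_iff lookup_add)

lemma coef_diff_fun: "coef (f - g) = coef f - coef g"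
  by (auto simp: fun_eq_iff lookup_minus)

lemma coef_pscale_fun: "coef (pscale c f) = fscale c (coef f)"
  by (auto simp: fun_eq_iff fscale_def)

lemma completionD: "c \<in> completion X \<Longrightarrow> \<exists>F. (\<forall>j. F j \<in> X) \<and> fock_lim (\<lambda>j. coef (F j)) c"
  by (simp add: completion_def)

lemma completionI: "(\<And>j. F j \<in> X) \<Longrightarrow> fock_lim (\<lambda>j. coef (F j)) c \<Longrightarrow> c \<in> completion X"
  by (auto simp: completion_def)

lemma completion_coef: "f \<in> X \<Longrightarrow> coef f \<in> completion X"
  by (rule completionI[of "\<lambda>_. f"]) (simp_all add: fock_lim_const lookup_in_fock)

lemma completion_add:
  assumes "pscale.subspace X" "c \<in> completion X" "d \<in> completion X"
  shows "c + d \<in> completion X"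
proof -
  obtain F H where "\<And>j. F j \<in> X" "fock_lim (\<lambda>j. coef (F j)) c" "\<And>j. H j \<in> X" "fock_lim (\<lambda>j. coef (H j)) d"
    using assms(2,3) completionD by metis
  then show ?thesis
    using fock_lim_add[of "\<lambda>j. coef (F j)" c "\<lambda>j. coef (H j)" d]
    by (intro completionI[of "\<lambda>j. F j + H j"] pscale.subspace_add[OF assms(1)]) (simp_all add: coef_add_fun)
qed

lemma completion_scale:
  assumes "pscale.subspace X" "c \<in> completion X"
  shows "fscale z c \<in> completion X"
proof -
  obtain F where "\<And>j. F j \<in> X" "fock_lim (\<lambda>j. coef (F j)) c"
    using assms(2) completionD by metis
  then show ?thesis
    using fock_lim_fscale[of "\<lambda>j. coef (F j)" c z]
    by (intro completionI[of "\<lambda>j. pscale z (F j)"] pscale.subspace_scale[OF assms(1)]) (simp_all add: coef_pscale_fun)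
qed

text \<open>Covers the action of a group element as well as an intertwining map. The constant
  \<open>C\<close> bounds squared norms.\<close>

locale bounded_op =
  fixes X :: "cpoly set" and T :: "cpoly \<Rightarrow> cpoly" and C :: real
  assumes sub: "pscale.subspace X"
    and add: "\<And>f g. f \<in> X \<Longrightarrow> g \<in> X \<Longrightarrow> T (f + g) = T f + T g"
    and scale: "\<And>c f. f \<in> X \<Longrightarrow> T (pscale c f) = pscale c (T f)"
    and C0: "0 \<le> C"
    and bound: "\<And>f. f \<in> X \<Longrightarrow> pnsq (T f) \<le> C * pnsq f"
begin

lemma diff: "f \<in> X \<Longrightarrow> g \<in> X \<Longrightarrow> T (f - g) = T f - T g"
  using add[of f "pscale (-1) g"] scale[of g "-1"] pscale.subspace_scale[OF sub, of g "-1"] by simp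

lemma diff_le:
  assumes "f \<in> X" "g \<in> X"
  shows "fsq (coef (T f) - coef (T g)) \<le> C * fsq (coef f - coef g)"
  using bound[OF pscale.subspace_diff[OF sub assms]] diff[OF assms]
  by (simp add: fsq_coef[symmetric] coef_diff_fun)

lemma extend_exists:
  assumes F: "\<And>j. F j \<in> X" and lim: "fock_lim (\<lambda>j. coef (F j)) c"
  shows "\<exists>d. fock_lim (\<lambda>j. coef (T (F j))) d"
proof (rule fock_complete)
  show "coef (T (F j)) \<in> fock" for j by (rule lookup_in_fock)
  fix \<epsilon> :: real assume e: "\<epsilon> > 0"
  have Ff: "coef (F j) - c \<in> fock" for j using lim by (auto simp: fock_lim_iff intro: fock_minus)
  have "(\<lambda>j. fsq (coef (F j) - c)) \<longlonglongrightarrow> 0" using lim by (simp add: fock_lim_iff)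
  \<comment> \<open>The 4 absorbs the two summands of \<open>fsq_diff_le\<close>, each with factor
    2; \<open>C + 1\<close> replaces \<open>C\<close> so that the denominator cannot vanish.\<close>
  moreover have e': "0 < \<epsilon>\<^sup>2 / (4 * (C + 1))" using e C0 by (intro divide_pos_pos) auto
  ultimately obtain N where N: "\<And>j. j \<ge> N \<Longrightarrow> fsq (coef (F j) - c) < \<epsilon>\<^sup>2 / (4 * (C + 1))"
    by (force simp: lim_sequentially dist_real_def fsq_nonneg)
  have "fnorm (coef (T (F i)) - coef (T (F j))) < \<epsilon>" if "i \<ge> N" "j \<ge> N" for i j
  proof -
    have "fsq (coef (F i) - coef (F j)) \<le> 2 * fsq (coef (F i) - c) + 2 * fsq (coef (F j) - c)"
      using fsq_diff_le[OF Ff Ff, of i j] by simp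
    also have "\<dots> < 4 * (\<epsilon>\<^sup>2 / (4 * (C + 1)))" using N[OF that(1)] N[OF that(2)] by simp
    also have "\<dots> = \<epsilon>\<^sup>2 / (C + 1)" using C0 by (simp add: field_simps)
    finally have l: "fsq (coef (F i) - coef (F j)) < \<epsilon>\<^sup>2 / (C + 1)" .
    have "fsq (coef (T (F i)) - coef (T (F j))) \<le> C * fsq (coef (F i) - coef (F j))"
      by (rule diff_le[OF F F])
    also have "\<dots> \<le> (C + 1) * fsq (coef (F i) - coef (F j))"
      by (intro mult_right_mono) (simp_all add: fsq_nonneg)
    also have "\<dots> < \<epsilon>\<^sup>2" using l C0 by (simp add: field_simps)
    finally have "sqrt (fsq (coef (T (F i)) - coef (T (F j)))) < sqrt (\<epsilon>\<^sup>2)"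
      by (rule real_sqrt_less_mono)
    then show ?thesis using e by (simp add: fnorm_fsq)
  qed
  then show "\<exists>N. \<forall>i\<ge>N. \<forall>j\<ge>N. fnorm (coef (T (F i)) - coef (T (F j))) < \<epsilon>" by blast
qed

text \<open>The definite description in \<open>extend\<close> asks for one limit that serves all
  approximating sequences.\<close>

lemma extend_same:
  assumes F: "\<And>j. F j \<in> X" "fock_lim (\<lambda>j. coef (F j)) c" and H: "\<And>j. H j \<in> X" "fock_lim (\<lambda>j. coef (H j)) c"
    and d: "fock_lim (\<lambda>j. coef (T (F j))) d"
  shows "fock_lim (\<lambda>j. coef (T (H j))) d"
proof -
  have f: "coef (F j) - c \<in> fock" "coef (H j) - c \<in> fock" "d \<in> fock" for j
    using F(2) H(2) d by (auto simp: fock_lim_iff intro: fock_minus)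
  let ?b = "\<lambda>j. 2 * (C * (2 * fsq (coef (H j) - c) + 2 * fsq (coef (F j) - c))) + 2 * fsq (coef (T (F j)) - d)"
  have "(\<lambda>j. fsq (coef (T (H j)) - d)) \<longlonglongrightarrow> 0"
  proof (rule tendsto_sandwich[OF _ _ tendsto_const])
    have "?b \<longlonglongrightarrow> 2 * (C * (2 * 0 + 2 * 0)) + 2 * 0"
      using F(2) H(2) d by (intro tendsto_intros) (auto simp: fock_lim_iff)
    then show "?b \<longlonglongrightarrow> 0" by simp
    have "fsq (coef (T (H j)) - d) \<le> ?b j" for j
    proof -
      have "fsq (coef (T (H j)) - d) \<le> 2 * fsq (coef (T (H j)) - coef (T (F j))) + 2 * fsq (coef (T (F j)) - d)"
        using fsq_add_le[of "coef (T (H j)) - coef (T (F j))" "coef (T (F j)) - d"] f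
        by (simp add: fock_minus lookup_in_fock)
      moreover have "fsq (coef (T (H j)) - coef (T (F j))) \<le> C * fsq (coef (H j) - coef (F j))"
        by (rule diff_le[OF H(1) F(1)])
      moreover have "C * fsq (coef (H j) - coef (F j)) \<le> C * (2 * fsq (coef (H j) - c) + 2 * fsq (coef (F j) - c))"
        using fsq_diff_le[OF f(2) f(1), of j j] C0 by (intro mult_left_mono) simp_all
      ultimately show ?thesis by linarith
    qed
    then show "eventually (\<lambda>j. fsq (coef (T (H j)) - d) \<le> ?b j) sequentially" by simp
  qed (simp add: fsq_nonneg)
  then show ?thesis using f by (simp add: fock_lim_iff lookup_in_fock)
qed

lemma extend_lim:
  assumes F: "\<And>j. F j \<in> X" "fock_lim (\<lambda>j. coef (F j)) c"
  shows "fock_lim (\<lambda>j. coef (T (F j))) (extend X T c)"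
proof -
  obtain d where d: "fock_lim (\<lambda>j. coef (T (F j))) d" using extend_exists[OF F] by blast
  have "extend X T c = d" unfolding extend_def
  proof (rule the_equality)
    show "\<forall>H. (\<forall>j. H j \<in> X) \<and> fock_lim (\<lambda>j. coef (H j)) c \<longrightarrow> fock_lim (\<lambda>j. coef (T (H j))) d"
      using extend_same[OF F _ _ d] by blast
    fix d' assume "\<forall>H. (\<forall>j. H j \<in> X) \<and> fock_lim (\<lambda>j. coef (H j)) c \<longrightarrow> fock_lim (\<lambda>j. coef (T (H j))) d'"
    then have "fock_lim (\<lambda>j. coef (T (F j))) d'" using F by blast
    then show "d' = d" using d fock_lim_unique by blast
  qed
  then show ?thesis using d by simp
qed

lemma extend_coef: "f \<in> X \<Longrightarrow> extend X T (coef f) = coef (T f)"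
  using extend_lim[of "\<lambda>_. f" "coef f"] fock_lim_const[OF lookup_in_fock] fock_lim_unique by blast

lemma extend_add:
  assumes "c \<in> completion X" "d \<in> completion X"
  shows "extend X T (c + d) = extend X T c + extend X T d"
proof -
  obtain F H where FH: "\<And>j. F j \<in> X" "fock_lim (\<lambda>j. coef (F j)) c" "\<And>j. H j \<in> X" "fock_lim (\<lambda>j. coef (H j)) d"
    using assms completionD by metis
  have "fock_lim (\<lambda>j. coef (T (F j + H j))) (extend X T (c + d))"
    using fock_lim_add[OF FH(2,4)]
    by (intro extend_lim pscale.subspace_add[OF sub] FH) (simp add: coef_add_fun)
  moreover have "fock_lim (\<lambda>j. coef (T (F j + H j))) (extend X T c + extend X T d)"
    using fock_lim_add[OF extend_lim[OF FH(1,2)] extend_lim[OF FH(3,4)]]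
    by (simp add: add[OF FH(1,3)] coef_add_fun)
  ultimately show ?thesis by (rule fock_lim_unique)
qed

lemma extend_scale:
  assumes "c \<in> completion X"
  shows "extend X T (fscale z c) = fscale z (extend X T c)"
proof -
  obtain F where F: "\<And>j. F j \<in> X" "fock_lim (\<lambda>j. coef (F j)) c"
    using assms completionD by metis
  have "fock_lim (\<lambda>j. coef (T (pscale z (F j)))) (extend X T (fscale z c))"
    using fock_lim_fscale[OF F(2)]
    by (intro extend_lim pscale.subspace_scale[OF sub] F) (simp add: coef_pscale_fun)
  moreover have "fock_lim (\<lambda>j. coef (T (pscale z (F j)))) (fscale z (extend X T c))"
    using fock_lim_fscale[OF extend_lim[OF F]] by (simp add: scale[OF F(1)] coef_pscale_fun)
  ultimately show ?thesis by (rule fock_lim_unique)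
qed

text \<open>The factor 4 results from using \<open>fsq_add_le\<close> twice; any constant yields
  continuity.\<close>

lemma extend_bound:
  assumes "c \<in> completion X"
  shows "fsq (extend X T c) \<le> 4 * C * fsq c"
proof -
  obtain F where F: "\<And>j. F j \<in> X" "fock_lim (\<lambda>j. coef (F j)) c"
    using assms completionD by metis
  note E = extend_lim[OF F]
  have f: "c \<in> fock" "extend X T c \<in> fock" using F(2) E by (auto simp: fock_lim_iff)
  let ?b = "\<lambda>j. 2 * fsq (coef (T (F j)) - extend X T c) + 2 * (C * (2 * fsq (coef (F j) - c) + 2 * fsq c))"
  have "?b \<longlonglongrightarrow> 2 * 0 + 2 * (C * (2 * 0 + 2 * fsq c))"
    using F(2) E by (intro tendsto_intros) (auto simp: fock_lim_iff)
  moreover have "fsq (extend X T c) \<le> ?b j" for j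
  proof -
    have "fsq (extend X T c) \<le> 2 * fsq (extend X T c - coef (T (F j))) + 2 * fsq (coef (T (F j)))"
      using fsq_add_le[of "extend X T c - coef (T (F j))" "coef (T (F j))"] f
      by (simp add: fock_minus lookup_in_fock)
    moreover have "fsq (coef (T (F j))) \<le> C * fsq (coef (F j))"
      using bound[OF F(1)] by (simp add: fsq_coef)
    moreover have "C * fsq (coef (F j)) \<le> C * (2 * fsq (coef (F j) - c) + 2 * fsq c)"
      using fsq_add_le[of "coef (F j) - c" c] f C0
      by (intro mult_left_mono) (simp_all add: fock_minus lookup_in_fock)
    ultimately show ?thesis using fsq_minus_commute[of "extend X T c" "coef (T (F j))"] by simp
  qed
  ultimately have "fsq (extend X T c) \<le> 2 * 0 + 2 * (C * (2 * 0 + 2 * fsq c))"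
    by (intro LIMSEQ_le_const) auto
  then show ?thesis by simp
qed

end

subsection \<open>Continuous intertwining maps\<close>

context tower
begin

text \<open>All members of \<open>tun L l\<close> have degree \<open>tdeg L\<close>, so the bound of
  \<open>act_bounded\<close>, which grows with the degree, becomes a single constant, also for
  elements that are not unitary.\<close>

lemma act_bounded_op:
  assumes "g \<in> group_limit G"
  shows "\<exists>C. bounded_op (tun L l) (act g) C"
proof -
  obtain i where "g \<in> G i" using assms by (auto simp: group_limit_def)
  from act_bounded[OF G_carrier[OF this]] obtain C where C: "C \<ge> 0" "\<And>d f. homog d f \<Longrightarrow> pnsq (act g f) \<le> C ^ d * pnsq f"
    by blast
  have "bounded_op (tun L l) (act g) (C ^ tdeg L)"
    by unfold_locales (use C tun_homog in \<open>auto simp: tun_subspace act_add act_pscale\<close>)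
  then show ?thesis by blast
qed

abbreviation "VU \<equiv> hw_union ms m"
abbreviation "WU \<equiv> tensor_union ms m"

lemma act_op:
  assumes "g \<in> group_limit G"
  shows "\<exists>C. bounded_op VU (act g) C" "\<exists>C. bounded_op WU (act g) C"
  using act_bounded_op[OF assms] by (simp_all add: hw_union_tun tensor_union_tun)

lemma union_act:
  assumes "g \<in> group_limit G"
  shows "f \<in> VU \<Longrightarrow> act g f \<in> VU" "f \<in> WU \<Longrightarrow> act g f \<in> WU"
  using tun_act[OF _ assms] by (simp_all add: hw_union_tun tensor_union_tun)

lemma alg_hom_op:
  assumes T: "T \<in> alg_hom G ms m"
  shows "\<exists>C. bounded_op VU T C"
proof -
  obtain C where "C \<ge> 0" "\<forall>f\<in>VU. pnsq (T f) \<le> C * pnsq f" using alg_hom_bounded[OF T] by blast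
  then have "bounded_op VU T C"
    by unfold_locales (use alg_homD[OF T] hw_union_subspace in auto)
  then show ?thesis by blast
qed

definition \<Psi> :: "(cpoly \<Rightarrow> cpoly) \<Rightarrow> (mono \<Rightarrow> complex) \<Rightarrow> (mono \<Rightarrow> complex)" where
  "\<Psi> T c = (if c \<in> completion VU then extend VU T c else 0)"

lemma \<Psi>_lim:
  assumes T: "T \<in> alg_hom G ms m" and F: "\<And>j. F j \<in> VU" "fock_lim (\<lambda>j. coef (F j)) c"
  shows "fock_lim (\<lambda>j. coef (T (F j))) (\<Psi> T c)"
proof -
  obtain C where "bounded_op VU T C" using alg_hom_op[OF T] by blast
  from bounded_op.extend_lim[OF this F] completionI[OF F] show ?thesis by (simp add: \<Psi>_def)
qed

lemma \<Psi>_hom: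
  assumes T: "T \<in> alg_hom G ms m"
  shows "\<Psi> T \<in> hom_tensor G ms m"
proof -
  obtain C where "bounded_op VU T C" using alg_hom_op[OF T] by blast
  then interpret T: bounded_op VU T C .
  have "\<Psi> T c \<in> completion WU" if c: "c \<in> completion VU" for c
  proof -
    obtain F where F: "\<And>j. F j \<in> VU" "fock_lim (\<lambda>j. coef (F j)) c" using completionD[OF c] by blast
    show ?thesis by (rule completionI[OF alg_homD(1)[OF T F(1)] \<Psi>_lim[OF T F]])
  qed
  moreover have "\<Psi> T (extend VU (act g) c) = extend WU (act g) (\<Psi> T c)"
    if g: "g \<in> group_limit G" and c: "c \<in> completion VU" for g c
  proof -
    obtain F where F: "\<And>j. F j \<in> VU" "fock_lim (\<lambda>j. coef (F j)) c" using completionD[OF c] by blast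
    obtain C1 C2 where o: "bounded_op VU (act g) C1" "bounded_op WU (act g) C2" using act_op[OF g] by blast
    have "fock_lim (\<lambda>j. coef (T (act g (F j)))) (\<Psi> T (extend VU (act g) c))"
      by (rule \<Psi>_lim[OF T union_act(1)[OF g F(1)] bounded_op.extend_lim[OF o(1) F]])
    moreover have "fock_lim (\<lambda>j. coef (act g (T (F j)))) (extend WU (act g) (\<Psi> T c))"
      by (rule bounded_op.extend_lim[OF o(2) alg_homD(1)[OF T F(1)] \<Psi>_lim[OF T F]])
    ultimately show ?thesis
      using fock_lim_unique by (simp add: alg_homD(5)[OF T F(1) g])
  qed
  moreover have "fock_continuous_on (completion VU) (\<Psi> T)"
    unfolding fock_continuous_on_def
  proof (intro ballI allI impI)
    fix x and \<epsilon> :: real assume x: "x \<in> completion VU" and e: "\<epsilon> > 0"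
    \<comment> \<open>The constant of \<open>extend_bound\<close>, increased by 1 to make it
      positive.\<close>
    let ?K = "4 * C + 1"
    have K: "0 < ?K" using T.C0 by simp
    show "\<exists>\<delta>>0. \<forall>y\<in>completion VU. fnorm (y - x) < \<delta> \<longrightarrow> fnorm (\<Psi> T y - \<Psi> T x) < \<epsilon>"
    proof (intro exI[of _ "\<epsilon> / sqrt ?K"] conjI ballI impI)
      show "0 < \<epsilon> / sqrt ?K" using e K by simp
      fix y assume y: "y \<in> completion VU" and d: "fnorm (y - x) < \<epsilon> / sqrt ?K"
      have yx: "y - x \<in> completion VU"
      proof -
        have "y - x = y + fscale (-1) x" by (auto simp: fscale_def fun_eq_iff)
        then show ?thesis using completion_add[OF hw_union_subspace y completion_scale[OF hw_union_subspace x]] by metis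
      qed
      have "\<Psi> T y - \<Psi> T x = extend VU T (y - x)"
        using T.extend_add[OF yx x] x y by (simp add: \<Psi>_def)
      then have "fsq (\<Psi> T y - \<Psi> T x) \<le> 4 * C * fsq (y - x)" using T.extend_bound[OF yx] by simp
      also have "\<dots> \<le> ?K * fsq (y - x)" by (intro mult_right_mono) (simp_all add: fsq_nonneg)
      finally have "fnorm (\<Psi> T y - \<Psi> T x) \<le> sqrt (?K * fsq (y - x))" by (simp add: fnorm_fsq)
      also have "\<dots> = sqrt ?K * fnorm (y - x)" by (simp add: fnorm_fsq real_sqrt_mult)
      also have "\<dots> < \<epsilon>" using d K by (simp add: field_simps)
      finally show "fnorm (\<Psi> T y - \<Psi> T x) < \<epsilon>" .
    qed
  qed
  ultimately show ?thesis
    unfolding hom_tensor_def intertwiners_def mem_Collect_eq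
    by (intro conjI ballI allI impI)
      (auto simp: T.extend_add T.extend_scale completion_add completion_scale hw_union_subspace \<Psi>_def)
qed

lemma \<Psi>_coef:
  assumes T: "T \<in> alg_hom G ms m" and f: "f \<in> VU"
  shows "\<Psi> T (coef f) = coef (T f)"
  using \<Psi>_lim[OF T, of "\<lambda>_. f" "coef f"] f fock_lim_const[OF lookup_in_fock] fock_lim_unique by blast

lemma \<Psi>_inj: "inj_on \<Psi> (alg_hom G ms m)"
proof (rule inj_onI, rule ext)
  fix T T' f assume T: "T \<in> alg_hom G ms m" and T': "T' \<in> alg_hom G ms m" and eq: "\<Psi> T = \<Psi> T'"
  show "T f = T' f"
  proof (cases "f \<in> VU")
    case True
    then have "coef (T f) = coef (T' f)" using \<Psi>_coef[OF T] \<Psi>_coef[OF T'] eq by metis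
    then show ?thesis by (simp only: lookup_inject)
  qed (simp add: alg_homD(2)[OF T] alg_homD(2)[OF T'])
qed

section \<open>Recovering polynomial maps from continuous ones\<close>

lemma coef_trunc: "coef (trunc k f) \<alpha> = (if \<forall>v\<in>keys \<alpha>. snd (snd v) < k then coef f \<alpha> else 0)"
proof -
  define d :: "var \<Rightarrow> complex" where "d v = (if snd (snd v) < k then 1 else 0)" for v
  have "vapply (col_mat (\<lambda>_. proj k)) x = vapply (diag_mat d) x" for x
  proof
    fix v :: var
    obtain i a t where v: "v = (i, a, t)" by (cases v)
    have "{s. proj k s t \<noteq> 0} = (if t < k then {t} else {})" by (auto simp: proj_def)
    then show "vapply (col_mat (\<lambda>_. proj k)) x v = vapply (diag_mat d) x v"
      by (simp add: v vapply_col vapply_diag d_def) (simp add: proj_def)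
  qed
  then have "trunc k f = lsubst (diag_mat d) f"
    by (intro poly_ext) (simp add: trunc_eq col_subst_eq pev_lsubst)
  moreover have "mev d \<alpha> = (if \<forall>v\<in>keys \<alpha>. snd (snd v) < k then 1 else 0)"
  proof (cases "\<forall>v\<in>keys \<alpha>. snd (snd v) < k")
    case False
    then obtain v where v: "v \<in> keys \<alpha>" "\<not> snd (snd v) < k" by blast
    then have "d v ^ coef \<alpha> v = 0" by (simp add: d_def in_keys_iff)
    then have "mev d \<alpha> = 0" unfolding mev_def using v(1) by (intro prod_zero) auto
    then show ?thesis by (simp only: False if_False)
  qed (simp add: mev_def d_def)
  ultimately show ?thesis by (simp add: coef_lsubst_diag)
qed

text \<open>\<open>W k\<close> is finite-dimensional, hence closed.\<close>

lemma completion_columns: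
  assumes d: "d \<in> completion WU" and k: "n \<le> k"
    and van: "\<And>\<alpha> v. d \<alpha> \<noteq> 0 \<Longrightarrow> v \<in> keys \<alpha> \<Longrightarrow> snd (snd v) < k"
  shows "\<exists>p\<in>W k. coef p = d"
proof -
  obtain F where F: "\<And>j. F j \<in> WU" "fock_lim (\<lambda>j. coef (F j)) d" using completionD[OF d] by blast
  \<comment> \<open>Truncation moves the approximants into the fixed space \<open>W k\<close>; by
    \<open>van\<close> it does not change the limits of their coefficients.\<close>
  define H where "H j = trunc k (F j)" for j
  have HW: "H j \<in> W k" for j using F(1)[of j] tensor_trunc by (auto simp: H_def tensor_union_def)
  have Hd: "(\<lambda>j. coef (H j) \<alpha>) \<longlonglongrightarrow> d \<alpha>" for \<alpha>
  proof (cases "\<forall>v\<in>keys \<alpha>. snd (snd v) < k")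
    case True
    show ?thesis unfolding H_def coef_trunc if_P[OF True] by (rule fock_lim_coef[OF F(2)])
  next
    case False
    then have "d \<alpha> = 0" using van by blast
    then show ?thesis unfolding H_def coef_trunc if_not_P[OF False] by simp
  qed
  have "\<exists>E. finite E \<and> E \<subseteq> W k \<and> (\<forall>e\<in>E. \<forall>e'\<in>E. pinner e e' = (if e = e' then 1 else 0)) \<and>
      (\<forall>f\<in>W k. f = (\<Sum>e\<in>E. pscale (pinner f e) e))"
    using finite_tensor_keys tensor_subspace tensor_keys by (rule onb_exists)
  then obtain E where E: "finite E \<and> E \<subseteq> W k \<and> (\<forall>e\<in>E. \<forall>e'\<in>E. pinner e e' = (if e = e' then 1 else 0)) \<and>
      (\<forall>f\<in>W k. f = (\<Sum>e\<in>E. pscale (pinner f e) e))" by (rule exE)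
  \<comment> \<open>The limits of the coordinates in the orthonormal basis. Each coordinate involves
    finitely many coefficients, so coefficientwise convergence suffices.\<close>
  define L where "L e = (\<Sum>\<beta>\<in>keys e. of_real (mfact \<beta>) * (cnj (coef e \<beta>) * d \<beta>))" for e
  have pl: "(\<lambda>j. pinner (H j) e) \<longlonglongrightarrow> L e" for e
  proof -
    have "pinner (H j) e = (\<Sum>\<beta>\<in>keys e. of_real (mfact \<beta>) * (cnj (coef e \<beta>) * coef (H j) \<beta>))" for j
      by (subst pinner_commute) (simp add: pinner_superset[of "keys e"])
    then show ?thesis unfolding L_def by (simp only:) (intro tendsto_intros Hd)
  qed
  define p where "p = (\<Sum>e\<in>E. pscale (L e) e)"
  have "p \<in> W k" unfolding p_def
    using E by (intro pscale.subspace_sum[OF tensor_subspace] pscale.subspace_scale[OF tensor_subspace]) auto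
  moreover have "coef p \<alpha> = d \<alpha>" for \<alpha>
  proof (rule LIMSEQ_unique[OF _ Hd])
    have "H j = (\<Sum>e\<in>E. pscale (pinner (H j) e) e)" for j
      using E HW[of j] by (elim conjE) (erule bspec)
    then have "coef (H j) \<alpha> = coef (\<Sum>e\<in>E. pscale (pinner (H j) e) e) \<alpha>" for j
      by (rule arg_cong[where f = "\<lambda>p. coef p \<alpha>"])
    then have "coef (H j) \<alpha> = (\<Sum>e\<in>E. pinner (H j) e * coef e \<alpha>)" for j
      by (simp only: lookup_sum coef_pscale)
    moreover have "(\<lambda>j. \<Sum>e\<in>E. pinner (H j) e * coef e \<alpha>) \<longlonglongrightarrow> (\<Sum>e\<in>E. L e * coef e \<alpha>)"
      by (intro tendsto_intros pl)
    ultimately show "(\<lambda>j. coef (H j) \<alpha>) \<longlonglongrightarrow> coef p \<alpha>"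
      by (simp add: p_def lookup_sum)
  qed
  ultimately show ?thesis by blast
qed

text \<open>The candidate is the restriction of \<open>A\<close> to polynomials. Its values are
  polynomials again: the tori of the columns from \<open>k\<close> on fix \<open>f\<close>, so the
  power series \<open>A (coef f)\<close> does not involve these columns, and
  \<open>completion_columns\<close> applies.\<close>

lemma \<Psi>_surj:
  assumes A: "A \<in> hom_tensor G ms m"
  shows "\<exists>T\<in>alg_hom G ms m. \<Psi> T = A"
proof -
  have A': "\<forall>x\<in>completion VU. A x \<in> completion WU" "\<forall>x. x \<notin> completion VU \<longrightarrow> A x = 0"
    "\<forall>x\<in>completion VU. \<forall>y\<in>completion VU. A (x + y) = A x + A y"
    "\<forall>c. \<forall>x\<in>completion VU. A (fscale c x) = fscale c (A x)"
    "\<forall>g\<in>group_limit G. \<forall>x\<in>completion VU. A (extend VU (act g) x) = extend WU (act g) (A x)"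
    "fock_continuous_on (completion VU) A"
    using A unfolding hom_tensor_def intertwiners_def mem_Collect_eq by blast+
  note AW = bspec[OF A'(1)] and A0 = A'(2)[rule_format] and Aadd = A'(3)[rule_format]
    and Ascale = A'(4)[rule_format] and Aact = A'(5)[rule_format]
    and Acont = A'(6)[unfolded fock_continuous_on_def, rule_format]
  have poly: "\<exists>p\<in>WU. coef p = A (coef f)" if f: "f \<in> VU" for f
  proof -
    obtain k where k: "n \<le> k" "f \<in> V k" using f by (auto simp: hw_union_def)
    let ?d = "A (coef f)"
    have d: "?d \<in> completion WU" by (rule AW[OF completion_coef[OF f]])
    obtain F where F: "\<And>j. F j \<in> WU" "fock_lim (\<lambda>j. coef (F j)) ?d" using completionD[OF d] by blast
    \<comment> \<open>The extended torus action is accessible only through limits. Computing one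
      coefficient of the limit in two ways shows that it is multiplied by the character of its
      monomial.\<close>
    have wt: "cwt l \<alpha> = 0" if l: "k \<le> l" and nz: "?d \<alpha> \<noteq> 0" for l \<alpha>
    proof (rule circle_weight[OF _ nz])
      fix z assume z: "cmod z = 1"
      have g: "tor l z \<in> group_limit G" by (rule limit_I[OF U_G[OF tor_U[OF lessI z]]])
      obtain C1 C2 where o: "bounded_op VU (act (tor l z)) C1" "bounded_op WU (act (tor l z)) C2"
        using act_op[OF g] by blast
      have "act (tor l z) f = f"
        using act_tor_outside[of f "[m]" k l z] k l by (simp add: tensor_single)
      then have "extend WU (act (tor l z)) ?d = ?d"
        using Aact[OF g completion_coef[OF f]] bounded_op.extend_coef[OF o(1) f] by simp
      then have "(\<lambda>j. coef (act (tor l z) (F j)) \<alpha>) \<longlonglongrightarrow> ?d \<alpha>"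
        using fock_lim_coef[OF bounded_op.extend_lim[OF o(2) F], of \<alpha>] by (simp only:)
      moreover have "(\<lambda>j. coef (act (tor l z) (F j)) \<alpha>) \<longlonglongrightarrow> z ^ cwt l \<alpha> * ?d \<alpha>"
        unfolding coef_act_tor by (intro tendsto_intros fock_lim_coef[OF F(2)])
      ultimately have "?d \<alpha> = z ^ cwt l \<alpha> * ?d \<alpha>" by (rule LIMSEQ_unique)
      then show "z ^ cwt l \<alpha> * ?d \<alpha> = z ^ 0 * ?d \<alpha>" by simp
    qed
    have "\<exists>p\<in>W k. coef p = ?d"
    proof (rule completion_columns[OF d k(1)], rule ccontr)
      fix \<alpha> v assume nz: "?d \<alpha> \<noteq> 0" and v: "v \<in> keys \<alpha>" and "\<not> snd (snd v) < k"
      then have "cwt (snd (snd v)) \<alpha> = 0" by (intro wt) simp_all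
      from cwt_0[OF this v] show False by simp
    qed
    then show ?thesis using k(1) by (auto simp: tensor_union_def)
  qed
  define T where "T f = (if f \<in> VU then SOME p. p \<in> WU \<and> coef p = A (coef f) else 0)" for f
  have T: "T f \<in> WU" "coef (T f) = A (coef f)" if f: "f \<in> VU" for f
    using someI_ex[of "\<lambda>p. p \<in> WU \<and> coef p = A (coef f)"] poly[OF f] f by (auto simp: T_def)
  have TH: "T \<in> alg_hom G ms m"
    unfolding alg_hom_def intertwiners_def mem_Collect_eq
  proof (intro conjI ballI allI impI)
    fix f assume f: "f \<in> VU"
    note cf = completion_coef[OF f]
    show "T f \<in> WU" by (rule T(1)[OF f])
    fix h assume h: "h \<in> VU"
    have "coef (T (f + h)) = coef (T f + T h)"
      using T(2)[OF pscale.subspace_add[OF hw_union_subspace f h]]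
      by (simp add: coef_add_fun Aadd cf completion_coef[OF h] T(2) f h)
    then show "T (f + h) = T f + T h" by (simp only: lookup_inject)
  next
    fix c f assume f: "f \<in> VU"
    have "coef (T (pscale c f)) = coef (pscale c (T f))"
      using T(2)[OF pscale.subspace_scale[OF hw_union_subspace f]]
      by (simp add: coef_pscale_fun Ascale completion_coef[OF f] T(2) f)
    then show "T (pscale c f) = pscale c (T f)" by (simp only: lookup_inject)
  next
    fix g f assume g: "g \<in> group_limit G" and f: "f \<in> VU"
    obtain C1 C2 where o: "bounded_op VU (act g) C1" "bounded_op WU (act g) C2" using act_op[OF g] by blast
    have "coef (T (act g f)) = A (extend VU (act g) (coef f))"
      using T(2)[OF union_act(1)[OF g f]] bounded_op.extend_coef[OF o(1) f] by simp
    also have "\<dots> = extend WU (act g) (coef (T f))"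
      using Aact[OF g completion_coef[OF f]] T(2)[OF f] by simp
    also have "\<dots> = coef (act g (T f))" by (rule bounded_op.extend_coef[OF o(2) T(1)[OF f]])
    finally show "T (act g f) = act g (T f)" by (simp only: lookup_inject)
  qed (simp add: T_def)
  \<comment> \<open>Both sides are limits of \<open>T\<close> along one sequence of polynomials
    tending to \<open>c\<close>; for \<open>A\<close> this is its continuity.\<close>
  moreover have "\<Psi> T c = A c" for c
  proof (cases "c \<in> completion VU")
    case True
    then obtain F where F: "\<And>j. F j \<in> VU" "fock_lim (\<lambda>j. coef (F j)) c" using completionD by blast
    have FV: "coef (F j) \<in> completion VU" for j by (rule completion_coef[OF F(1)])
    have "A c \<in> fock" using completionD[OF AW[OF True]] by (auto simp: fock_lim_def)
    moreover have "(\<lambda>j. fnorm (A (coef (F j)) - A c)) \<longlonglongrightarrow> 0"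
    proof (rule LIMSEQ_I)
      fix \<epsilon> :: real assume "\<epsilon> > 0"
      from Acont[OF True this] obtain \<delta> where \<delta>: "\<delta> > 0"
        "\<And>y. y \<in> completion VU \<Longrightarrow> fnorm (y - c) < \<delta> \<Longrightarrow> fnorm (A y - A c) < \<epsilon>" by blast
      have "(\<lambda>j. fnorm (coef (F j) - c)) \<longlonglongrightarrow> 0" using F(2) by (simp add: fock_lim_def)
      from LIMSEQ_D[OF this \<delta>(1)] obtain N where N: "\<And>j. j \<ge> N \<Longrightarrow> norm (fnorm (coef (F j) - c)) < \<delta>" by auto
      have nn: "norm (fnorm x) = fnorm x" for x by (simp add: fnorm_fsq fsq_nonneg)
      show "\<exists>N. \<forall>j\<ge>N. norm (fnorm (A (coef (F j)) - A c) - 0) < \<epsilon>"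
        using N \<delta>(2)[OF FV] by (intro exI[of _ N]) (simp add: nn del: real_norm_def)
    qed
    ultimately have "fock_lim (\<lambda>j. coef (T (F j))) (A c)"
      unfolding fock_lim_def by (simp add: lookup_in_fock T(2)[OF F(1)] flip: T(2)[OF F(1)])
    then show ?thesis using \<Psi>_lim[OF TH F] fock_lim_unique by blast
  qed (simp add: \<Psi>_def A0)
  ultimately show ?thesis by (intro bexI[of _ T]) auto
qed

lemma \<Psi>_image: "\<Psi> ` alg_hom G ms m = hom_tensor G ms m"
  using \<Psi>_hom \<Psi>_surj by blast

lemma alg_hom_closed:
  shows "0 \<in> alg_hom G ms m"
    and "T \<in> alg_hom G ms m \<Longrightarrow> T' \<in> alg_hom G ms m \<Longrightarrow> T + T' \<in> alg_hom G ms m"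
    and "T \<in> alg_hom G ms m \<Longrightarrow> map_scale pscale c T \<in> alg_hom G ms m"
  using tensor_union_subspace
  by (auto simp: alg_hom_def intertwiners_def map_scale_def pscale.subspace_def act_add act_pscale
      pscale.scale_right_distrib pscale.scale_left_commute)
    (simp add: act_eq)

lemma \<Psi>_add:
  assumes T: "T \<in> alg_hom G ms m" and T': "T' \<in> alg_hom G ms m"
  shows "\<Psi> (T + T') = \<Psi> T + \<Psi> T'"
proof
  fix c
  show "\<Psi> (T + T') c = (\<Psi> T + \<Psi> T') c"
  proof (cases "c \<in> completion VU")
    case True
    then obtain F where F: "\<And>j. F j \<in> VU" "fock_lim (\<lambda>j. coef (F j)) c" using completionD by blast
    have "fock_lim (\<lambda>j. coef ((T + T') (F j))) (\<Psi> (T + T') c)"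
      by (rule \<Psi>_lim[OF alg_hom_closed(2)[OF T T'] F])
    moreover have "fock_lim (\<lambda>j. coef ((T + T') (F j))) (\<Psi> T c + \<Psi> T' c)"
      using fock_lim_add[OF \<Psi>_lim[OF T F] \<Psi>_lim[OF T' F]] by (simp add: coef_add_fun)
    ultimately show ?thesis using fock_lim_unique by simp
  qed (simp add: \<Psi>_def)
qed

lemma \<Psi>_scale:
  assumes T: "T \<in> alg_hom G ms m"
  shows "\<Psi> (map_scale pscale z T) = map_scale fscale z (\<Psi> T)"
proof
  fix c
  show "\<Psi> (map_scale pscale z T) c = map_scale fscale z (\<Psi> T) c"
  proof (cases "c \<in> completion VU")
    case True
    then obtain F where F: "\<And>j. F j \<in> VU" "fock_lim (\<lambda>j. coef (F j)) c" using completionD by blast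
    have "fock_lim (\<lambda>j. coef (map_scale pscale z T (F j))) (\<Psi> (map_scale pscale z T) c)"
      by (rule \<Psi>_lim[OF alg_hom_closed(3)[OF T] F])
    moreover have "fock_lim (\<lambda>j. coef (map_scale pscale z T (F j))) (fscale z (\<Psi> T c))"
      using fock_lim_fscale[OF \<Psi>_lim[OF T F]] by (simp add: map_scale_def coef_pscale_fun)
    ultimately show ?thesis using fock_lim_unique by (simp add: map_scale_def)
  qed (auto simp: \<Psi>_def map_scale_def fscale_def)
qed

end

subsection \<open>Dimensions\<close>

text \<open>Since \<open>\<phi>\<close> is linear on \<open>S\<close> only, a basis is chosen inside
  \<open>S\<close> and its image is shown to be independent and spanning.\<close>

lemma edim_image_finite:
  fixes s1 :: "complex \<Rightarrow> 'v \<Rightarrow> 'v::ab_group_add" and s2 :: "complex \<Rightarrow> 'w \<Rightarrow> 'w::ab_group_add"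
  assumes vs: "vector_space s1" "vector_space s2" and sub: "module.subspace s1 S"
    and add: "\<And>x y. x \<in> S \<Longrightarrow> y \<in> S \<Longrightarrow> \<phi> (x + y) = \<phi> x + \<phi> y"
    and scale: "\<And>c x. x \<in> S \<Longrightarrow> \<phi> (s1 c x) = s2 c (\<phi> x)"
    and inj: "inj_on \<phi> S" and fin: "finite B0" "S \<subseteq> module.span s1 B0"
  shows "\<exists>B. finite B \<and> \<phi> ` S \<subseteq> module.span s2 B" "vector_space.dim s2 (\<phi> ` S) = vector_space.dim s1 S"
proof -
  interpret v1: vector_space s1 by fact
  interpret v2: vector_space s2 by fact
  have \<phi>0: "\<phi> 0 = 0" using scale[OF v1.subspace_0[OF sub], of 0] by simp
  have sum: "\<phi> (\<Sum>b\<in>A. s1 (c b) b) = (\<Sum>b\<in>A. s2 (c b) (\<phi> b))" if "finite A" "A \<subseteq> S" for A c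
    using that
  proof (induction A rule: finite_induct)
    case (insert b A)
    have "(\<Sum>b\<in>A. s1 (c b) b) \<in> S" by (intro v1.subspace_sum[OF sub] v1.subspace_scale[OF sub]) (use insert in auto)
    then show ?case using insert v1.subspace_scale[OF sub] by (simp add: add scale)
  qed (simp add: \<phi>0)
  obtain B where B: "B \<subseteq> S" "v1.independent B" "S \<subseteq> v1.span B" "card B = v1.dim S"
    using v1.basis_exists[of S] by blast
  have "B \<subseteq> v1.span B0" using B(1) fin(2) by blast
  then have fB: "finite B" using v1.independent_span_bound[OF fin(1) B(2)] by blast
  have injB: "inj_on \<phi> B" using inj B(1) inj_on_subset by blast
  have ind: "v2.independent (\<phi> ` B)"
  proof (rule v2.independent_if_scalars_zero)
    show "finite (\<phi> ` B)" using fB by simp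
    fix f x assume z: "(\<Sum>x\<in>\<phi> ` B. s2 (f x) x) = 0" and x: "x \<in> \<phi> ` B"
    have "\<phi> (\<Sum>b\<in>B. s1 (f (\<phi> b)) b) = 0" using z sum[OF fB B(1)] injB by (simp add: sum.reindex)
    moreover have "(\<Sum>b\<in>B. s1 (f (\<phi> b)) b) \<in> S"
      by (intro v1.subspace_sum[OF sub] v1.subspace_scale[OF sub]) (use B in auto)
    ultimately have "(\<Sum>b\<in>B. s1 (f (\<phi> b)) b) = 0"
      using inj \<phi>0 v1.subspace_0[OF sub] by (metis inj_onD)
    then have "f (\<phi> b) = 0" if "b \<in> B" for b
      using v1.independentD[OF B(2) fB subset_refl, of "\<lambda>b. f (\<phi> b)"] that by simp
    then show "f x = 0" using x by blast
  qed
  have span: "\<phi> ` S \<subseteq> v2.span (\<phi> ` B)"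
  proof clarify
    fix x assume "x \<in> S"
    then have "x \<in> v1.span B" using B(3) by blast
    then obtain c where "x = (\<Sum>b\<in>B. s1 (c b) b)" using v1.span_finite[OF fB] by auto
    then have x: "\<phi> x = (\<Sum>b\<in>B. s2 (c b) (\<phi> b))" using sum[OF fB B(1)] by simp
    show "\<phi> x \<in> v2.span (\<phi> ` B)"
      unfolding x by (intro v2.span_sum v2.span_scale v2.span_base imageI)
  qed
  show "\<exists>B. finite B \<and> \<phi> ` S \<subseteq> v2.span B" using fB span by blast
  have "v2.dim (\<phi> ` S) = card (\<phi> ` B)"
    by (rule v2.dim_unique[OF _ span ind]) (use B(1) in auto)
  then show "v2.dim (\<phi> ` S) = v1.dim S" using B(4) card_image[OF injB] by simp
qed

text \<open>The inverse map is linear on the image, so finite generation passes in both directions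
  and the value \<infinity> is preserved too.\<close>

lemma edim_image:
  fixes s1 :: "complex \<Rightarrow> 'v \<Rightarrow> 'v::ab_group_add" and s2 :: "complex \<Rightarrow> 'w \<Rightarrow> 'w::ab_group_add"
  assumes vs: "vector_space s1" "vector_space s2" and sub: "module.subspace s1 S"
    and add: "\<And>x y. x \<in> S \<Longrightarrow> y \<in> S \<Longrightarrow> \<phi> (x + y) = \<phi> x + \<phi> y"
    and scale: "\<And>c x. x \<in> S \<Longrightarrow> \<phi> (s1 c x) = s2 c (\<phi> x)"
    and inj: "inj_on \<phi> S"
  shows "edim s2 (\<phi> ` S) = edim s1 S"
proof -
  interpret v1: vector_space s1 by fact
  interpret v2: vector_space s2 by fact
  let ?\<psi> = "the_inv_into S \<phi>"
  have \<psi>: "?\<psi> (\<phi> x) = x" if "x \<in> S" for x by (rule the_inv_into_f_f[OF inj that])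
  have img: "?\<psi> ` (\<phi> ` S) = S" using \<psi> by force
  have \<phi>0: "\<phi> 0 = 0" using scale[OF v1.subspace_0[OF sub], of 0] by simp
  have sub2: "v2.subspace (\<phi> ` S)"
    unfolding v2.subspace_def
  proof (intro conjI ballI allI)
    show "0 \<in> \<phi> ` S" using \<phi>0 v1.subspace_0[OF sub] by force
    fix x assume "x \<in> \<phi> ` S"
    then obtain x' where x: "x' \<in> S" "x = \<phi> x'" by blast
    show "s2 c x \<in> \<phi> ` S" for c
      using v1.subspace_scale[OF sub x(1), of c] by (simp add: x(2) flip: scale[OF x(1)])
    fix y assume "y \<in> \<phi> ` S"
    then obtain y' where y: "y' \<in> S" "y = \<phi> y'" by blast
    show "x + y \<in> \<phi> ` S"
      by (rule image_eqI[OF _ v1.subspace_add[OF sub x(1) y(1)]]) (simp add: x y add)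
  qed
  have \<psi>add: "?\<psi> (x + y) = ?\<psi> x + ?\<psi> y" if "x \<in> \<phi> ` S" "y \<in> \<phi> ` S" for x y
  proof -
    from that obtain x' y' where xy: "x' \<in> S" "x = \<phi> x'" "y' \<in> S" "y = \<phi> y'" by blast
    have "x + y = \<phi> (x' + y')" using add xy by simp
    then show ?thesis using \<psi> xy v1.subspace_add[OF sub xy(1,3)] by simp
  qed
  have \<psi>scale: "?\<psi> (s2 c x) = s1 c (?\<psi> x)" if "x \<in> \<phi> ` S" for c x
  proof -
    from that obtain x' where x: "x' \<in> S" "x = \<phi> x'" by blast
    have "s2 c x = \<phi> (s1 c x')" using scale x by simp
    then show ?thesis using \<psi> x v1.subspace_scale[OF sub x(1)] by simp
  qed
  have finite_span: "\<exists>B. finite B \<and> S \<subseteq> v1.span B" if "finite B" "\<phi> ` S \<subseteq> v2.span B" for B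
    using edim_image_finite(1)[of s2 s1 "\<phi> ` S" ?\<psi> B] vs sub2 \<psi>add \<psi>scale inj_on_the_inv_into[OF inj] that
    unfolding img by blast
  show ?thesis
  proof (cases "\<exists>B. finite B \<and> S \<subseteq> v1.span B")
    case True
    then obtain B where B: "finite B" "S \<subseteq> v1.span B" by blast
    show ?thesis
      using edim_image_finite[OF vs sub add scale inj B] True unfolding edim_def by simp
  next
    case False
    then have "\<not> (\<exists>B. finite B \<and> \<phi> ` S \<subseteq> v2.span B)" using finite_span by blast
    then show ?thesis using False unfolding edim_def by (simp only: if_False)
  qed
qed

lemma vector_space_scales:
  "vector_space seq_scale" "vector_space (map_scale pscale)"
proof -
  show "vector_space seq_scale"
    unfolding seq_scale_def by (rule vector_space_fun) (rule pscale.vector_space_axioms)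
  show "vector_space (map_scale pscale)"
    unfolding map_scale_def by (rule vector_space_fun) (rule pscale.vector_space_axioms)
qed

context tower
begin

lemma edim_alg_hom: "edim (map_scale pscale) (alg_hom G ms m) = edim seq_scale (inv_seqs G ms m)"
  unfolding \<Phi>_image[symmetric]
proof (rule edim_image[OF vector_space_scales])
  interpret vector_space seq_scale by (rule vector_space_scales)
  show "subspace (inv_seqs G ms m)" using inv_seqs_closed by (simp add: subspace_def)
qed (simp_all add: \<Phi>_add \<Phi>_scale \<Phi>_inj)

lemma edim_hom_tensor: "edim (map_scale fscale) (hom_tensor G ms m) = edim (map_scale pscale) (alg_hom G ms m)"
  unfolding \<Psi>_image[symmetric]
proof (rule edim_image[OF vector_space_scales(2) vector_space_map_fscale])
  interpret vector_space "map_scale pscale" by (rule vector_space_scales)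
  show "subspace (alg_hom G ms m)" using alg_hom_closed by (simp add: subspace_def)
qed (simp_all add: \<Psi>_add \<Psi>_scale \<Psi>_inj)

lemma edim_hom_identity: "edim (map_scale seq_scale) (hom_identity G ms m) = edim seq_scale (inv_seqs G ms m)"
proof -
  interpret vector_space seq_scale by (rule vector_space_scales)
  have "hom_identity G ms m = (\<lambda>s x. seq_scale x s) ` inv_seqs G ms m"
    using hom_identity_iff by auto
  moreover have "edim (map_scale seq_scale) ((\<lambda>s x. seq_scale x s) ` inv_seqs G ms m) = edim seq_scale (inv_seqs G ms m)"
  proof (rule edim_image[OF vector_space_scales(1) vector_space_map_seq_scale])
    show "subspace (inv_seqs G ms m)" using inv_seqs_closed by (simp add: subspace_def)
    show "inj_on (\<lambda>s x. seq_scale x s) (inv_seqs G ms m)"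
    proof (rule inj_onI)
      fix s t assume "(\<lambda>x. seq_scale x s) = (\<lambda>x. seq_scale x t)"
      from fun_cong[OF this, of 1] show "s = t" by simp
    qed
  qed (auto simp: fun_eq_iff map_scale_def scale_right_distrib scale_left_commute mult.commute)
  ultimately show ?thesis by simp
qed

end

theorem mainTheorem3:
  fixes G :: "nat \<Rightarrow> cmat set" and ms :: "nat list list" and m :: "nat list"
  assumes "G = U_group \<or> G = GL_group"
    and "\<forall>\<mu>\<in>set ms. signature \<mu>"
    and "signature m"
  shows "multiplicity_tensor G ms m = multiplicity_identity G ms m"
proof -
  interpret tower G ms m by unfold_locales fact
  show ?thesis
    by (simp add: multiplicity_tensor_def multiplicity_identity_def edim_hom_tensor edim_alg_hom
        edim_hom_identity)
qed

end
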